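(* Assume (A.1) and (A.2). Then for every $\xi\in\mathbb{R}$, \[ \operatorname{s-lim}_{t\to\infty}\exp\Big(i\xi\frac{\hat x(t)}{t}\Big)\Pi_{\rm ac}(U)=\exp(i\xi\hat v_+)\Pi_{\rm ac}(U). \]
   Context: $\mathcal{H}=\ell^2(\mathbb{Z};\mathbb{C}^2)$; shift $(S\Psi)(x)=(\Psi^{(0)}(x+1),\Psi^{(1)}(x-1))^T$; for $\{C(x)\}\subset U(2)$, $(C\Psi)(x)=C(x)\Psi(x)$, $U=SC$; for $C_0\in U(2)$, $U_0=SC_0$. (A.1): there are $c_1,\epsilon>0$ with $\|C(x)-C_0\|\le c_1|x|^{-1-\epsilon}$ for $x\ne0$. $\hat U_0(k)=\operatorname{diag}(e^{ik},e^{-ik})C_0=\sum_{j=1,2}\lambda_j(k)|u_j(k)\rangle\langle u_j(k)|$, $k\in[0,2\pi)$, with eigenvalues $\lambda_j(k)$ differentiable in $k$ and orthonormal eigenvectors $u_j(k)$. (A.2): each $u_j$ is continuously differentiable with $\sup_k\|u_j'(k)\|<\infty$. $\mathscr{F}\Psi(k)=\sum_x e^{-ikx}\Psi(x)$; $\hat v_0=\mathscr{F}^{-1}\big(\sum_j\frac{i\lambda_j'(k)}{\lambda_j(k)}|u_j(k)\rangle\langle u_j(k)|\big)\mathscr{F}$. $\Pi_{\rm ac}(V)$ is the projection onto the absolutely continuous subspace of a unitary $V$. $W_+=\operatorname{s-lim}_{t\to\infty}U^{-t}U_0^t\Pi_{\rm ac}(U_0)$ (existing and complete under (A.1)), and $\hat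 v_+=W_+\hat v_0W_+^*$, so $\exp(i\xi\hat v_+)\Pi_{\rm ac}(U)=W_+\exp(i\xi\hat v_0)W_+^*\Pi_{\rm ac}(U)$. $\hat x$ is the position operator $(\hat x\Psi)(x)=x\Psi(x)$, $\hat x(t)=U^{-t}\hat xU^t$. *)

theory Defs
  imports "HOL-Analysis.Analysis"
begin

text \<open>States: functions int => complex^2 (component "0" of the paper is index 1,
component "1" is index 2 of the index type 2). The Hilbert space H is the set of
square-summable such functions.\<close>

type_synonym state = "int \<Rightarrow> complex^2"

definition cinner :: "complex^'n \<Rightarrow> complex^'n \<Rightarrow> complex" where
  "cinner a b = (\<Sum>i\<in>UNIV. cnj (a$i) * b$i)"

definition adjm :: "complex^'n^'n \<Rightarrow> complex^'n^'n" where
  "adjm C = (\<chi> i j. cnj (C$j$i))"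

definition unitary_mat :: "complex^'n^'n \<Rightarrow> bool" where
  "unitary_mat C \<longleftrightarrow> adjm C ** C = mat 1 \<and> C ** adjm C = mat 1"

definition l2 :: "state \<Rightarrow> bool" where
  "l2 \<Psi> \<longleftrightarrow> (\<lambda>x. (norm (\<Psi> x))\<^sup>2) summable_on UNIV"

definition l2norm :: "state \<Rightarrow> real" where
  "l2norm \<Psi> = sqrt (\<Sum>\<^sub>\<infinity>x. (norm (\<Psi> x))\<^sup>2)"

definition linner :: "state \<Rightarrow> state \<Rightarrow> complex" where
  "linner \<phi> \<psi> = (\<Sum>\<^sub>\<infinity>x. cinner (\<phi> x) (\<psi> x))"

definition shift :: "state \<Rightarrow> state" where
  "shift \<Psi> x = (\<chi> i. if i = 1 then \<Psi> (x+1) $ 1 else \<Psi> (x-1) $ 2)"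

definition coin :: "(int \<Rightarrow> complex^2^2) \<Rightarrow> state \<Rightarrow> state" where
  "coin C \<Psi> x = C x *v \<Psi> x"

definition walk :: "(int \<Rightarrow> complex^2^2) \<Rightarrow> state \<Rightarrow> state" where
  "walk C \<Psi> = shift (coin C \<Psi>)"

definition upow :: "(state \<Rightarrow> state) \<Rightarrow> int \<Rightarrow> state \<Rightarrow> state" where
  "upow V n = (if n \<ge> 0 then V ^^ nat n else inv V ^^ nat (-n))"

text \<open>Absolutely continuous subspace of a unitary V: those psi whose spectral measure
(the finite measure on the circle, parametrised by theta in [0,2pi], whose Fourier
coefficients are <psi, V^n psi>) has a density w.r.t. Lebesgue measure.\<close>
definition Hac :: "(state \<Rightarrow> state) \<Rightarrow> state set" where
  "Hac V = {\<psi>. l2 \<psi> \<and> (\<exists>f::real \<Rightarrow> real. (\<forall>\<theta>. f \<theta> \<ge> 0) \<and> f integrable_on {0..2*pi} \<and>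
     (\<forall>n::int. linner \<psi> (upow V n \<psi>) =
        integral {0..2*pi} (\<lambda>\<theta>. exp (\<i> * of_int n * of_real \<theta>) * of_real (f \<theta>))))}"

definition Pac :: "(state \<Rightarrow> state) \<Rightarrow> state \<Rightarrow> state" where
  "Pac V \<psi> = (THE p. p \<in> Hac V \<and> (\<forall>\<phi>\<in>Hac V. linner \<phi> (\<lambda>x. \<psi> x - p x) = 0))"

definition Wplus :: "(state \<Rightarrow> state) \<Rightarrow> (state \<Rightarrow> state) \<Rightarrow> state \<Rightarrow> state" where
  "Wplus U U0 \<psi> = (THE \<phi>. l2 \<phi> \<and>
     (\<lambda>t. l2norm (\<lambda>x. (inv U ^^ t) ((U0 ^^ t) (Pac U0 \<psi>)) x - \<phi> x)) \<longlonglongrightarrow> 0)"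

definition adj :: "(state \<Rightarrow> state) \<Rightarrow> state \<Rightarrow> state" where
  "adj A \<phi> = (THE \<psi>. l2 \<psi> \<and> (\<forall>w. l2 w \<longrightarrow> linner \<psi> w = linner \<phi> (A w)))"

definition fourier :: "state \<Rightarrow> real \<Rightarrow> complex^2" where
  "fourier \<Psi> = (SOME g. g measurable_on {0..2*pi} \<and>
     (\<forall>N::nat. (\<lambda>k. (norm ((\<Sum>x\<in>{-int N..int N}. exp (- \<i> * of_real k * of_int x) *s \<Psi> x) - g k))\<^sup>2)
                  integrable_on {0..2*pi}) \<and>
     (\<lambda>N::nat. integral {0..2*pi}
        (\<lambda>k. (norm ((\<Sum>x\<in>{-int N..int N}. exp (- \<i> * of_real k * of_int x) *s \<Psi> x) - g k))\<^sup>2))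
       \<longlonglongrightarrow> 0)"

definition fourier_inv :: "(real \<Rightarrow> complex^2) \<Rightarrow> state" where
  "fourier_inv h x = complex_of_real (1 / (2*pi)) *s
     integral {0..2*pi} (\<lambda>k. exp (\<i> * of_real k * of_int x) *s h k)"

definition outer :: "complex \<Rightarrow> complex^2 \<Rightarrow> complex^2^2" where
  "outer c v = (\<chi> a b. c * v$a * cnj (v$b))"

definition U0hat :: "complex^2^2 \<Rightarrow> real \<Rightarrow> complex^2^2" where
  "U0hat C0 k = (\<chi> a b. if a = b then (if a = 1 then exp (\<i> * of_real k) else exp (- \<i> * of_real k)) else 0) ** C0"

definition deriv02 :: "(real \<Rightarrow> 'a::real_normed_vector) \<Rightarrow> real \<Rightarrow> 'a" where
  "deriv02 f k = vector_derivative f (at k within {0..<2*pi})"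

text \<open>exp(i xi v_0) = F^{-1} ( sum_j exp(i xi (i lambda_j'/lambda_j)) |u_j><u_j| ) F
 (functional calculus of the Fourier multiplier v_0, written in its spectral form).\<close>
definition exp_v0 :: "real \<Rightarrow> (2 \<Rightarrow> real \<Rightarrow> complex) \<Rightarrow> (2 \<Rightarrow> real \<Rightarrow> complex^2) \<Rightarrow> state \<Rightarrow> state" where
  "exp_v0 \<xi> lam u \<Psi> = fourier_inv (\<lambda>k.
     (\<Sum>j\<in>UNIV. outer (exp (\<i> * of_real \<xi> * (\<i> * deriv02 (lam j) k / lam j k))) (u j k))
       *v fourier \<Psi> k)"

definition exp_x :: "real \<Rightarrow> state \<Rightarrow> state" where
  "exp_x s \<Psi> x = exp (\<i> * of_real (s * of_int x)) *s \<Psi> x"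

end

theory Submission
  imports Defs
begin

text \<open>Write \<open>U = SC\<close> and \<open>U\<^sub>0 = SC\<^sub>0\<close>. By (A.1), \<open>U - U\<^sub>0\<close> is of trace class, so the wave limits of
  \<open>U\<^sup>-\<^sup>t U\<^sub>0\<^sup>t\<close> and \<open>U\<^sub>0\<^sup>-\<^sup>t U\<^sup>t\<close> exist on the absolutely continuous subspaces (Kato, Rosenblum, Pearson):
  vectors with bounded spectral density are dense there, and for them
  \<open>\<parallel>(B\<^sup>-\<^sup>p\<^sup>-\<^sup>q A\<^sup>p\<^sup>+\<^sup>q - B\<^sup>-\<^sup>p A\<^sup>p) \<psi>\<parallel>\<^sup>2 = 2 (\<parallel>\<psi>\<parallel>\<^sup>2 - \<langle>A\<^sup>p\<^sup>+\<^sup>q \<psi>, B\<^sup>q A\<^sup>p \<psi>\<rangle>)\<close>; telescoping the overlap in \<open>p\<close> bounds the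
  right-hand side by tails of the square-summable sequences \<open>\<langle>g, A\<^sup>r \<psi>\<rangle>\<close>, uniformly in \<open>q\<close>.
  Hence \<open>U\<^sup>t \<psi>\<close> is asymptotic to \<open>U\<^sub>0\<^sup>t W\<^sup>* \<psi>\<close>, and the claim reduces to the free walk. There
  \<open>exp (i s x)\<close> translates the quasi-momentum by \<open>s\<close>, and
  \<open>(\<lambda>(k - \<xi>/t) / \<lambda>(k))\<^sup>t\<close> tends to \<open>exp (- \<xi> \<lambda>'(k) / \<lambda>(k))\<close>, so dominated convergence applies.

  The projection onto the absolutely continuous subspace of \<open>U\<^sub>0\<close> is either zero or the identity.
      If the
  diagonal of \<open>C\<^sub>0\<close> vanishes, then \<open>U\<^sub>0\<^sup>2\<close> is a scalar. Otherwise the characteristic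
  equation reads \<open>\<lambda> + det C\<^sub>0 / \<lambda> = c cos (k - \<kappa>)\<close>, so \<open>\<lambda>\<close> is injective without critical points on
      each of
  two arcs, and a change of variables gives every vector a spectral density.\<close>


section \<open>Scattering for trace class perturbations\<close>

text \<open>The claim is built from \<open>THE\<close> and \<open>SOME\<close> (\<open>Pac\<close>,
  \<open>Wplus\<close>, \<open>adj\<close>, \<open>fourier\<close>), so each of these has to be
  pinned down before a limit can be taken. The obstacle is \<open>Pac\<close>: that
  \<open>Hac\<close> is a closed subspace is not visible from its definition by densities. It comes
  out of scattering. Wave limits in both directions identify \<open>Hac (walk C)\<close> with the
  range of an isometry on a complete space, and such a range is a closed subspace. This is where
  completeness of the wave operator enters, beyond its existence. It also shows why the free walk is
  classified first: when every free vector has a density, the wave limit is an isometry on the whole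
  space, and its adjoint inverts it on the range. Scattering is carried out with the real part of
  the inner product, because norms and Cauchy sequences depend on it alone; complex scalars return
  for densities and projections. Spectral measures are handled through their Fourier coefficients,
  and functions of a unitary operator through limits of trigonometric polynomials of it.\<close>

text \<open>This holds when the spectral measure of \<open>\<psi>\<close> has a density bounded by \<open>M / (2 \<pi>)\<close>.\<close>

definition kato_bound :: "('a::real_inner \<Rightarrow> 'a) \<Rightarrow> real \<Rightarrow> 'a \<Rightarrow> bool" where
  "kato_bound A M \<psi> \<longleftrightarrow> (\<forall>F c. finite F \<longrightarrow>
     (norm (\<Sum>r\<in>F. c r *\<^sub>R (A ^^ r) \<psi>))\<^sup>2 \<le> M * (\<Sum>r\<in>F. (c r)\<^sup>2))"

lemma kato_bound_nonneg:
  assumes "kato_bound A M \<psi>"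
  shows "M \<ge> 0"
proof -
  have "M * 1 \<ge> (norm \<psi>)\<^sup>2"
    using assms unfolding kato_bound_def by (elim allE[where x="{0}"] allE[where x="\<lambda>_. 1"]) auto
  then show ?thesis using order_trans[OF zero_le_power2] by simp
qed

text \<open>Duality: the bound on combinations of the orbit is tested with the coefficients
  \<open>inner g ((A ^^ r) \<psi>)\<close> themselves. Their square sum \<open>S\<close> then equals
  \<open>inner g v\<close>, and Cauchy-Schwarz bounds \<open>S * S\<close> by a multiple of
  \<open>S\<close>.\<close>

lemma kato_bound_sum:
  assumes "kato_bound A M \<psi>" "finite F"
  shows "(\<Sum>r\<in>F. (inner g ((A ^^ r) \<psi>))\<^sup>2) \<le> M * (norm g)\<^sup>2"
proof -
  define c where "c r = inner g ((A ^^ r) \<psi>)" for r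
  define S where "S = (\<Sum>r\<in>F. (c r)\<^sup>2)"
  define v where "v = (\<Sum>r\<in>F. c r *\<^sub>R (A ^^ r) \<psi>)"
  have v: "(norm v)\<^sup>2 \<le> M * S"
    using assms unfolding kato_bound_def v_def S_def by blast
  have Sv: "S = inner g v"
    unfolding S_def v_def inner_sum_right by (simp add: c_def power2_eq_square)
  have S0: "S \<ge> 0" unfolding S_def by (simp add: sum_nonneg)
  have M0: "M \<ge> 0" by (rule kato_bound_nonneg[OF assms(1)])
  have "S\<^sup>2 \<le> (norm g * norm v)\<^sup>2"
    using Cauchy_Schwarz_ineq2[of g v] Sv S0 by (intro power_mono) auto
  also have "\<dots> \<le> (norm g)\<^sup>2 * (M * S)"
    using v by (simp add: power_mult_distrib mult_left_mono)
  finally have "S * S \<le> (M * (norm g)\<^sup>2) * S" by (simp add: power2_eq_square mult_ac)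
  then have "S \<le> M * (norm g)\<^sup>2"
    using S0 M0 by (cases "S = 0") (auto simp: mult_le_cancel_right)
  then show ?thesis by (simp add: S_def c_def)
qed

lemma kato_bound_summable:
  assumes "kato_bound A M \<psi>"
  shows "summable (\<lambda>r. (inner g ((A ^^ r) \<psi>))\<^sup>2)"
proof (rule bounded_imp_summable)
  show "(\<Sum>r\<le>n. (inner g ((A ^^ r) \<psi>))\<^sup>2) \<le> M * (norm g)\<^sup>2" for n
    by (rule kato_bound_sum[OF assms]) simp
qed simp

lemma kato_bound_weak_limit:
  assumes "kato_bound A M \<psi>"
  shows "(\<lambda>p. inner g ((A ^^ p) \<psi>)) \<longlonglongrightarrow> 0"
proof -
  have "(\<lambda>p. (inner g ((A ^^ p) \<psi>))\<^sup>2) \<longlonglongrightarrow> 0"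
    by (rule summable_LIMSEQ_zero[OF kato_bound_summable[OF assms]])
  from tendsto_real_sqrt[OF this] show ?thesis
    by (simp add: tendsto_rabs_zero_iff)
qed

lemma isometry_inner:
  assumes "linear A" "\<And>x. norm (A x) = norm x"
  shows "inner (A x) (A y) = inner x y"
proof -
  have "(norm (A (x + y)))\<^sup>2 = (norm (x + y))\<^sup>2" by (simp add: assms(2))
  then show ?thesis
    by (simp add: linear_add[OF assms(1)] assms(2) dot_norm)
qed

lemma funpow_inv_cancel:
  assumes "bij (A :: 'a \<Rightarrow> 'a)"
  shows "(A ^^ n) ((inv A ^^ n) x) = x" "(inv A ^^ n) ((A ^^ n) x) = x"
proof -
  have 1: "A (inv A y) = y" "inv A (A y) = y" for y
    using assms by (simp_all add: bij_is_surj surj_f_inv_f bij_is_inj)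
  show "(A ^^ n) ((inv A ^^ n) x) = x"
    by (induction n arbitrary: x) (simp_all add: 1 funpow_swap1)
  show "(inv A ^^ n) ((A ^^ n) x) = x"
    by (induction n arbitrary: x) (simp_all add: 1 funpow_swap1)
qed

section \<open>Unitary operators on a real inner product space\<close>

locale unitary_op =
  fixes A :: "'a::real_inner \<Rightarrow> 'a"
  assumes lin: "linear A" and iso: "norm (A x) = norm x" and surj: "surj A"
begin

lemma inj: "inj A"
  using iso linear_injective_0[OF lin] by (metis norm_eq_zero)

lemma bij: "bij A"
  using inj surj by (simp add: bij_def)

lemma linear_pow: "linear (A ^^ n)"
proof (induction n)
  case (Suc n)
  then show ?case unfolding funpow.simps by (rule linear_compose[OF _ lin])
qed (simp add: linear_id[unfolded id_def])

lemma iso_pow: "norm ((A ^^ n) x) = norm x"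
  by (induction n) (auto simp: iso)

lemma bounded_linear_pow: "bounded_linear (A ^^ n)"
  by (rule bounded_linear_intro[where K = 1])
     (simp_all add: linear_add[OF linear_pow] linear_scale[OF linear_pow] iso_pow)

lemma inner_pow: "inner ((A ^^ n) x) ((A ^^ n) y) = inner x y"
  by (rule isometry_inner[OF linear_pow iso_pow])

lemma unitary_inv: "unitary_op (inv A)"
proof (rule unitary_op.intro)
  show "linear (inv A)"
    unfolding linear_iff
  proof (intro conjI allI)
    show "inv A (x + y) = inv A x + inv A y" for x y
      using surj by (intro inv_f_eq[OF inj]) (simp add: linear_add[OF lin] surj_f_inv_f)
    show "inv A (r *\<^sub>R x) = r *\<^sub>R inv A x" for r x
      using surj by (intro inv_f_eq[OF inj]) (simp add: linear_scale[OF lin] surj_f_inv_f)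
  qed
  show "norm (inv A x) = norm x" for x
    using iso[of "inv A x"] surj by (simp add: surj_f_inv_f)
  show "surj (inv A)"
    using bij by (simp add: bij_imp_bij_inv bij_is_surj)
qed

lemmas pow_cancel = funpow_inv_cancel[OF bij]

lemma inner_inv_pow: "inner ((inv A ^^ n) x) y = inner x ((A ^^ n) y)"
  using inner_pow[of n "(inv A ^^ n) x" y] by (simp add: pow_cancel)

end

text \<open>A weak form of \<open>B - A = (\<Sum>n. s\<^sub>n \<langle>f\<^sub>n, \<cdot>\<rangle> e\<^sub>n)\<close> with summable \<open>s\<close>.\<close>

locale trace_class_pair = A: unitary_op A + B: unitary_op B
  for A B :: "'a::real_inner \<Rightarrow> 'a" +
  fixes s :: "nat \<Rightarrow> real" and e f :: "nat \<Rightarrow> 'a"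
  assumes s_nonneg: "s n \<ge> 0" and s_summable: "summable s"
    and e_le: "norm (e n) \<le> 1" and f_le: "norm (f n) \<le> 1"
    and trace_bound: "\<bar>inner h (B g - A g)\<bar> \<le> (\<Sum>n. s n * (\<bar>inner h (e n)\<bar> * \<bar>inner g (f n)\<bar>))"
begin

text \<open>The l2 tail, from time \<open>p\<close> on, of the coefficients of \<open>g\<close>
  along the orbit. All decay in the Cauchy estimate comes from these tails.\<close>

definition rem :: "'a \<Rightarrow> 'a \<Rightarrow> nat \<Rightarrow> real" where
  "rem \<psi> g p = sqrt (\<Sum>r. (inner g ((A ^^ (r + p)) \<psi>))\<^sup>2)"

lemma rem_summable: "kato_bound A M \<psi> \<Longrightarrow> summable (\<lambda>r. (inner g ((A ^^ (r + p)) \<psi>))\<^sup>2)"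
  using summable_ignore_initial_segment[OF kato_bound_summable] by blast

lemma rem_tendsto:
  assumes "kato_bound A M \<psi>"
  shows "rem \<psi> g \<longlonglongrightarrow> 0"
proof -
  have "(\<lambda>p. \<Sum>r. (inner g ((A ^^ (r + p)) \<psi>))\<^sup>2) \<longlonglongrightarrow> 0"
    by (rule suminf_exist_split2) (rule kato_bound_summable[OF assms])
  from tendsto_real_sqrt[OF this] show ?thesis unfolding rem_def by simp
qed

lemma rem_nonneg: "kato_bound A M \<psi> \<Longrightarrow> rem \<psi> g p \<ge> 0"
  unfolding rem_def by (simp add: suminf_nonneg[OF rem_summable])

lemma sum_le_rem:
  assumes "kato_bound A M \<psi>"
  shows "sqrt (\<Sum>r<m. (inner g ((A ^^ (r + p)) \<psi>))\<^sup>2) \<le> rem \<psi> g p"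
  unfolding rem_def by (intro real_sqrt_le_mono sum_le_suminf rem_summable[OF assms]) auto

lemma rem_le:
  assumes "kato_bound A M \<psi>" "norm g \<le> 1"
  shows "rem \<psi> g p \<le> sqrt M"
proof -
  have M: "M * (norm g)\<^sup>2 \<le> M"
    using assms(2) kato_bound_nonneg[OF assms(1)] by (simp add: mult_left_le power_le_one)
  have "(\<Sum>r. (inner g ((A ^^ (r + p)) \<psi>))\<^sup>2) \<le> M"
  proof (rule suminf_le_const[OF rem_summable[OF assms(1)]])
    fix m
    \<comment> \<open>A shifted index set is still finite, so the bound for arbitrary finite sets
      covers the tails with the same constant.\<close>
    have "(\<Sum>r<m. (inner g ((A ^^ (r + p)) \<psi>))\<^sup>2) =
        (\<Sum>r\<in>(\<lambda>r. r + p) ` {..<m}. (inner g ((A ^^ r) \<psi>))\<^sup>2)"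
      by (subst sum.reindex) auto
    also have "\<dots> \<le> M * (norm g)\<^sup>2" by (rule kato_bound_sum[OF assms(1)]) simp
    finally show "(\<Sum>r<m. (inner g ((A ^^ (r + p)) \<psi>))\<^sup>2) \<le> M" using M by linarith
  qed
  then show ?thesis unfolding rem_def by (rule real_sqrt_le_mono)
qed

lemma s_mult_summable:
  assumes "\<And>n. \<bar>a n\<bar> \<le> K"
  shows "summable (\<lambda>n. s n * a n)"
  by (rule summable_comparison_test'[of "\<lambda>n. K * s n" 0])
     (use assms s_nonneg in \<open>auto intro!: summable_mult s_summable mult_right_mono simp: abs_mult
         mult.commute[of "s _"]\<close>)

text \<open>Dominated convergence for series, with \<open>s\<close> as majorant: decay for each
  single \<open>n\<close> passes to the weighted sum.\<close>

lemma s_mult_tendsto: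
  assumes "\<And>n p. \<bar>a n p\<bar> \<le> K" "\<And>n. (\<lambda>p. a n p) \<longlonglongrightarrow> 0"
  shows "(\<lambda>p. \<Sum>n. s n * a n p) \<longlonglongrightarrow> (0::real)"
proof -
  have "(\<lambda>p. \<Sum>n. s n * a n p) \<longlonglongrightarrow> (\<Sum>n. 0)"
  proof (rule tannerys_theorem[where M = "\<lambda>n. s n * K", THEN conjunct2, THEN conjunct2])
    show "(\<lambda>p. s n * a n p) \<longlonglongrightarrow> 0" for n
      using tendsto_mult_left[OF assms(2), of "s n"] by simp
    show "summable (\<lambda>n. s n * K)" by (intro summable_mult2 s_summable)
    show "\<forall>\<^sub>F (n, p) in at_top \<times>\<^sub>F sequentially. norm (s n * a n p) \<le> s n * K"
      using assms(1) s_nonneg by (intro always_eventually)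
          (auto simp: abs_mult intro!: mult_left_mono)
  qed auto
  then show ?thesis by simp
qed

lemma inner_unit_le: "norm g \<le> 1 \<Longrightarrow> \<bar>inner x g\<bar> \<le> norm x"
  using Cauchy_Schwarz_ineq2[of x g] mult_left_le[of "norm g" "norm x"] by simp

text \<open>After the sums are interchanged, Cauchy-Schwarz in \<open>r\<close> for each fixed
  \<open>n\<close> gives a product of two tails, which does not depend on \<open>m\<close>. Two
  offsets are kept because the two arguments of the overlap below sit at different times.\<close>

lemma kato_pair_sum:
  assumes k: "kato_bound A M \<psi>" and u: "\<And>n. norm (u n) \<le> 1" and v: "\<And>n. norm (v n) \<le> 1"
  shows "(\<Sum>r<m. \<Sum>n. s n * (\<bar>inner (u n) ((A ^^ (r + p)) \<psi>)\<bar> * \<bar>inner (v n) ((A ^^ (r + p')) \<psi>)\<bar>))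
    \<le> (\<Sum>n. s n * (rem \<psi> (u n) p * rem \<psi> (v n) p'))"
proof -
  have b: "\<bar>\<bar>inner (u n) ((A ^^ i) \<psi>)\<bar> * \<bar>inner (v n) ((A ^^ j) \<psi>)\<bar>\<bar> \<le> norm \<psi> * norm \<psi>" for i j n
    using inner_unit_le[OF u, of "(A ^^ i) \<psi>" n] inner_unit_le[OF v, of "(A ^^ j) \<psi>" n]
    by (simp add: A.iso_pow abs_mult inner_commute[of "u n"] inner_commute[of "v n"] mult_mono)
  have r: "\<bar>rem \<psi> (u n) p * rem \<psi> (v n) p'\<bar> \<le> sqrt M * sqrt M" for n
    unfolding abs_mult using rem_le[OF k u] rem_le[OF k v] rem_nonneg[OF k]
      order_trans[OF rem_nonneg[OF k] rem_le[OF k u]] by (intro mult_mono) auto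
  have "(\<Sum>r<m. \<Sum>n. s n * (\<bar>inner (u n) ((A ^^ (r + p)) \<psi>)\<bar> * \<bar>inner (v n) ((A ^^ (r + p')) \<psi>)\<bar>))
     = (\<Sum>n. s n * (\<Sum>r<m. \<bar>inner (u n) ((A ^^ (r + p)) \<psi>)\<bar> * \<bar>inner (v n) ((A ^^ (r + p')) \<psi>)\<bar>))"
    unfolding sum_distrib_left by (rule suminf_sum[symmetric]) (rule s_mult_summable[OF b])
  also have "\<dots> \<le> (\<Sum>n. s n * (rem \<psi> (u n) p * rem \<psi> (v n) p'))"
  proof (rule suminf_le)
    fix n
    have "(\<Sum>r<m. \<bar>inner (u n) ((A ^^ (r + p)) \<psi>)\<bar> * \<bar>inner (v n) ((A ^^ (r + p')) \<psi>)\<bar>)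
      \<le> L2_set (\<lambda>r. inner (u n) ((A ^^ (r + p)) \<psi>)) {..<m} * L2_set
          (\<lambda>r. inner (v n) ((A ^^ (r + p')) \<psi>)) {..<m}"
      by (rule L2_set_mult_ineq)
    also have "\<dots> \<le> rem \<psi> (u n) p * rem \<psi> (v n) p'"
      unfolding L2_set_def by (intro mult_mono sum_le_rem[OF k] rem_nonneg[OF k])
          (simp add: sum_nonneg)
    finally show "s n * (\<Sum>r<m. \<bar>inner (u n) ((A ^^ (r + p)) \<psi>)\<bar> * \<bar>inner (v n) ((A ^^ (r + p')) \<psi>)\<bar>)
       \<le> s n * (rem \<psi> (u n) p * rem \<psi> (v n) p')" by (rule mult_left_mono) (rule s_nonneg)

  next
    show "summable (\<lambda>n. s n * (\<Sum>r<m. \<bar>inner (u n) ((A ^^ (r + p)) \<psi>)\<bar> * \<bar>inner (v n)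
        ((A ^^ (r + p')) \<psi>)\<bar>))"
      unfolding sum_distrib_left by (intro summable_sum s_mult_summable[OF b])
    show "summable (\<lambda>n. s n * (rem \<psi> (u n) p * rem \<psi> (v n) p'))"
      by (rule s_mult_summable[OF r])
  qed
  finally show ?thesis .
qed

text \<open>The real inner product of the wave approximants at times \<open>p + q\<close> and
  \<open>p\<close>, with the powers of \<open>inv B\<close> moved to one side.\<close>

definition overlap :: "'a \<Rightarrow> nat \<Rightarrow> nat \<Rightarrow> real" where
  "overlap \<psi> q p = inner ((A ^^ (p + q)) \<psi>) ((B ^^ q) ((A ^^ p) \<psi>))"

text \<open>Applying \<open>A\<close> to both arguments of the overlap at \<open>p\<close> gives
  both overlaps the same left vector, and their difference becomes a commutator. Since
  \<open>B\<close> commutes with its powers,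
  \<open>B^q A - A B^q = (B - A) B^q - B^q (B - A)\<close>: only two perturbation terms occur,
  however large \<open>q\<close> is.\<close>

lemma overlap_step:
  "\<bar>overlap \<psi> q (Suc p) - overlap \<psi> q p\<bar>
    \<le> (\<Sum>n. s n * (\<bar>inner ((B ^^ q) (e n)) ((A ^^ (p + Suc q)) \<psi>)\<bar> * \<bar>inner (f n) ((A ^^ p) \<psi>)\<bar>))
    + (\<Sum>n. s n * (\<bar>inner (e n) ((A ^^ (p + Suc q)) \<psi>)\<bar> * \<bar>inner ((inv B ^^ q) (f n))
        ((A ^^ p) \<psi>)\<bar>))"
proof -
  define x where "x = (A ^^ (p + Suc q)) \<psi>"
  define y where "y = (A ^^ p) \<psi>"
  have Bq: "linear (B ^^ q)" by (rule B.linear_pow)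
  have "overlap \<psi> q p = inner x (A ((B ^^ q) y))"
    unfolding overlap_def x_def y_def using A.inner_pow[of 1] by simp
  moreover have "overlap \<psi> q (Suc p) = inner x ((B ^^ q) (A y))"
    unfolding overlap_def x_def y_def by simp
  moreover have "(B ^^ q) (B y) = B ((B ^^ q) y)" by (simp add: funpow_swap1)
  ultimately have "overlap \<psi> q (Suc p) - overlap \<psi> q p
      = inner x (B ((B ^^ q) y) - A ((B ^^ q) y)) - inner x ((B ^^ q) (B y - A y))"
    by (simp add: linear_diff[OF Bq] inner_diff_right)
  also have "inner x ((B ^^ q) (B y - A y)) = inner ((inv B ^^ q) x) (B y - A y)"
    by (simp add: B.inner_inv_pow)
  finally have "\<bar>overlap \<psi> q (Suc p) - overlap \<psi> q p\<bar>
      \<le> \<bar>inner x (B ((B ^^ q) y) - A ((B ^^ q) y))\<bar> + \<bar>inner ((inv B ^^ q) x) (B y - A y)\<bar>"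
    by linarith
  also have "\<dots> \<le> (\<Sum>n. s n * (\<bar>inner x (e n)\<bar> * \<bar>inner ((B ^^ q) y) (f n)\<bar>))
     + (\<Sum>n. s n * (\<bar>inner ((inv B ^^ q) x) (e n)\<bar> * \<bar>inner y (f n)\<bar>))"
    by (intro add_mono trace_bound)
  also have "\<dots> = (\<Sum>n. s n * (\<bar>inner ((B ^^ q) (e n)) x\<bar> * \<bar>inner (f n) y\<bar>))
     + (\<Sum>n. s n * (\<bar>inner (e n) x\<bar> * \<bar>inner ((inv B ^^ q) (f n)) y\<bar>))"
  proof -
    have "inner ((B ^^ q) y) (f n) = inner ((inv B ^^ q) (f n)) y" for n
      by (simp add: B.inner_inv_pow inner_commute[of _ "f n"])
    moreover have "inner ((inv B ^^ q) x) (e n) = inner ((B ^^ q) (e n)) x" for n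
      by (simp add: B.inner_inv_pow) (simp add: inner_commute)
    ultimately show ?thesis by (simp add: inner_commute)
  qed
  finally show ?thesis by (simp add: x_def y_def)
qed

text \<open>The bounds are uniform in the time difference \<open>q\<close>; this is what makes the sequence Cauchy.\<close>

lemma overlap_diff:
  assumes k: "kato_bound A M \<psi>"
  shows "\<bar>overlap \<psi> q (p + m) - overlap \<psi> q p\<bar>
    \<le> sqrt M * ((\<Sum>n. s n * rem \<psi> (f n) p) + (\<Sum>n. s n * rem \<psi> (e n) (p + Suc q)))"
proof -
  have M0: "sqrt M \<ge> 0" using kato_bound_nonneg[OF k] by simp
  have Be: "norm ((B ^^ q) (e n)) \<le> 1" "norm ((inv B ^^ q) (f n)) \<le> 1" for n
    using e_le f_le B.iso_pow unitary_op.iso_pow[OF B.unitary_inv] by auto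
  have remb: "\<bar>rem \<psi> (u n) i\<bar> \<le> sqrt M" if "\<And>n. norm (u n) \<le> 1" for u i and n :: nat
    using rem_le[OF k that] rem_nonneg[OF k] by simp
  \<comment> \<open>The vectors \<open>(B ^^ q) (e n)\<close> and \<open>(inv B ^^ q) (f n)\<close>
    vary with \<open>q\<close>, so their tails are merely bounded by \<open>sqrt M\<close>.
    Smallness is taken from the other factor, whose vector is fixed.\<close>
  have sumb: "(\<Sum>n. s n * (rem \<psi> (u n) i * rem \<psi> (v n) j)) \<le> sqrt M * (\<Sum>n. s n * rem \<psi> (v n) j)"
    if u: "\<And>n. norm (u n) \<le> 1" and v: "\<And>n. norm (v n) \<le> 1" for u v i j
  proof -
    have "\<bar>rem \<psi> (u n) i * rem \<psi> (v n) j\<bar> \<le> sqrt M * sqrt M" for n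
      unfolding abs_mult using remb[OF u] remb[OF v] M0 by (intro mult_mono) auto
    then have "(\<Sum>n. s n * (rem \<psi> (u n) i * rem \<psi> (v n) j)) \<le> (\<Sum>n. sqrt M * (s n * rem \<psi> (v n) j))"
      using rem_le[OF k u] rem_nonneg[OF k, of "v _"] s_nonneg
      by (intro suminf_le s_mult_summable[where K = "sqrt M * sqrt M"] summable_mult
          s_mult_summable[OF remb[OF v]])
         (auto simp: mult.left_commute[of "sqrt M"] simp del: real_sqrt_mult_self intro!:
             mult_left_mono mult_right_mono)
    also have "\<dots> = sqrt M * (\<Sum>n. s n * rem \<psi> (v n) j)"
      by (rule suminf_mult) (rule s_mult_summable[OF remb[OF v]])
    finally show ?thesis .
  qed
  have "overlap \<psi> q (p + m) - overlap \<psi> q p =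
      (\<Sum>r<m. overlap \<psi> q (Suc (r + p)) - overlap \<psi> q (r + p))"
    using sum_lessThan_telescope[of "\<lambda>r. overlap \<psi> q (r + p)" m] by (simp add: add.commute)
  then have "\<bar>overlap \<psi> q (p + m) - overlap \<psi> q p\<bar>
      \<le> (\<Sum>r<m. \<bar>overlap \<psi> q (Suc (r + p)) - overlap \<psi> q (r + p)\<bar>)" by simp
  also have "\<dots> \<le> (\<Sum>r<m. (\<Sum>n. s n * (\<bar>inner ((B ^^ q) (e n)) ((A ^^ (r + (p + Suc q))) \<psi>)\<bar> * \<bar>inner
      (f n) ((A ^^ (r + p)) \<psi>)\<bar>))
    + (\<Sum>n. s n * (\<bar>inner ((inv B ^^ q) (f n)) ((A ^^ (r + p)) \<psi>)\<bar> * \<bar>inner (e n)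
        ((A ^^ (r + (p + Suc q))) \<psi>)\<bar>)))"
    by (intro sum_mono order_trans[OF overlap_step]) (simp add: mult_ac add.assoc)
  also have "\<dots> \<le> (\<Sum>n. s n * (rem \<psi> ((B ^^ q) (e n)) (p + Suc q) * rem \<psi> (f n) p))
     + (\<Sum>n. s n * (rem \<psi> ((inv B ^^ q) (f n)) p * rem \<psi> (e n) (p + Suc q)))"
    unfolding sum.distrib by (intro add_mono kato_pair_sum[OF k] Be e_le f_le)
  also have "\<dots> \<le> sqrt M * (\<Sum>n. s n * rem \<psi> (f n) p) + sqrt M * (\<Sum>n. s n * rem \<psi> (e n) (p + Suc q))"
    by (intro add_mono sumb Be e_le f_le)
  finally show ?thesis by (simp add: distrib_left)
qed

text \<open>A trace class operator is compact and turns weak into strong convergence. Concretely,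
  the trace bound is tested with the very vector \<open>V p\<close> whose norm is wanted, so that
  its square is dominated by a series in which every term decays.\<close>

lemma perturbation_tendsto:
  assumes w: "\<And>g. (\<lambda>p. inner g ((A ^^ p) \<psi>)) \<longlonglongrightarrow> 0"
  shows "(\<lambda>p. B ((A ^^ p) \<psi>) - A ((A ^^ p) \<psi>)) \<longlonglongrightarrow> 0"
proof -
  define V where "V p = B ((A ^^ p) \<psi>) - A ((A ^^ p) \<psi>)" for p
  have V2: "norm (V p) \<le> 2 * norm \<psi>" for p
    unfolding V_def using norm_triangle_ineq4[of "B ((A ^^ p) \<psi>)" "A ((A ^^ p) \<psi>)"]
    by (simp add: A.iso B.iso A.iso_pow)
  have "(\<lambda>p. \<Sum>n. s n * (\<bar>inner (V p) (e n)\<bar> * \<bar>inner ((A ^^ p) \<psi>) (f n)\<bar>)) \<longlonglongrightarrow> 0"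
  proof (rule s_mult_tendsto)
    have Ve: "\<bar>inner (V p) (e n)\<bar> \<le> 2 * norm \<psi>" for n p
      using inner_unit_le[OF e_le[of n], of "V p"] V2[of p] by linarith
    have "\<bar>inner ((A ^^ p) \<psi>) (f n)\<bar> \<le> norm \<psi>" for n p
      using inner_unit_le[OF f_le, of "(A ^^ p) \<psi>" n] by (simp add: A.iso_pow)
    then show "\<bar>\<bar>inner (V p) (e n)\<bar> * \<bar>inner ((A ^^ p) \<psi>) (f n)\<bar>\<bar> \<le> (2 * norm \<psi>) * norm \<psi>" for n p
      unfolding abs_mult abs_abs by (intro mult_mono Ve) auto
    show "(\<lambda>p. \<bar>inner (V p) (e n)\<bar> * \<bar>inner ((A ^^ p) \<psi>) (f n)\<bar>) \<longlonglongrightarrow> 0" for n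
    proof (rule Lim_null_comparison)
      show "\<forall>\<^sub>F p in sequentially. norm (\<bar>inner (V p) (e n)\<bar> * \<bar>inner ((A ^^ p) \<psi>) (f n)\<bar>)
          \<le> 2 * norm \<psi> * \<bar>inner (f n) ((A ^^ p) \<psi>)\<bar>"
        using Ve by (intro always_eventually allI)
            (simp add: inner_commute[of _ "f n"] mult_right_mono)
      show "(\<lambda>p. 2 * norm \<psi> * \<bar>inner (f n) ((A ^^ p) \<psi>)\<bar>) \<longlonglongrightarrow> 0"
        using tendsto_mult_left[OF tendsto_rabs[OF w[of "f n"]], of "2 * norm \<psi>"] by simp
    qed
  qed
  then have "(\<lambda>p. (norm (V p))\<^sup>2) \<longlonglongrightarrow> 0"
  proof (rule tendsto_0_le[where K = 1, OF _ always_eventually, OF _ allI])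
    show "norm ((norm (V p))\<^sup>2) \<le> norm (\<Sum>n. s n *
        (\<bar>inner (V p) (e n)\<bar> * \<bar>inner ((A ^^ p) \<psi>) (f n)\<bar>)) * 1" for p
      using trace_bound[of "V p" "(A ^^ p) \<psi>"] by (simp add: V_def dot_square_norm)
  qed
  then have "(\<lambda>p. norm (V p)) \<longlonglongrightarrow> 0"
    using tendsto_real_sqrt by fastforce
  then show ?thesis unfolding V_def by (simp add: tendsto_norm_zero_iff)
qed

text \<open>Induction along \<open>B^(q+1) - A^(q+1) = B (B^q - A^q) + (B - A) A^q\<close>; the last
  term is the perturbation on a later point of the orbit.\<close>

lemma pow_diff_tendsto:
  assumes w: "\<And>g. (\<lambda>p. inner g ((A ^^ p) \<psi>)) \<longlonglongrightarrow> 0"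
  shows "(\<lambda>p. (B ^^ q) ((A ^^ p) \<psi>) - (A ^^ q) ((A ^^ p) \<psi>)) \<longlonglongrightarrow> 0"
proof (induction q)
  case (Suc q)
  have "(\<lambda>p. norm ((B ^^ q) ((A ^^ p) \<psi>) - (A ^^ q) ((A ^^ p) \<psi>))
      + norm (B ((A ^^ (p + q)) \<psi>) - A ((A ^^ (p + q)) \<psi>))) \<longlonglongrightarrow> 0 + 0"
    by (intro tendsto_add tendsto_norm_zero Suc.IH
        LIMSEQ_ignore_initial_segment[OF perturbation_tendsto[OF w]])
  then show ?case unfolding add_0_right
  proof (rule tendsto_0_le[where K = 1, OF _ always_eventually, OF _ allI])
    fix p
    have "(B ^^ Suc q) ((A ^^ p) \<psi>) - (A ^^ Suc q) ((A ^^ p) \<psi>)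
       = B ((B ^^ q) ((A ^^ p) \<psi>) - (A ^^ q) ((A ^^ p) \<psi>)) +
           (B ((A ^^ (p + q)) \<psi>) - A ((A ^^ (p + q)) \<psi>))"
      by (simp add: linear_diff[OF B.lin] funpow_add add.commute[of p])
    then show "norm ((B ^^ Suc q) ((A ^^ p) \<psi>) - (A ^^ Suc q) ((A ^^ p) \<psi>))
      \<le> norm (norm ((B ^^ q) ((A ^^ p) \<psi>) - (A ^^ q) ((A ^^ p) \<psi>))
      + norm (B ((A ^^ (p + q)) \<psi>) - A ((A ^^ (p + q)) \<psi>))) * 1"
      by (simp add: B.iso norm_triangle_le)
  qed
qed simp

text \<open>For fixed \<open>q\<close> and late times \<open>B ^^ q\<close> acts on the orbit like
  \<open>A ^^ q\<close>. This supplies the far end of the telescoping sum.\<close>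

lemma overlap_tendsto:
  assumes w: "\<And>g. (\<lambda>p. inner g ((A ^^ p) \<psi>)) \<longlonglongrightarrow> 0"
  shows "(\<lambda>m. overlap \<psi> q m) \<longlonglongrightarrow> (norm \<psi>)\<^sup>2"
proof -
  have "(\<lambda>p. overlap \<psi> q p - (norm \<psi>)\<^sup>2) \<longlonglongrightarrow> 0"
  proof (rule tendsto_0_le[OF pow_diff_tendsto[OF w, of q], of _ "norm \<psi>", OF always_eventually,
      rule_format])
    fix p
    have "(norm \<psi>)\<^sup>2 = inner ((A ^^ (p + q)) \<psi>) ((A ^^ q) ((A ^^ p) \<psi>))"
      by (simp add: dot_square_norm A.iso_pow add.commute[of p] funpow_add)
    then have "overlap \<psi> q p - (norm \<psi>)\<^sup>2 = inner ((A ^^ (p + q)) \<psi>)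
        ((B ^^ q) ((A ^^ p) \<psi>) - (A ^^ q) ((A ^^ p) \<psi>))"
      by (simp add: overlap_def inner_diff_right)
    then show "norm (overlap \<psi> q p - (norm \<psi>)\<^sup>2) \<le> norm
        ((B ^^ q) ((A ^^ p) \<psi>) - (A ^^ q) ((A ^^ p) \<psi>)) * norm \<psi>"
      using Cauchy_Schwarz_ineq2[of "(A ^^ (p + q)) \<psi>"
          "(B ^^ q) ((A ^^ p) \<psi>) - (A ^^ q) ((A ^^ p) \<psi>)"]
      by (simp add: A.iso_pow mult.commute)
  qed
  then show ?thesis using Lim_null by blast
qed

lemma wave_dist:
  "(norm ((inv B ^^ (p + q)) ((A ^^ (p + q)) \<psi>) - (inv B ^^ p) ((A ^^ p) \<psi>)))\<^sup>2
     = 2 * ((norm \<psi>)\<^sup>2 - overlap \<psi> q p)"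
proof -
  have iB: "norm ((inv B ^^ n) x) = norm x" for n x
    by (rule unitary_op.iso_pow[OF B.unitary_inv])
  have "inner ((inv B ^^ (p + q)) ((A ^^ (p + q)) \<psi>)) ((inv B ^^ p) ((A ^^ p) \<psi>))
     = inner ((A ^^ (p + q)) \<psi>) ((B ^^ (q + p)) ((inv B ^^ p) ((A ^^ p) \<psi>)))"
    by (simp add: B.inner_inv_pow add.commute)
  also have "\<dots> = inner ((A ^^ (p + q)) \<psi>) ((B ^^ q) ((B ^^ p) ((inv B ^^ p) ((A ^^ p) \<psi>))))"
    by (simp add: funpow_add)
  also have "\<dots> = overlap \<psi> q p" by (simp add: B.pow_cancel overlap_def)
  finally show ?thesis
    by (simp add: power2_norm_eq_inner inner_diff_left inner_diff_right inner_commute)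
       (simp add: iB A.iso_pow dot_square_norm)
qed

theorem kato_bound_Cauchy:
  assumes k: "kato_bound A M \<psi>"
  shows "Cauchy (\<lambda>t. (inv B ^^ t) ((A ^^ t) \<psi>))"
proof -
  define Rf where "Rf p = (\<Sum>n. s n * rem \<psi> (f n) p)" for p
  define Re where "Re p = (\<Sum>n. s n * rem \<psi> (e n) p)" for p
  have M0: "sqrt M \<ge> 0" using kato_bound_nonneg[OF k] by simp
  have remb: "\<bar>rem \<psi> (u n) i\<bar> \<le> sqrt M" if "\<And>n. norm (u n) \<le> 1" for u i and n :: nat
    using rem_le[OF k that] rem_nonneg[OF k] by simp
  have lim: "Rf \<longlonglongrightarrow> 0" "Re \<longlonglongrightarrow> 0"
    unfolding Rf_def Re_def using rem_tendsto[OF k] remb f_le e_le by (auto intro!: s_mult_tendsto)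
  have dist: "(norm ((inv B ^^ (p + q)) ((A ^^ (p + q)) \<psi>) - (inv B ^^ p) ((A ^^ p) \<psi>)))\<^sup>2
     \<le> 2 * (sqrt M * (Rf p + Re (p + Suc q)))" for p q
  proof -
    have "(\<lambda>m. overlap \<psi> q (p + m)) \<longlonglongrightarrow> (norm \<psi>)\<^sup>2"
      using LIMSEQ_ignore_initial_segment[OF overlap_tendsto[OF kato_bound_weak_limit[OF k]], of q
          p]
      by (simp add: add.commute)
    then have "(\<lambda>m. overlap \<psi> q (p + m) - overlap \<psi> q p) \<longlonglongrightarrow> (norm \<psi>)\<^sup>2 - overlap \<psi> q p"
      by (intro tendsto_diff tendsto_const)
    \<comment> \<open>The far end \<open>m\<close> of the telescoped bound is sent to
      infinity.\<close>
    then have "(norm \<psi>)\<^sup>2 - overlap \<psi> q p \<le> sqrt M * (Rf p + Re (p + Suc q))"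
      by (rule LIMSEQ_le_const2) (use overlap_diff[OF k, of q p]
          in \<open>force simp: Rf_def Re_def abs_le_iff\<close>)
    then show ?thesis unfolding wave_dist by simp
  qed
  show ?thesis
  proof (rule metric_CauchyI)
    fix \<epsilon> :: real assume "\<epsilon> > 0"
    \<comment> \<open>With two tails below \<open>\<eta>\<close> the squared distance is at most
      \<open>4 * (sqrt M * \<eta>)\<close>, which this choice keeps under the square of
      \<open>\<epsilon>/2\<close>; the \<open>+ 1\<close> covers \<open>M = 0\<close>.\<close>
    define \<eta> where "\<eta> = (\<epsilon>/2)\<^sup>2 / (4 * (sqrt M + 1))"
    have eta: "\<eta> > 0" "4 * (sqrt M * \<eta>) < (\<epsilon>/2)\<^sup>2"
    proof -
      show "\<eta> > 0" unfolding \<eta>_def using \<open>\<epsilon> > 0\<close> M0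
          by (intro divide_pos_pos) (auto simp del: real_sqrt_ge_0_iff)
      have "4 * (sqrt M * \<eta>) < 4 * ((sqrt M + 1) * \<eta>)" using \<open>\<eta> > 0\<close> by simp
      also have "\<dots> = (\<epsilon>/2)\<^sup>2" unfolding \<eta>_def using M0
          by (simp add: field_simps del: real_sqrt_ge_0_iff)
      finally show "4 * (sqrt M * \<eta>) < (\<epsilon>/2)\<^sup>2" .
    qed
    obtain P where P: "\<And>p. p \<ge> P \<Longrightarrow> Rf p < \<eta>" "\<And>p. p \<ge> P \<Longrightarrow> Re p < \<eta>"
      using order_tendstoD(2)[OF lim(1) eta(1)] order_tendstoD(2)[OF lim(2) eta(1)]
      unfolding eventually_sequentially by (metis (no_types) linorder_le_cases order_trans)
    have near: "dist ((inv B ^^ n) ((A ^^ n) \<psi>)) ((inv B ^^ P) ((A ^^ P) \<psi>)) < \<epsilon>/2" if "n \<ge> P" for n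
    proof -
      obtain q where q: "n = P + q" using \<open>n \<ge> P\<close> by (metis le_iff_add)
      have "2 * (sqrt M * (Rf P + Re (P + Suc q))) \<le> 2 * (sqrt M * (\<eta> + \<eta>))"
        using P[of P] P[of "P + Suc q"] M0 by (intro mult_left_mono add_mono) auto
      also have "\<dots> < (\<epsilon>/2)\<^sup>2" using eta(2) by simp
      finally have "(dist ((inv B ^^ n) ((A ^^ n) \<psi>)) ((inv B ^^ P) ((A ^^ P) \<psi>)))\<^sup>2 < (\<epsilon>/2)\<^sup>2"
        using dist[of P q] by (simp add: q dist_norm)
      then show ?thesis by (rule power2_less_imp_less) (use \<open>\<epsilon> > 0\<close> in simp)
    qed
    show "\<exists>N. \<forall>m\<ge>N. \<forall>n\<ge>N. dist ((inv B ^^ m) ((A ^^ m) \<psi>)) ((inv B ^^ n) ((A ^^ n) \<psi>)) < \<epsilon>"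
      using dist_triangle_half_l[OF near near] by blast
  qed
qed

text \<open>The approximants are isometries, so an error in the initial vector costs the same at
  every time and a dense set of initial vectors suffices.\<close>

lemma wave_Cauchy:
  assumes "\<And>\<epsilon>. \<epsilon> > 0 \<Longrightarrow> \<exists>\<phi> M. kato_bound A M \<phi> \<and> norm (\<psi> - \<phi>) < \<epsilon>"
  shows "Cauchy (\<lambda>t. (inv B ^^ t) ((A ^^ t) \<psi>))"
proof (rule metric_CauchyI)
  fix \<epsilon> :: real assume "\<epsilon> > 0"
  then obtain \<phi> M where k: "kato_bound A M \<phi>" and n: "norm (\<psi> - \<phi>) < \<epsilon>/3"
    using assms[of "\<epsilon>/3"] by auto
  define W where "W t x = (inv B ^^ t) ((A ^^ t) x)" for t x
  have W: "dist (W t \<psi>) (W t \<phi>) < \<epsilon>/3" for t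
    using n linear_diff[OF A.linear_pow, of t \<psi> \<phi>]
      linear_diff[OF unitary_op.linear_pow[OF B.unitary_inv], of t "(A ^^ t) \<psi>" "(A ^^ t) \<phi>"]
    by (metis A.iso_pow B.unitary_inv W_def dist_norm unitary_op.iso_pow)
  obtain N where N: "\<And>m n. m \<ge> N \<Longrightarrow> n \<ge> N \<Longrightarrow> dist (W m \<phi>) (W n \<phi>) < \<epsilon>/3"
    using metric_CauchyD[OF kato_bound_Cauchy[OF k], of "\<epsilon>/3"] \<open>\<epsilon> > 0\<close> by (auto simp: W_def)
  have "dist (W m \<psi>) (W n \<psi>) < \<epsilon>" if "m \<ge> N" "n \<ge> N" for m n
    using N[OF that] W[of m] W[of n] dist_triangle_third[of "W m \<psi>" "W m \<phi>" \<epsilon> "W n \<phi>" "W n \<psi>"]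
    by (simp add: dist_commute)
  then show "\<exists>N. \<forall>m\<ge>N. \<forall>n\<ge>N. dist ((inv B ^^ m) ((A ^^ m) \<psi>)) ((inv B ^^ n) ((A ^^ n) \<psi>)) < \<epsilon>"
    unfolding W_def by blast
qed

end

section \<open>The Hilbert space of square-summable states\<close>

lemma orthogonal_projection_exists:
  fixes S :: "'a::{real_inner, complete_space} set"
  assumes S: "subspace S" "closed S"
  obtains p where "p \<in> S" "\<And>y. y \<in> S \<Longrightarrow> inner y (x - p) = 0"
proof -
  define d where "d = (INF y\<in>S. (norm (x - y))\<^sup>2)"
  have bdd: "bdd_below ((\<lambda>y. (norm (x - y))\<^sup>2) ` S)" by (rule bdd_belowI[of _ 0]) auto
  have ne: "S \<noteq> {}" using subspace_0[OF S(1)] by auto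
  have dle: "d \<le> (norm (x - y))\<^sup>2" if "y \<in> S" for y
    unfolding d_def by (rule cINF_lower[OF bdd that])
  have "\<exists>y\<in>S. (norm (x - y))\<^sup>2 < d + inverse (real (Suc n))" for n
    using cINF_less_iff[OF ne bdd, of "d + inverse (real (Suc n))"] unfolding d_def by simp
  then obtain y where y: "\<And>n. y n \<in> S" "\<And>n. (norm (x - y n))\<^sup>2 < d + inverse (real (Suc n))"
    by metis
  \<comment> \<open>Parallelogram law: the midpoint lies in \<open>S\<close>, so its squared
    distance to \<open>x\<close> is at least \<open>d\<close>.\<close>
  have par: "(norm (y m - y n))\<^sup>2 \<le> 2 * inverse (real (Suc m)) + 2 * inverse (real (Suc n))" for m n
  proof -
    have mid: "(1/2) *\<^sub>R (y m + y n) \<in> S" using S(1) y(1) by (intro subspace_scale subspace_add)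
    have "(norm (y m - y n))\<^sup>2 = 2 * (norm (x - y m))\<^sup>2 + 2 * (norm (x - y n))\<^sup>2
       - 4 * (norm (x - (1/2) *\<^sub>R (y m + y n)))\<^sup>2"
      by (simp add: power2_norm_eq_inner inner_diff_left inner_diff_right inner_add_left
          inner_add_right
          inner_commute algebra_simps)
    then show ?thesis using y(2)[of m] y(2)[of n] dle[OF mid] by linarith
  qed
  have "Cauchy y"
  proof (rule metric_CauchyI)
    fix e :: real assume "e > 0"
    then obtain N where N: "inverse (real (Suc N)) < e\<^sup>2 / 4"
      using reals_Archimedean[of "e\<^sup>2 / 4"] by auto
    have "dist (y m) (y n) < e" if "m \<ge> N" "n \<ge> N" for m n
    proof -
      have "inverse (real (Suc m)) \<le> inverse (real (Suc N))"
          "inverse (real (Suc n)) \<le> inverse (real (Suc N))"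
        using that by (auto intro!: le_imp_inverse_le)
      then have "(dist (y m) (y n))\<^sup>2 < e\<^sup>2" using par[of m n] N unfolding dist_norm by linarith
      then show ?thesis by (rule power2_less_imp_less) (use \<open>e > 0\<close> in simp)
    qed
    then show "\<exists>N. \<forall>m\<ge>N. \<forall>n\<ge>N. dist (y m) (y n) < e" by blast
  qed
  then obtain p where p: "y \<longlonglongrightarrow> p" using Cauchy_convergent convergent_def by blast
  have pS: "p \<in> S" using closed_sequentially[OF S(2)] y(1) p by blast
  have "(norm (x - p))\<^sup>2 \<le> d + 0"
  proof (rule LIMSEQ_le)
    show "(\<lambda>n. (norm (x - y n))\<^sup>2) \<longlonglongrightarrow> (norm (x - p))\<^sup>2"
      by (intro tendsto_intros p)
    show "(\<lambda>n. d + inverse (real (Suc n))) \<longlonglongrightarrow> d + 0"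
      by (intro tendsto_intros LIMSEQ_inverse_real_of_nat)
  qed (use y(2) in \<open>auto intro: less_imp_le\<close>)
  then have min: "(norm (x - p))\<^sup>2 \<le> (norm (x - y))\<^sup>2" if "y \<in> S" for y using dle[OF that]
    by linarith
  have "inner y (x - p) = 0" if "y \<in> S" for y
  proof (cases "y = 0")
    case False
    \<comment> \<open>The minimiser of the squared distance along the line through \<open>p\<close>
      in direction \<open>y\<close>; minimality of \<open>p\<close> then forces the inner product to
      vanish.\<close>
    define t where "t = inner y (x - p) / inner y y"
    have yy: "inner y y > 0" using False by simp
    have "p + t *\<^sub>R y \<in> S" using pS that S(1) by (intro subspace_add subspace_scale)
    from min[OF this] have "0 \<le> - 2 * t * inner y (x - p) + t * t * inner y y"
      by (simp add: power2_norm_eq_inner inner_diff_left inner_diff_right inner_add_left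
          inner_add_right
          inner_commute algebra_simps)
    also have "\<dots> = - (inner y (x - p))\<^sup>2 / inner y y"
      using yy by (simp add: t_def field_simps power2_eq_square)
    finally have "0 \<le> - (inner y (x - p))\<^sup>2 / inner y y" .
    then have "(inner y (x - p))\<^sup>2 \<le> 0" using yy by (simp add: field_simps)
    then show ?thesis by simp
  qed simp
  with pS that show thesis by blast
qed

section \<open>Complex vectors and square-summable states\<close>

lemma cvec_power2_norm: "(norm v)\<^sup>2 = (cmod (v$1))\<^sup>2 + (cmod (v$2))\<^sup>2" for v :: "complex^2"
  by (simp add: norm_vec_def L2_set_def sum_2)

lemma cvec_norm_scale: "norm (c *s v) = cmod c * norm v" for v :: "complex^'n"
  by (simp add: norm_vec_def vector_scalar_mult_def norm_mult L2_set_right_distrib)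

lemma Re_cinner: "Re (cinner a b) = inner a b"
  by (simp add: cinner_def inner_vec_def inner_complex_def)

lemma norm_cinner_le: "cmod (cinner a b) \<le> norm a * norm b"
proof -
  have "cmod (cinner a b) \<le> (\<Sum>i\<in>UNIV. \<bar>cmod (a$i)\<bar> * \<bar>cmod (b$i)\<bar>)"
    unfolding cinner_def by (rule order_trans[OF norm_sum]) (simp add: norm_mult)
  also have "\<dots> \<le> norm a * norm b"
    unfolding norm_vec_def by (rule L2_set_mult_ineq)
  finally show ?thesis .
qed

lemma l2_scale: "l2 \<Psi> \<Longrightarrow> l2 (\<lambda>x. c *s \<Psi> x)"
  unfolding l2_def by (simp add: cvec_norm_scale power_mult_distrib summable_on_cmult_right)

lemma l2_scaleR: "l2 \<Psi> \<Longrightarrow> l2 (\<lambda>x. c *\<^sub>R \<Psi> x)"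
  unfolding l2_def by (simp add: power_mult_distrib summable_on_cmult_right)

lemma l2_add:
  assumes "l2 \<Phi>" "l2 \<Psi>"
  shows "l2 (\<lambda>x. \<Phi> x + \<Psi> x)"
  unfolding l2_def
proof (rule summable_on_comparison_test)
  show "(\<lambda>x. 2 * (norm (\<Phi> x))\<^sup>2 + 2 * (norm (\<Psi> x))\<^sup>2) summable_on UNIV"
    using assms unfolding l2_def by (intro summable_on_add summable_on_cmult_right)
  show "(norm (\<Phi> x + \<Psi> x))\<^sup>2 \<le> 2 * (norm (\<Phi> x))\<^sup>2 + 2 * (norm (\<Psi> x))\<^sup>2" for x
    using inner_ge_zero[of "\<Phi> x - \<Psi> x"]
    by (simp add: power2_norm_eq_inner inner_diff_left inner_diff_right inner_add_left
        inner_add_right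
        inner_commute)
qed auto

lemma l2_minus: "l2 \<Psi> \<Longrightarrow> l2 (\<lambda>x. - \<Psi> x)"
  unfolding l2_def by simp

lemma l2_diff: "l2 \<Phi> \<Longrightarrow> l2 \<Psi> \<Longrightarrow> l2 (\<lambda>x. \<Phi> x - \<Psi> x)"
  using l2_add[of \<Phi> "\<lambda>x. - \<Psi> x"] l2_minus[of \<Psi>] by simp

lemma l2_zero: "l2 (\<lambda>x. 0)"
  unfolding l2_def by simp

lemma l2_cinner_summable:
  assumes "l2 \<Phi>" "l2 \<Psi>"
  shows "(\<lambda>x. cinner (\<Phi> x) (\<Psi> x)) summable_on UNIV"
proof (rule Infinite_Sum.abs_summable_summable[OF Infinite_Sum.abs_summable_on_comparison_test])
  show "(\<lambda>x. norm ((norm (\<Phi> x))\<^sup>2 + (norm (\<Psi> x))\<^sup>2)) summable_on UNIV"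
    using assms unfolding l2_def by (auto intro: summable_on_add)
  show "cmod (cinner (\<Phi> x) (\<Psi> x)) \<le> norm ((norm (\<Phi> x))\<^sup>2 + (norm (\<Psi> x))\<^sup>2)" for x
    using norm_cinner_le[of "\<Phi> x" "\<Psi> x"] sum_squares_bound[of "norm (\<Phi> x)" "norm (\<Psi> x)"]
      mult_nonneg_nonneg[of "norm (\<Phi> x)" "norm (\<Psi> x)"] by (simp del: mult_nonneg_nonneg)
qed

lemma l2_inner_summable:
  assumes "l2 \<Phi>" "l2 \<Psi>"
  shows "(\<lambda>x. inner (\<Phi> x) (\<Psi> x)) summable_on UNIV"
  using summable_on_Re[OF l2_cinner_summable[OF assms]] by (simp add: Re_cinner)

text \<open>The operators of the claim act on all functions. A type of square-summable ones gives
  access to \<open>real_inner\<close> and \<open>complete_space\<close>; the complex structure is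
  added by \<open>cscale\<close> and \<open>cip\<close>.\<close>

typedef hil = "{\<Psi>. l2 \<Psi>}" morphisms st hil
  using l2_zero by blast

lemma l2_st [simp]: "l2 (st h)" using st[of h] by simp
lemma st_hil [simp]: "l2 \<Psi> \<Longrightarrow> st (hil \<Psi>) = \<Psi>" by (rule hil_inverse) simp

instantiation hil :: real_inner
begin

definition "0 = hil (\<lambda>x. 0)"
definition "g + h = hil (\<lambda>x. st g x + st h x)"
definition "g - h = hil (\<lambda>x. st g x - st h x)"
definition "- h = hil (\<lambda>x. - st h x)"
definition "c *\<^sub>R h = hil (\<lambda>x. c *\<^sub>R st h x)"
definition "inner g h = (\<Sum>\<^sub>\<infinity>x. inner (st g x) (st h x))"
definition "norm (h::hil) = sqrt (inner h h)"
definition "sgn (h::hil) = inverse (norm h) *\<^sub>R h"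
definition "dist g h = norm (g - h :: hil)"
definition [code del]: "uniformity = (INF e\<in>{0<..}. principal {(x::hil, y). dist x y < e})"
definition [code del]: "open U = (\<forall>x\<in>U. eventually (\<lambda>(x', y). x' = x \<longrightarrow> y \<in> U)
    (uniformity :: (hil \<times> hil) filter))"

lemma st_simps:
  "st 0 = (\<lambda>x. 0)" "st (g + h) = (\<lambda>x. st g x + st h x)" "st (g - h) = (\<lambda>x. st g x - st h x)"
  "st (- h) = (\<lambda>x. - st h x)" "st (c *\<^sub>R h) = (\<lambda>x. c *\<^sub>R st h x)"
  unfolding zero_hil_def plus_hil_def minus_hil_def uminus_hil_def scaleR_hil_def
  by (simp_all add: l2_zero l2_add l2_diff l2_minus l2_scaleR)

instance
proof
  fix a b c :: hil and r s :: real
  show "a + b + c = a + (b + c)" "a + b = b + a" "0 + a = a" "- a + a = 0" "a - b = a + - b"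
    "r *\<^sub>R (a + b) = r *\<^sub>R a + r *\<^sub>R b" "(r + s) *\<^sub>R a = r *\<^sub>R a + s *\<^sub>R a"
    "r *\<^sub>R s *\<^sub>R a = (r * s) *\<^sub>R a" "1 *\<^sub>R a = a"
    by (simp_all add: st_inject[symmetric] st_simps fun_eq_iff algebra_simps)
  show "inner a b = inner b a" by (simp add: inner_hil_def inner_commute)
  show "inner (a + b) c = inner a c + inner b c"
    by (simp add: inner_hil_def st_simps inner_add_left infsum_add l2_inner_summable)
  show "inner (r *\<^sub>R a) b = r * inner a b"
    by (simp add: inner_hil_def st_simps infsum_cmult_right')
  show "0 \<le> inner a a" by (simp add: inner_hil_def infsum_nonneg)
  show "inner a a = 0 \<longleftrightarrow> a = 0"
  proof
    assume "inner a a = 0"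
    then have "inner (st a x) (st a x) = 0" for x
      using nonneg_infsum_le_0D[OF _ l2_inner_summable[OF l2_st l2_st], of a a x]
      by (simp add: inner_hil_def)
    then show "a = 0" by (simp add: st_inject[symmetric] st_simps fun_eq_iff)
  qed (simp add: inner_hil_def st_simps)
qed (simp_all add: norm_hil_def sgn_hil_def dist_hil_def uniformity_hil_def open_hil_def)

end

lemma norm_hil: "norm h = l2norm (st h)"
  by (simp add: norm_hil_def inner_hil_def l2norm_def dot_square_norm)

lemma norm_hil_sq: "(norm h)\<^sup>2 = (\<Sum>\<^sub>\<infinity>x. (norm (st h x))\<^sup>2)"
  by (simp add: norm_hil l2norm_def infsum_nonneg)

lemma finite_sum_le_norm_hil: "finite F \<Longrightarrow> (\<Sum>x\<in>F. (norm (st h x))\<^sup>2) \<le> (norm h)\<^sup>2"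
  unfolding norm_hil_sq by (rule finite_sum_le_infsum) (use l2_st[of h] in \<open>auto simp: l2_def\<close>)

lemma norm_st_le: "norm (st h x) \<le> norm h"
  using finite_sum_le_norm_hil[of "{x}" h] by simp

lemma norm_hil_le:
  assumes "\<And>F. finite F \<Longrightarrow> (\<Sum>x\<in>F. (norm (st h x))\<^sup>2) \<le> K\<^sup>2" "K \<ge> 0"
  shows "norm h \<le> K"
proof -
  have "(norm h)\<^sup>2 \<le> K\<^sup>2"
    unfolding norm_hil_sq by (rule infsum_le_finite_sums)
        (use l2_st[of h] assms in \<open>auto simp: l2_def\<close>)
  then show ?thesis using assms(2) power2_le_imp_le by blast
qed

instance hil :: complete_space
proof
  fix X :: "nat \<Rightarrow> hil" assume X: "Cauchy X"
  have "Cauchy (\<lambda>n. st (X n) x)" for x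
  proof (rule metric_CauchyI)
    fix e :: real assume "e > 0"
    from metric_CauchyD[OF X this] obtain N where "\<And>m n. m \<ge> N \<Longrightarrow> n \<ge> N \<Longrightarrow> dist (X m) (X n) < e"
        by blast
    moreover have "dist (st (X m) x) (st (X n) x) \<le> dist (X m) (X n)" for m n
      using norm_st_le[of "X m - X n" x] by (simp add: dist_norm st_simps)
    ultimately show "\<exists>N. \<forall>m\<ge>N. \<forall>n\<ge>N. dist (st (X m) x) (st (X n) x) < e"
      by (meson order_le_less_trans)
  qed
  then have "\<exists>l. (\<lambda>n. st (X n) x) \<longlonglongrightarrow> l" for x
    using Cauchy_convergent convergent_def by blast
  then obtain \<Phi> where \<Phi>: "\<And>x. (\<lambda>n. st (X n) x) \<longlonglongrightarrow> \<Phi> x" by metis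
  \<comment> \<open>Finite partial sums of the squared distance pass to the pointwise limit. A bound
    uniform in \<open>F\<close> then yields both membership of the limit in \<open>l2\<close> and
    convergence in norm.\<close>
  have close: "(\<Sum>x\<in>F. (norm (st (X m) x - \<Phi> x))\<^sup>2) \<le> e\<^sup>2"
    if "finite F" "m \<ge> N" "\<And>m n. m \<ge> N \<Longrightarrow> n \<ge> N \<Longrightarrow> dist (X m) (X n) < e" for F N m e
  proof (rule LIMSEQ_le_const2)
    show "(\<lambda>n. \<Sum>x\<in>F. (norm (st (X m) x - st (X n) x))\<^sup>2) \<longlonglongrightarrow> (\<Sum>x\<in>F. (norm (st (X m) x - \<Phi> x))\<^sup>2)"
      by (intro tendsto_intros \<Phi>)
    have "(\<Sum>x\<in>F. (norm (st (X m) x - st (X n) x))\<^sup>2) \<le> e\<^sup>2" if "n \<ge> N" for n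
    proof -
      have "(\<Sum>x\<in>F. (norm (st (X m) x - st (X n) x))\<^sup>2) \<le> (norm (X m - X n))\<^sup>2"
        using finite_sum_le_norm_hil[OF \<open>finite F\<close>, of "X m - X n"] by (simp add: st_simps)
      also have "\<dots> \<le> e\<^sup>2"
        using \<open>\<And>m n. m \<ge> N \<Longrightarrow> n \<ge> N \<Longrightarrow> dist (X m) (X n) < e\<close>[OF \<open>m \<ge> N\<close> \<open>n \<ge> N\<close>]
        by (intro power_mono) (auto simp: dist_norm)
      finally show ?thesis .
    qed
    then show "\<exists>N. \<forall>n\<ge>N. (\<Sum>x\<in>F. (norm (st (X m) x - st (X n) x))\<^sup>2) \<le> e\<^sup>2" by blast
  qed
  obtain N1 where N1: "\<And>m n. m \<ge> N1 \<Longrightarrow> n \<ge> N1 \<Longrightarrow> dist (X m) (X n) < 1"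
    using metric_CauchyD[OF X, of 1] by auto
  have "l2 (\<lambda>x. st (X N1) x - \<Phi> x)"
    unfolding l2_def
    by (rule nonneg_bdd_above_summable_on) (use close[OF _ order_refl N1]
        in \<open>auto intro!: bdd_aboveI2\<close>)
  from l2_diff[OF l2_st[of "X N1"] this] have l2\<Phi>: "l2 \<Phi>" by simp
  have "X \<longlonglongrightarrow> hil \<Phi>"
  proof (rule metric_LIMSEQ_I)
    fix e :: real assume "e > 0"
    then obtain N where N: "\<And>m n. m \<ge> N \<Longrightarrow> n \<ge> N \<Longrightarrow> dist (X m) (X n) < e/2"
      using metric_CauchyD[OF X, of "e/2"] by auto
    have "dist (X m) (hil \<Phi>) \<le> e/2" if "m \<ge> N" for m
      unfolding dist_norm
      by (rule norm_hil_le) (use close[OF _ that N] \<open>e > 0\<close> in \<open>auto simp: st_simps l2\<Phi>\<close>)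
    then show "\<exists>no. \<forall>n\<ge>no. dist (X n) (hil \<Phi>) < e"
      using \<open>e > 0\<close> by (metis field_sum_of_halves less_add_same_cancel1 half_gt_zero
          order_le_less_trans)
  qed
  then show "convergent X" by (auto simp: convergent_def)
qed

section \<open>Complex scalars and the complex inner product\<close>

definition cscale :: "complex \<Rightarrow> hil \<Rightarrow> hil" where
  "cscale c h = hil (\<lambda>x. c *s st h x)"

definition cip :: "hil \<Rightarrow> hil \<Rightarrow> complex" where
  "cip g h = linner (st g) (st h)"

lemma st_cscale [simp]: "st (cscale c h) = (\<lambda>x. c *s st h x)"
  unfolding cscale_def by (simp add: l2_scale)

lemma norm_cscale: "norm (cscale c h) = cmod c * norm h"
proof -
  have "(norm (cscale c h))\<^sup>2 = (cmod c * norm h)\<^sup>2"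
    by (simp add: norm_hil_sq power_mult_distrib cvec_norm_scale infsum_cmult_right')
  then show ?thesis by (simp add: power2_eq_iff_nonneg)
qed

lemma vec_smult_distribs:
  "c *s (u + v) = c *s u + c *s (v :: complex^'n)" "c *s (u - v) = c *s u - c *s v"
  "c *s (r *\<^sub>R v) = r *\<^sub>R (c *s v)" "(complex_of_real r) *s v = r *\<^sub>R v"
  "(a + c) *s v = a *s v + c *s v" "a *s (c *s v) = (a * c) *s v"
  by (simp_all add: vec_eq_iff algebra_simps scaleR_conv_of_real[where 'a = complex])

lemma linear_cscale: "linear (cscale c)"
  by (rule linearI) (simp_all add: st_inject[symmetric] st_simps vec_smult_distribs)

lemma cscale_cscale: "cscale a (cscale b h) = cscale (a * b) h"
  and cscale_1 [simp]: "cscale 1 h = h"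
  and cscale_of_real: "cscale (complex_of_real r) h = r *\<^sub>R h"
  by (simp_all add: st_inject[symmetric] st_simps vec_smult_distribs)

lemma bounded_linear_cscale: "bounded_linear (cscale c)"
  by (rule bounded_linear_intro[where K = "cmod c"])
     (simp_all add: linear_add[OF linear_cscale] linear_scale[OF linear_cscale] norm_cscale
         mult.commute)

lemma cinner_simps:
  "cinner (a + b) c = cinner a c + cinner b c" "cinner a (b + c) = cinner a b + cinner a c"
  "cinner a (z *s c) = z * cinner a c" "cinner (z *s a) c = cnj z * cinner a c"
  "cnj (cinner a b) = cinner b a" "cinner a (b - c) = cinner a b - cinner a c"
  "cinner (a - b) c = cinner a c - cinner b c" "cinner a 0 = 0" "cinner 0 a = 0"
  by (simp_all add: cinner_def algebra_simps sum.distrib sum_distrib_left sum_subtractf)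

lemma cip_simps:
  "cip (a + b) c = cip a c + cip b c" "cip a (b + c) = cip a b + cip a c"
  "cip a (cscale z c) = z * cip a c" "cip (cscale z a) c = cnj z * cip a c"
  "cnj (cip a b) = cip b a"
  unfolding cip_def linner_def
  by (simp_all add: st_simps cinner_simps infsum_add l2_cinner_summable infsum_cmult_right'
      flip: infsum_cnj)

lemma Re_cip: "Re (cip g h) = inner g h"
  unfolding cip_def linner_def inner_hil_def
  by (simp add: infsum_Re[symmetric] l2_cinner_summable Re_cinner)

lemma Im_cip: "Im (cip g h) = inner (cscale \<i> g) h"
  using Re_cip[of "cscale \<i> g" h] by (simp add: cip_simps)

lemma cip_conv_inner: "cip g h = Complex (inner g h) (inner (cscale \<i> g) h)"
  by (simp add: complex_eq_iff Re_cip Im_cip)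

lemma cip_self: "cip h h = complex_of_real ((norm h)\<^sup>2)"
proof -
  have "Im (cip h h) = 0" using arg_cong[OF cip_simps(5)[of h h], of Im] by simp
  then show ?thesis by (simp add: complex_eq_iff Re_cip dot_square_norm)
qed

lemma tendsto_cip:
  assumes "(f \<longlongrightarrow> a) F" "(g \<longlongrightarrow> b) F"
  shows "((\<lambda>x. cip (f x) (g x)) \<longlongrightarrow> cip a b) F"
  unfolding cip_conv_inner
  by (intro tendsto_intros assms bounded_linear.tendsto[OF bounded_linear_cscale])

lemma cip_eqI:
  assumes "\<And>w. cip a w = cip b w"
  shows "a = b"
proof -
  have "inner (a - b) (a - b) = 0"
    using assms[of "a - b"] by (subst inner_diff_left) (simp flip: Re_cip)
  then show ?thesis by simp
qed

text \<open>A (real) subspace closed under multiplication by \<open>\<i>\<close> has the same real and complex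
  orthogonal complements.\<close>

lemma cip_projection_exists:
  assumes S: "subspace S" "closed S" "\<And>y. y \<in> S \<Longrightarrow> cscale \<i> y \<in> S"
  obtains p where "p \<in> S" "\<And>y. y \<in> S \<Longrightarrow> cip y (x - p) = 0"
proof -
  obtain p where p: "p \<in> S" "\<And>y. y \<in> S \<Longrightarrow> inner y (x - p) = 0"
    using orthogonal_projection_exists[OF S(1,2)] by blast
  with S(3) that show thesis by (simp add: cip_conv_inner complex_eq_iff)
qed

section \<open>Trigonometric polynomials\<close>

abbreviation Lc :: "real measure" where "Lc \<equiv> lebesgue_on {0..2*pi}"

lemma AE_LcI:
  assumes "negligible N" "\<And>\<theta>. \<theta> \<in> {0..2*pi} \<Longrightarrow> \<theta> \<notin> N \<Longrightarrow> P \<theta>"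
  shows "AE \<theta> in Lc. P \<theta>"
proof (rule AE_I')
  show "N \<inter> {0..2*pi} \<in> null_sets Lc"
    using assms(1) by (simp add: null_sets_restrict_space negligible_iff_null_sets null_set_Int2)
  show "{\<theta> \<in> space Lc. \<not> P \<theta>} \<subseteq> N \<inter> {0..2*pi}"
    using assms(2) by auto
qed

lemma continuous_measurable_Lc:
  "continuous_on {0..2*pi} f \<Longrightarrow> f \<in> borel_measurable Lc"
  by (rule continuous_imp_measurable_on_sets_lebesgue) auto

lemma integrable_Lc_iff:
  fixes f :: "real \<Rightarrow> 'a::euclidean_space"
  shows "integrable Lc f \<longleftrightarrow> f absolutely_integrable_on {0..2*pi}"
  by (simp add: integrable_restrict_space set_integrable_def)

lemma integrable_Lc_nonneg:
  fixes f :: "real \<Rightarrow> real"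
  assumes "\<And>\<theta>. f \<theta> \<ge> 0" "f integrable_on {0..2*pi}"
  shows "integrable Lc f"
  unfolding integrable_Lc_iff by (rule nonnegative_absolutely_integrable_1) (use assms in auto)

lemma integral_Lc:
  fixes f :: "real \<Rightarrow> 'a::euclidean_space"
  shows "integrable Lc f \<Longrightarrow> integral {0..2*pi} f = integral\<^sup>L Lc f"
  by (rule lebesgue_integral_eq_integral[symmetric]) auto

lemma integrable_Lc_bounded:
  fixes f :: "real \<Rightarrow> 'a::euclidean_space"
  assumes "f \<in> borel_measurable Lc" "\<And>\<theta>. \<theta> \<in> {0..2*pi} \<Longrightarrow> norm (f \<theta>) \<le> K"
  shows "integrable Lc f"
proof (rule Bochner_Integration.integrable_bound[where f = "\<lambda>_. K"])
  show "integrable Lc (\<lambda>_. K)"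
    unfolding integrable_Lc_iff by (rule absolutely_integrable_continuous_real) auto
  show "AE \<theta> in Lc. norm (f \<theta>) \<le> norm K"
    using assms(2) by (intro AE_I2) force
qed (use assms in auto)

lemma integrable_Lc_mult_bounded:
  fixes f :: "real \<Rightarrow> real" and g :: "real \<Rightarrow> complex"
  assumes "integrable Lc f" "g \<in> borel_measurable Lc" "\<And>\<theta>. \<theta> \<in> {0..2*pi} \<Longrightarrow> cmod (g \<theta>) \<le> K"
  shows "integrable Lc (\<lambda>\<theta>. g \<theta> * complex_of_real (f \<theta>))"
proof (rule Bochner_Integration.integrable_bound[where f = "\<lambda>\<theta>. K * f \<theta>"])
  show "integrable Lc (\<lambda>\<theta>. K * f \<theta>)" using assms(1) by simp
  show "AE \<theta> in Lc. norm (g \<theta> * complex_of_real (f \<theta>)) \<le> norm (K * f \<theta>)"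
    using assms(3) by (intro AE_I2) (force simp: norm_mult abs_mult intro!: mult_right_mono)
qed (use assms in \<open>auto intro: borel_measurable_integrable\<close>)

definition expi :: "int \<Rightarrow> real \<Rightarrow> complex" where
  "expi n \<theta> = exp (\<i> * of_int n * of_real \<theta>)"

lemma norm_expi [simp]: "cmod (expi n \<theta>) = 1"
  by (simp add: expi_def norm_exp_eq_Re)

lemma expi_0 [simp]: "expi 0 \<theta> = 1"
  by (simp add: expi_def)

lemma expi_add: "expi (m + n) \<theta> = expi m \<theta> * expi n \<theta>"
  by (simp add: expi_def flip: exp_add) (simp add: algebra_simps)

lemma cnj_expi: "cnj (expi n \<theta>) = expi (- n) \<theta>"
  by (simp add: expi_def exp_cnj)

lemma continuous_on_expi [continuous_intros]: "continuous_on S (expi n)"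
  unfolding expi_def by (intro continuous_intros)

lemma expi_period: "expi n (2*pi) = 1"
  using exp_integer_2pi[of "of_int n"] by (simp add: expi_def mult_ac)

lemma integral_expi: "integral\<^sup>L Lc (expi n) = (if n = 0 then 2 * pi else 0)"
proof -
  have int: "integrable Lc (expi n)"
    unfolding integrable_Lc_iff by (intro absolutely_integrable_continuous_real continuous_intros)
  have "(expi n has_integral (if n = 0 then 2 * pi else 0)) {0..2*pi}"
  proof (cases "n = 0")
    case True
    have "((\<lambda>_. 1::complex) has_integral (2*pi) *\<^sub>R 1) {0..2*pi}"
      using has_integral_const_real[of "1::complex" 0 "2*pi"] by simp
    moreover have "expi 0 = (\<lambda>_. 1)" by (simp add: fun_eq_iff)
    ultimately show ?thesis using True by (simp add: scaleR_conv_of_real)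
  next
    case False
    have "(expi n has_integral (expi n (2*pi) / (\<i> * of_int n) - expi n 0 / (\<i> * of_int n)))
        {0..2*pi}"
    proof (rule fundamental_theorem_of_calculus)
      fix \<theta> :: real
      have "((\<lambda>z. exp (\<i> * of_int n * z) / (\<i> * of_int n)) has_field_derivative expi n \<theta>)
          (at (of_real \<theta>))"
        unfolding expi_def using False by (auto intro!: derivative_eq_intros)
      then show "((\<lambda>\<theta>. expi n \<theta> / (\<i> * of_int n)) has_vector_derivative expi n \<theta>)
          (at \<theta> within {0..2*pi})"
        unfolding expi_def by (rule has_vector_derivative_real_field)
    qed simp
    then show ?thesis using False expi_period[of n] by (simp add: expi_def)
  qed
  then show ?thesis using integral_Lc[OF int] by (simp add: integral_unique)
qed

text \<open>Generated by monomials and sums, so that inductions run in parallel with the operator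
  version \<open>trig_op\<close>.\<close>

inductive trigpoly :: "(real \<Rightarrow> complex) \<Rightarrow> bool" where
  monom: "trigpoly (\<lambda>\<theta>. c * expi n \<theta>)"
| add: "trigpoly p \<Longrightarrow> trigpoly q \<Longrightarrow> trigpoly (\<lambda>\<theta>. p \<theta> + q \<theta>)"

lemma trigpoly_const: "trigpoly (\<lambda>\<theta>. c)"
  using trigpoly.monom[of c 0] by simp

lemma trigpoly_mult:
  assumes "trigpoly p" "trigpoly q"
  shows "trigpoly (\<lambda>\<theta>. p \<theta> * q \<theta>)"
  using assms(1)
proof induction
  case (monom c n)
  show ?case using assms(2)
  proof induction
    case (monom d m)
    show ?case using trigpoly.monom[of "c * d" "n + m"] by (simp add: expi_add mult_ac)
  next
    case (add p q)
    then show ?case using trigpoly.add by (simp add: distrib_left)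
  qed
next
  case (add p q)
  then show ?case using trigpoly.add by (simp add: distrib_right)
qed

text \<open>On the unit circle a real linear form is a combination of \<open>cos\<close> and
  \<open>sin\<close>, hence of \<open>expi 1\<close> and \<open>expi (-1)\<close>; sums and products
  preserve the class.\<close>

lemma real_polynomial_trigpoly:
  assumes "real_polynomial_function p"
  shows "trigpoly (\<lambda>\<theta>. complex_of_real (p (cis \<theta>)))"
  using assms
proof induction
  case (linear h)
  interpret bounded_linear h by fact
  have "complex_of_real (h (cis \<theta>))
      = (h 1 - \<i> * h \<i>) / 2 * expi 1 \<theta> + (h 1 + \<i> * h \<i>) / 2 * expi (-1) \<theta>" for \<theta>
  proof -
    have "cis \<theta> = cos \<theta> *\<^sub>R 1 + sin \<theta> *\<^sub>R \<i>" by (simp add: complex_eq_iff)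
    then have "h (cis \<theta>) = cos \<theta> * h 1 + sin \<theta> * h \<i>" by (simp only: add scaleR real_scaleR_def)
    moreover have "expi 1 \<theta> = cis \<theta>" "expi (-1) \<theta> = cis (- \<theta>)"
      by (simp_all add: expi_def cis_conv_exp mult_ac)
    ultimately show ?thesis by (simp add: complex_eq_iff field_simps)
  qed
  then show ?case by (simp only: trigpoly.intros)
next
  case (const c)
  show ?case by (rule trigpoly_const)
next
  case (add f g)
  then show ?case using trigpoly.add by simp
next
  case (mult f g)
  then show ?case using trigpoly_mult by simp
qed

text \<open>Continuous periodic functions live on the circle, where Stone--Weierstrass applies.\<close>

lemma trigpoly_approx:
  fixes g :: "real \<Rightarrow> real"
  assumes "continuous_on {0..2*pi} g" "g 0 = g (2*pi)" "e > 0"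
  obtains p where "trigpoly p" "\<And>\<theta>. \<theta> \<in> {0..2*pi} \<Longrightarrow> cmod (complex_of_real (g \<theta>) - p \<theta>) < e"
proof -
  define \<gamma> where "\<gamma> = (\<lambda>t. g (2*pi*t))"
  have "path \<gamma>" unfolding path_def \<gamma>_def
    by (rule continuous_on_compose2[OF assms(1)]) (auto intro!: continuous_intros)
  \<comment> \<open>The trivial homotopy of the loop with itself is used to transfer the loop to the
    circle, which yields continuity across the cut of \<open>Arg2pi\<close>.\<close>
  then have "homotopic_loops UNIV \<gamma> \<gamma>"
    by (simp add: homotopic_loops_refl pathstart_def pathfinish_def \<gamma>_def assms(2))
  from homotopic_with_imp_continuous[OF homotopic_loops_imp_homotopic_circlemaps[OF this]]
  have "continuous_on (sphere 0 1) (\<gamma> \<circ> (\<lambda>z. Arg2pi z / (2*pi)))" by simp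
  then obtain q where q: "real_polynomial_function q"
      "\<And>z. z \<in> sphere 0 1 \<Longrightarrow> \<bar>(\<gamma> \<circ> (\<lambda>z. Arg2pi z / (2*pi))) z - q z\<bar> < e"
    using Stone_Weierstrass_real_polynomial_function[of "sphere 0 1" _ e] assms(3) by auto
  have "cmod (complex_of_real (g \<theta>) - complex_of_real (q (cis \<theta>))) < e" if \<theta>: "\<theta> \<in> {0..2*pi}" for \<theta>
  proof -
    have "g (Arg2pi (cis \<theta>)) = g \<theta>"
    proof (cases "\<theta> = 2*pi")
      case True
      then show ?thesis using assms(2) by (simp add: Arg2pi_of_real[of 1, simplified])
    next
      case False
      then have "Arg2pi (cis \<theta>) = \<theta>"
        using \<theta> by (intro Arg2pi_unique[of 1]) (auto simp: cis_conv_exp)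
      then show ?thesis by simp
    qed
    moreover have "cmod (complex_of_real (g \<theta>) - complex_of_real (q (cis \<theta>))) = \<bar>g \<theta> - q (cis \<theta>)\<bar>"
      by (metis norm_of_real of_real_diff)
    ultimately show ?thesis using q(2)[of "cis \<theta>"] by (simp add: \<gamma>_def)
  qed
  with that[OF real_polynomial_trigpoly[OF q(1)]] show thesis by blast
qed

section \<open>Absolutely continuous vectors of a unitary operator\<close>

lemma cmod_square: "complex_of_real ((cmod z)\<^sup>2) = cnj z * z"
  using complex_norm_square[of z] by (simp add: mult.commute)

lemma continuous_bounded_Lc:
  fixes p :: "real \<Rightarrow> complex"
  assumes "continuous_on {0..2*pi} p"
  obtains K where "\<And>\<theta>. \<theta> \<in> {0..2*pi} \<Longrightarrow> cmod (p \<theta>) \<le> K"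
  using compact_imp_bounded[OF compact_continuous_image[OF assms]] unfolding bounded_iff by blast

lemma integrable_continuous_mult:
  assumes "integrable Lc f" "continuous_on {0..2*pi} p"
  shows "integrable Lc (\<lambda>\<theta>. p \<theta> * complex_of_real (f \<theta>))"
proof -
  obtain K where "\<And>\<theta>. \<theta> \<in> {0..2*pi} \<Longrightarrow> cmod (p \<theta>) \<le> K"
    using continuous_bounded_Lc[OF assms(2)] by blast
  then show ?thesis by (rule integrable_Lc_mult_bounded[OF assms(1)
      continuous_measurable_Lc[OF assms(2)]])
qed

definition zpow :: "('a \<Rightarrow> 'a) \<Rightarrow> int \<Rightarrow> 'a \<Rightarrow> 'a" where
  "zpow A n = (if n \<ge> 0 then A ^^ nat n else inv A ^^ nat (- n))"

lemma zpow_of_nat [simp]: "zpow A (int n) = A ^^ n"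
  by (simp add: zpow_def)

lemma zpow_0 [simp]: "zpow A 0 x = x"
  by (simp add: zpow_def)

lemma zpow_Suc:
  assumes "bij A"
  shows "zpow A (n + 1) x = A (zpow A n x)"
proof (cases "n \<ge> 0")
  case True
  then show ?thesis by (simp add: zpow_def nat_add_distrib)
next
  case False
  then obtain m where m: "n = - int (Suc m)" by (metis not_le negD)
  have "A (inv A y) = y" for y using assms by (simp add: bij_is_surj surj_f_inv_f)
  then show ?thesis using m by (auto simp: zpow_def nat_add_distrib)
qed

lemma zpow_add:
  assumes "bij A"
  shows "zpow A (m + n) x = zpow A m (zpow A n x)"
proof (induction m rule: int_induct[where k = 0])
  case (step1 i)
  then show ?case using zpow_Suc[OF assms, of "i + n"] zpow_Suc[OF assms, of i]
      by (simp add: algebra_simps)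
next
  case (step2 i)
  have "A (zpow A (i - 1 + n) x) = A (zpow A (i - 1) (zpow A n x))"
    using step2 zpow_Suc[OF assms, of "i - 1 + n" x] zpow_Suc[OF assms, of "i - 1" "zpow A n x"]
    by (simp add: algebra_simps)
  then show ?case using assms by (simp add: bij_is_inj inj_eq)
qed simp

section \<open>Trigonometric polynomials of a unitary operator\<close>

locale cunitary = unitary_op A for A :: "hil \<Rightarrow> hil" +
  assumes clin: "A (cscale c h) = cscale c (A h)"
begin

lemma clin_pow: "(A ^^ n) (cscale c h) = cscale c ((A ^^ n) h)"
  by (induction n) (simp_all add: clin)

lemma cunitary_inv: "cunitary (inv A)"
proof (intro cunitary.intro cunitary_axioms.intro unitary_inv)
  show "inv A (cscale c h) = cscale c (inv A h)" for c h
    using surj by (intro inv_f_eq[OF inj]) (simp add: clin surj_f_inv_f)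
qed

lemma zpow_unitary:
  "linear (zpow A n)" "norm (zpow A n x) = norm x" "zpow A n (cscale c h) = cscale c (zpow A n h)"
proof -
  interpret I: cunitary "inv A" by (rule cunitary_inv)
  show "linear (zpow A n)" "norm (zpow A n x) = norm x"
      "zpow A n (cscale c h) = cscale c (zpow A n h)"
    unfolding zpow_def by (simp_all add: linear_pow I.linear_pow iso_pow I.iso_pow clin_pow
        I.clin_pow)
qed

lemma cip_zpow_zpow: "cip (zpow A n g) (zpow A n h) = cip g h"
proof -
  have "inner (zpow A n g) (zpow A n h) = inner g h" for g h
    by (rule isometry_inner) (rule zpow_unitary)+
  then show ?thesis by (simp add: cip_conv_inner zpow_unitary(3)[symmetric])
qed

lemma cip_zpow: "cip (zpow A m g) (zpow A n h) = cip g (zpow A (n - m) h)"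
  using cip_zpow_zpow[of m g "zpow A (n - m) h"] zpow_add[OF bij, of m "n - m" h] by simp

text \<open>Expresses through Fourier coefficients that the spectral measure of
  \<open>\<psi>\<close> is \<open>f\<close> times Lebesgue measure on the circle.\<close>

definition ac_density :: "hil \<Rightarrow> (real \<Rightarrow> real) \<Rightarrow> bool" where
  "ac_density \<psi> f \<longleftrightarrow> (\<forall>\<theta>. f \<theta> \<ge> 0) \<and> integrable Lc f \<and>
     (\<forall>n. cip \<psi> (zpow A n \<psi>) = (LINT \<theta>|Lc. expi n \<theta> * of_real (f \<theta>)))"

text \<open>\<open>trig_op \<psi> p v\<close> states \<open>v = p(A) \<psi>\<close>, where \<open>e\<^sup>i\<^sup>\<theta>\<close> is replaced by \<open>A\<close>.\<close>

inductive trig_op :: "hil \<Rightarrow> (real \<Rightarrow> complex) \<Rightarrow> hil \<Rightarrow> bool" for \<psi> where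
  monom: "trig_op \<psi> (\<lambda>\<theta>. c * expi n \<theta>) (cscale c (zpow A n \<psi>))"
| add: "trig_op \<psi> p v \<Longrightarrow> trig_op \<psi> q w \<Longrightarrow> trig_op \<psi> (\<lambda>\<theta>. p \<theta> + q \<theta>) (v + w)"

lemma trig_op_exists: "trigpoly p \<Longrightarrow> \<exists>v. trig_op \<psi> p v"
  by (induction rule: trigpoly.induct) (auto intro: trig_op.intros)

lemma trig_op_continuous: "trig_op \<psi> p v \<Longrightarrow> continuous_on S p"
  by (induction rule: trig_op.induct) (auto intro!: continuous_intros)

lemma trig_op_scale: "trig_op \<psi> p v \<Longrightarrow> trig_op \<psi> (\<lambda>\<theta>. c * expi n \<theta> * p \<theta>) (cscale c (zpow A n v))"
proof (induction rule: trig_op.induct)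
  case (monom d m)
  have "(\<lambda>\<theta>. c * expi n \<theta> * (d * expi m \<theta>)) = (\<lambda>\<theta>. (c * d) * expi (n + m) \<theta>)"
    by (simp add: expi_add mult_ac)
  moreover have "cscale c (zpow A n (cscale d (zpow A m \<psi>))) = cscale (c * d) (zpow A (n + m) \<psi>)"
    by (simp add: zpow_add[OF bij] zpow_unitary(3) cscale_cscale)
  ultimately show ?case using trig_op.monom by simp
next
  case (add p v q w)
  then show ?case
    using trig_op.add by (simp add: distrib_left linear_add[OF zpow_unitary(1)]
        linear_add[OF linear_cscale])
qed

lemma trig_op_diff:
  assumes "trig_op \<psi> p v" "trig_op \<psi> q w"
  shows "trig_op \<psi> (\<lambda>\<theta>. p \<theta> - q \<theta>) (v - w)"
proof -
  have "cscale (-1) w = - w" using cscale_of_real[of "-1" w] by simp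
  with trig_op.add[OF assms(1) trig_op_scale[OF assms(2), of "-1" 0]] show ?thesis by simp
qed

lemma trig_op_sum:
  assumes "trig_op \<psi> p v" "finite F"
  shows "trig_op \<psi> (\<lambda>\<theta>. (\<Sum>r\<in>F. of_real (c r) * expi (int r) \<theta>) * p \<theta>) (\<Sum>r\<in>F. c r *\<^sub>R (A ^^ r) v)"
  using assms(2)
proof (induction F)
  case empty
  show ?case using trig_op_scale[OF assms(1), of 0 0] cscale_of_real[of 0 v] by simp
next
  case (insert r F)
  have "trig_op \<psi> (\<lambda>\<theta>. of_real (c r) * expi (int r) \<theta> * p \<theta>) (c r *\<^sub>R (A ^^ r) v)"
    using trig_op_scale[OF assms(1), of "of_real (c r)" "int r"] by (simp add: cscale_of_real)
  from trig_op.add[OF this insert.IH] show ?case using insert by (simp add: distrib_right)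
qed

text \<open>Both sides are sesquilinear, so monomials decide, and for them it is the definition of
  the density. The map from \<open>p\<close> to \<open>p(A) \<psi>\<close> is thereby isometric for
  the weight \<open>f\<close>: a functional calculus on the cyclic subspace of
  \<open>\<psi>\<close>.\<close>

lemma trig_op_cip:
  assumes f: "ac_density \<psi> f" and "trig_op \<psi> p v" "trig_op \<psi> q w"
  shows "cip v w = (LINT \<theta>|Lc. cnj (p \<theta>) * q \<theta> * of_real (f \<theta>))"
proof -
  have fint: "integrable Lc f" using f by (simp add: ac_density_def)
  show ?thesis using assms(2)
  proof induction
    case (monom c n)
    show ?case using assms(3)
    proof induction
      case (monom d m)
      have "cip (cscale c (zpow A n \<psi>)) (cscale d (zpow A m \<psi>))
          = (LINT \<theta>|Lc. cnj c * d * (expi (m - n) \<theta> * of_real (f \<theta>)))"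
        using f by (simp add: cip_simps cip_zpow ac_density_def mult_ac)
      also have "(\<lambda>\<theta>. cnj c * d * (expi (m - n) \<theta> * of_real (f \<theta>)))
          = (\<lambda>\<theta>. cnj (c * expi n \<theta>) * (d * expi m \<theta>) * of_real (f \<theta>))"
        using expi_add[of "- n" m] by (simp add: cnj_expi mult_ac)
      finally show ?case .
    next
      case (add p v q w)
      have "integrable Lc (\<lambda>\<theta>. cnj (c * expi n \<theta>) * p \<theta> * of_real (f \<theta>))"
        "integrable Lc (\<lambda>\<theta>. cnj (c * expi n \<theta>) * q \<theta> * of_real (f \<theta>))"
        by (intro integrable_continuous_mult fint continuous_intros
            trig_op_continuous[OF add.hyps(1)]
          trig_op_continuous[OF add.hyps(2)])+
      from Bochner_Integration.integral_add[OF this] show ?case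
        using add.IH by (simp only: cip_simps distrib_left distrib_right)
    qed
  next
    case (add p v q' w')
    have "integrable Lc (\<lambda>\<theta>. cnj (p \<theta>) * q \<theta> * of_real (f \<theta>))"
        "integrable Lc (\<lambda>\<theta>. cnj (q' \<theta>) * q \<theta> * of_real (f \<theta>))"
      by (intro integrable_continuous_mult fint continuous_intros trig_op_continuous[OF add.hyps(1)]
          trig_op_continuous[OF add.hyps(2)] trig_op_continuous[OF assms(3)])+
    from Bochner_Integration.integral_add[OF this] show ?case
      using add.IH by (simp only: cip_simps distrib_right complex_cnj_add)
  qed
qed

lemma trig_op_norm:
  assumes "ac_density \<psi> f" "trig_op \<psi> p v"
  shows "(norm v)\<^sup>2 = (LINT \<theta>|Lc. (cmod (p \<theta>))\<^sup>2 * f \<theta>)"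
proof -
  have "complex_of_real ((norm v)\<^sup>2) = (LINT \<theta>|Lc. cnj (p \<theta>) * p \<theta> * of_real (f \<theta>))"
    using trig_op_cip[OF assms(1,2,2)] cip_self[of v] by simp
  also have "\<dots> = (LINT \<theta>|Lc. complex_of_real ((cmod (p \<theta>))\<^sup>2 * f \<theta>))"
    by (simp only: of_real_mult cmod_square)
  also have "\<dots> = complex_of_real (LINT \<theta>|Lc. (cmod (p \<theta>))\<^sup>2 * f \<theta>)"
    by (rule integral_complex_of_real)
  finally show ?thesis by (simp only: of_real_eq_iff)
qed

end

lemma integral_trigpoly_square:
  fixes c :: "nat \<Rightarrow> real"
  assumes "finite F"
  shows "(LINT \<theta>|Lc. (cmod (\<Sum>r\<in>F. of_real (c r) * expi (int r) \<theta>))\<^sup>2) = 2 * pi * (\<Sum>r\<in>F. (c r)\<^sup>2)"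
proof -
  have int: "integrable Lc (\<lambda>\<theta>. z * expi n \<theta>)" for z n
    unfolding integrable_Lc_iff by (intro absolutely_integrable_continuous_real continuous_intros)
  let ?p = "\<lambda>\<theta>. \<Sum>r\<in>F. of_real (c r) * expi (int r) \<theta>"
  have "complex_of_real (LINT \<theta>|Lc. (cmod (?p \<theta>))\<^sup>2) = (LINT \<theta>|Lc. cnj (?p \<theta>) * ?p \<theta>)"
    unfolding cmod_square[symmetric] by (rule integral_complex_of_real[symmetric])
  also have "(\<lambda>\<theta>. cnj (?p \<theta>) * ?p \<theta>)
      = (\<lambda>\<theta>. \<Sum>r\<in>F. \<Sum>r'\<in>F. (of_real (c r) * of_real (c r')) * expi (int r' - int r) \<theta>)"
  proof (intro ext, unfold cnj_sum sum_product, intro sum.cong refl)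
    fix \<theta> r r'
    show "cnj (of_real (c r) * expi (int r) \<theta>) * (of_real (c r') * expi (int r') \<theta>)
        = of_real (c r) * of_real (c r') * expi (int r' - int r) \<theta>"
      using expi_add[of "int r'" "- int r" \<theta>] by (simp add: cnj_expi)
  qed
  also have "integral\<^sup>L Lc \<dots>
      = (\<Sum>r\<in>F. LINT \<theta>|Lc. (\<Sum>r'\<in>F. (of_real (c r) * of_real (c r')) * expi (int r' - int r) \<theta>))"
    by (rule Bochner_Integration.integral_sum, rule Bochner_Integration.integrable_sum, rule int)
  also have "\<dots> = (\<Sum>r\<in>F. \<Sum>r'\<in>F. LINT \<theta>|Lc. (of_real (c r) * of_real (c r')) * expi (int r' - int r)
      \<theta>)"
    by (rule sum.cong[OF refl], rule Bochner_Integration.integral_sum, rule int)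
  also have "\<dots> = (\<Sum>r\<in>F. \<Sum>r'\<in>F. if r' = r then complex_of_real ((c r)\<^sup>2 * (2 * pi)) else 0)"
    by (rule sum.cong[OF refl], rule sum.cong[OF refl])
       (simp only: integral_mult_right_zero integral_expi, simp add: power2_eq_square)
  also have "\<dots> = complex_of_real (2 * pi * (\<Sum>r\<in>F. (c r)\<^sup>2))"
    using assms by (simp only: sum.delta if_True sum_distrib_left) (simp add: mult_ac)
  finally show ?thesis by (simp only: of_real_eq_iff)
qed

lemma square_sum_le: "(a + b)\<^sup>2 \<le> 2 * a\<^sup>2 + 2 * b\<^sup>2" for a b :: real
  using zero_le_power2[of "a - b"] by (simp add: power2_sum power2_diff)

text \<open>The uniform bound is what makes dominated convergence applicable when these functions
  are multiplied by an integrable, possibly unbounded density. Measurability supplies continuous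
  approximations; periodicity is imposed by hand.\<close>

lemma trigpoly_approx_indicator:
  assumes "E \<in> sets Lc"
  obtains p where "\<And>n. trigpoly (p n)" "\<And>n \<theta>. \<theta> \<in> {0..2*pi} \<Longrightarrow> cmod (p n \<theta>) \<le> 2"
    "AE \<theta> in Lc. (\<lambda>n. p n \<theta>) \<longlonglongrightarrow> indicator E \<theta>"
proof -
  have "(indicator E :: real \<Rightarrow> real) measurable_on {0..2*pi}"
    by (rule measurable_on_iff_borel_measurable[THEN iffD2, OF _
        borel_measurable_indicator[OF assms]]) simp
  then obtain N g where N: "negligible N" and g: "\<And>n. continuous_on UNIV (g n)"
    and lim: "\<And>\<theta>. \<theta> \<notin> N \<Longrightarrow> (\<lambda>n. g n \<theta>) \<longlonglongrightarrow> (if \<theta> \<in> {0..2*pi} then indicator E \<theta> else (0::real))"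
    unfolding measurable_on_def by blast
  \<comment> \<open>Clamping gives the bound 1. The two ramps vanish at the endpoints, so
    \<open>h n\<close> takes equal values there, and at every interior point they are eventually
    1.\<close>
  define h where "h n \<theta> = max 0 (min 1 (g n \<theta>)) *
      (min 1 (real n * \<theta>) * min 1 (real n * (2*pi - \<theta>)))" for n \<theta>
  have h1: "\<bar>h n \<theta>\<bar> \<le> 1" if "\<theta> \<in> {0..2*pi}" for n \<theta>
    using that unfolding h_def abs_mult by (intro mult_le_one) auto
  have "\<exists>p. trigpoly p \<and> (\<forall>\<theta>\<in>{0..2*pi}. cmod (complex_of_real (h n \<theta>) - p \<theta>) < inverse
      (real (Suc n)))" for n
  proof -
    have "continuous_on {0..2*pi} (h n)"
      unfolding h_def by (intro continuous_intros continuous_on_subset[OF g]) auto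
    moreover have "h n 0 = h n (2*pi)" by (simp add: h_def)
    ultimately show ?thesis
      by (rule trigpoly_approx[where e = "inverse (real (Suc n))"]) auto
  qed
  then obtain p where p: "\<And>n. trigpoly (p n)"
    "\<And>n \<theta>. \<theta> \<in> {0..2*pi} \<Longrightarrow> cmod (complex_of_real (h n \<theta>) - p n \<theta>) < inverse (real (Suc n))" by metis
  have "cmod (p n \<theta>) \<le> 2" if "\<theta> \<in> {0..2*pi}" for n \<theta>
  proof -
    have "inverse (real (Suc n)) \<le> 1" by (simp add: inverse_le_1_iff)
    then show ?thesis
      using norm_triangle_sub[of "p n \<theta>" "complex_of_real (h n \<theta>)"] p(2)[OF that, of n]
          h1[OF that, of n]
      by (simp add: norm_minus_commute)
  qed
  moreover have "AE \<theta> in Lc. (\<lambda>n. p n \<theta>) \<longlonglongrightarrow> indicator E \<theta>"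
  proof (rule AE_LcI)
    show "negligible (N \<union> {0, 2*pi})" using N by (simp add: negligible_Un)
    fix \<theta> assume \<theta>: "\<theta> \<in> {0..2*pi}" "\<theta> \<notin> N \<union> {0, 2*pi}"
    have ev: "(\<lambda>n. min 1 (real n * a)) \<longlonglongrightarrow> 1" if "a > 0" for a :: real
    proof (rule tendsto_eventually)
      obtain k where k: "1 < real k * a" using reals_Archimedean3[OF \<open>a > 0\<close>] by blast
      have "min 1 (real n * a) = 1" if "n \<ge> k" for n
      proof -
        have "real k * a \<le> real n * a" using that \<open>a > 0\<close> by (intro mult_right_mono) auto
        with k show ?thesis by simp
      qed
      then show "\<forall>\<^sub>F n in sequentially. min 1 (real n * a) = 1"
        unfolding eventually_sequentially by blast
    qed
    have "(\<lambda>n. h n \<theta>) \<longlonglongrightarrow> max 0 (min 1 (indicator E \<theta>)) * (1 * 1)"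
      unfolding h_def using \<theta> lim[of \<theta>] by (intro tendsto_intros ev) auto
    then have "(\<lambda>n. complex_of_real (h n \<theta>)) \<longlonglongrightarrow> complex_of_real (indicator E \<theta>)"
      by (intro tendsto_of_real) (simp add: indicator_def)
    moreover have "(\<lambda>n. h n \<theta> - p n \<theta>) \<longlonglongrightarrow> 0"
      by (rule Lim_null_comparison[OF _ LIMSEQ_inverse_real_of_nat])
         (use p(2)[OF \<theta>(1)] in \<open>auto intro!: always_eventually less_imp_le\<close>)
    ultimately have "(\<lambda>n. h n \<theta> - (h n \<theta> - p n \<theta>)) \<longlonglongrightarrow> complex_of_real (indicator E \<theta>) - 0"
      by (rule tendsto_diff)
    then show "(\<lambda>n. p n \<theta>) \<longlonglongrightarrow> indicator E \<theta>" by (cases "\<theta> \<in> E") simp_all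
  qed
  ultimately show thesis using that p(1) by blast
qed

context cunitary
begin

text \<open>The approximating vector is \<open>\<chi>(A) \<psi>\<close> with \<open>\<chi>\<close> the indicator of the set where the density is
  at most \<open>M\<close>, obtained as the limit of \<open>p\<^sub>n(A) \<psi>\<close> for trigonometric polynomials \<open>p\<^sub>n \<rightarrow> \<chi>\<close>.\<close>

lemma ac_density_cutoff:
  assumes f: "ac_density \<psi> f" and M: "M \<ge> 0"
  obtains \<phi> where "kato_bound A (2 * pi * M) \<phi>"
    "(norm (\<psi> - \<phi>))\<^sup>2 = (LINT \<theta>|Lc. indicator {\<theta>. f \<theta> > M} \<theta> * f \<theta>)"
proof -
  have f0: "f \<theta> \<ge> 0" and fint: "integrable Lc f" for \<theta> using f by (auto simp: ac_density_def)
  have [measurable]: "f \<in> borel_measurable Lc" using fint by (rule borel_measurable_integrable)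
  define E where "E = {\<theta> \<in> space Lc. f \<theta> \<le> M}"
  have [measurable]: "E \<in> sets Lc" unfolding E_def by measurable
  obtain p where p: "\<And>n. trigpoly (p n)" "\<And>n \<theta>. \<theta> \<in> {0..2*pi} \<Longrightarrow> cmod (p n \<theta>) \<le> 2"
    and lim: "AE \<theta> in Lc. (\<lambda>n. p n \<theta>) \<longlonglongrightarrow> indicator E \<theta>"
    using trigpoly_approx_indicator[OF \<open>E \<in> sets Lc\<close>] by blast
  obtain v where v: "\<And>n. trig_op \<psi> (p n) (v n)" using trig_op_exists[OF p(1)] by metis
  have [measurable]: "p n \<in> borel_measurable Lc" for n
    using trig_op_continuous[OF v] by (rule continuous_measurable_Lc)
  \<comment> \<open>Kept general in \<open>q\<close> and \<open>c\<close>: with both equal to 1 it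
    gives the distance of \<open>\<psi>\<close> to the limit, and with \<open>c = 0\<close> and a
    trigonometric \<open>q\<close> it gives the Kato bound.\<close>
  have dct: "(\<lambda>n. LINT \<theta>|Lc. (cmod (q \<theta> * (c - p n \<theta>)))\<^sup>2 * f \<theta>)
      \<longlonglongrightarrow> (LINT \<theta>|Lc. (cmod (q \<theta> * (c - indicator E \<theta>)))\<^sup>2 * f \<theta>)"
    if q: "continuous_on {0..2*pi} q" for q c
  proof -
    obtain K where K: "\<And>\<theta>. \<theta> \<in> {0..2*pi} \<Longrightarrow> cmod (q \<theta>) \<le> K" using continuous_bounded_Lc[OF q]
        by blast
    have [measurable]: "q \<in> borel_measurable Lc" using q by (rule continuous_measurable_Lc)
    show ?thesis
    proof (rule integral_dominated_convergence[where w = "\<lambda>\<theta>. (K * (cmod c + 2))\<^sup>2 * f \<theta>"])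
      show "AE \<theta> in Lc. (\<lambda>n. (cmod (q \<theta> * (c - p n \<theta>)))\<^sup>2 * f \<theta>)
          \<longlonglongrightarrow> (cmod (q \<theta> * (c - indicator E \<theta>)))\<^sup>2 * f \<theta>"
        using lim by eventually_elim (intro tendsto_intros)
      show "AE \<theta> in Lc. norm ((cmod (q \<theta> * (c - p n \<theta>)))\<^sup>2 * f \<theta>) \<le> (K * (cmod c + 2))\<^sup>2 * f \<theta>"
          for n
      proof (rule AE_I2)
        fix \<theta> assume "\<theta> \<in> space Lc"
        then have \<theta>: "\<theta> \<in> {0..2*pi}" by simp
        have "cmod (c - p n \<theta>) \<le> cmod c + 2"
          using norm_triangle_ineq4[of c "p n \<theta>"] p(2)[OF \<theta>, of n] by linarith
        then have "cmod (q \<theta> * (c - p n \<theta>)) \<le> K * (cmod c + 2)"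
          unfolding norm_mult using K[OF \<theta>] by (intro mult_mono)
              (auto intro: order_trans[OF norm_ge_zero])
        then show "norm ((cmod (q \<theta> * (c - p n \<theta>)))\<^sup>2 * f \<theta>) \<le> (K * (cmod c + 2))\<^sup>2 * f \<theta>"
          using f0 by (simp add: abs_mult mult_right_mono power_mono)
      qed
    qed (use fint in auto)
  qed
  have p3: "cmod (p n \<theta> - indicator E \<theta>) \<le> 3" if "\<theta> \<in> {0..2*pi}" for n \<theta>
    using norm_triangle_ineq4[of "p n \<theta>" "indicator E \<theta>"] p(2)[OF that, of n]
    by (auto simp: indicator_def split: if_splits)
  have p4: "cmod (p m \<theta> - p n \<theta>) \<le> 4" if "\<theta> \<in> {0..2*pi}" for m n \<theta>
    using norm_triangle_ineq4[of "p m \<theta>" "p n \<theta>"] p(2)[OF that, of n] p(2)[OF that, of m]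
        by linarith
  have dct1: "(\<lambda>n. LINT \<theta>|Lc. (cmod (p n \<theta> - indicator E \<theta>))\<^sup>2 * f \<theta>) \<longlonglongrightarrow> 0"
  proof -
    have "(\<lambda>n. LINT \<theta>|Lc. (cmod (p n \<theta> - indicator E \<theta>))\<^sup>2 * f \<theta>) \<longlonglongrightarrow>
        (LINT \<theta>|Lc. (cmod (indicator E \<theta> - indicator E \<theta>))\<^sup>2 * f \<theta>)"
    proof (rule integral_dominated_convergence[where w = "\<lambda>\<theta>. 3\<^sup>2 * f \<theta>"])
      show "AE \<theta> in Lc. (\<lambda>n. (cmod (p n \<theta> - indicator E \<theta>))\<^sup>2 * f \<theta>)
          \<longlonglongrightarrow> (cmod (indicator E \<theta> - indicator E \<theta>))\<^sup>2 * f \<theta>"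
        using lim by eventually_elim (intro tendsto_intros)
      show "AE \<theta> in Lc. norm ((cmod (p n \<theta> - indicator E \<theta>))\<^sup>2 * f \<theta>) \<le> 3\<^sup>2 * f \<theta>" for n
      proof (rule AE_I2)
        fix \<theta> assume "\<theta> \<in> space Lc"
        then have "cmod (p n \<theta> - indicator E \<theta>) \<le> 3" using p3 by simp
        then have "(cmod (p n \<theta> - indicator E \<theta>))\<^sup>2 \<le> 3\<^sup>2" by (rule power_mono) simp
        then show "norm ((cmod (p n \<theta> - indicator E \<theta>))\<^sup>2 * f \<theta>) \<le> 3\<^sup>2 * f \<theta>"
          using f0 by (simp add: abs_mult mult_right_mono)
      qed
    qed (use fint in auto)
    then show ?thesis by simp
  qed
  have int: "integrable Lc (\<lambda>\<theta>. (cmod (q \<theta>))\<^sup>2 * f \<theta>)"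
    if [measurable]: "q \<in> borel_measurable Lc" and "\<And>\<theta>. \<theta> \<in> {0..2*pi} \<Longrightarrow> cmod (q \<theta>) \<le> K"
        for q :: "real \<Rightarrow> complex" and K
    by (rule Bochner_Integration.integrable_bound[where f = "\<lambda>\<theta>. K\<^sup>2 * f \<theta>"])
       (use fint f0 that in \<open>auto simp: abs_mult intro!: AE_I2 mult_right_mono power_mono\<close>)
  have "Cauchy v"
  proof (rule metric_CauchyI)
    fix e :: real assume "e > 0"
    then obtain k where k: "\<And>n. n \<ge> k \<Longrightarrow> (LINT \<theta>|Lc. (cmod (p n \<theta> - indicator E \<theta>))\<^sup>2 * f \<theta>) < e\<^sup>2
        / 4"
      using order_tendstoD(2)[OF dct1, of "e\<^sup>2/4"] unfolding eventually_sequentially by auto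
    have "dist (v m) (v n) < e" if "m \<ge> k" "n \<ge> k" for m n
    proof -
      have i: "integrable Lc (\<lambda>\<theta>. (cmod (p n \<theta> - indicator E \<theta>))\<^sup>2 * f \<theta>)" for n
        by (rule int[OF _ p3]) measurable
      have "(dist (v m) (v n))\<^sup>2 = (LINT \<theta>|Lc. (cmod (p m \<theta> - p n \<theta>))\<^sup>2 * f \<theta>)"
        unfolding dist_norm by (rule trig_op_norm[OF f trig_op_diff[OF v v]])
      also have "\<dots> \<le> (LINT \<theta>|Lc. 2 * ((cmod (p m \<theta> - indicator E \<theta>))\<^sup>2 * f \<theta>) + 2 *
          ((cmod (p n \<theta> - indicator E \<theta>))\<^sup>2 * f \<theta>))"
      proof (rule integral_mono)
        show "integrable Lc (\<lambda>\<theta>. (cmod (p m \<theta> - p n \<theta>))\<^sup>2 * f \<theta>)"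
          by (rule int[OF _ p4]) measurable
        fix \<theta>
        have "cmod (p m \<theta> - p n \<theta>) \<le> cmod (p m \<theta> - indicator E \<theta>) + cmod (p n \<theta> - indicator E \<theta>)"
          using norm_triangle_ineq4[of "p m \<theta> - indicator E \<theta>" "p n \<theta> - indicator E \<theta>"] by simp
        then have "(cmod (p m \<theta> - p n \<theta>))\<^sup>2 \<le>
            (cmod (p m \<theta> - indicator E \<theta>) + cmod (p n \<theta> - indicator E \<theta>))\<^sup>2"
          by (rule power_mono) simp
        also have "\<dots> \<le> 2 * (cmod (p m \<theta> - indicator E \<theta>))\<^sup>2 + 2 * (cmod (p n \<theta> - indicator E \<theta>))\<^sup>2"
          by (rule square_sum_le)
        finally have "(cmod (p m \<theta> - p n \<theta>))\<^sup>2 * f \<theta>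
          \<le> (2 * (cmod (p m \<theta> - indicator E \<theta>))\<^sup>2 + 2 * (cmod (p n \<theta> - indicator E \<theta>))\<^sup>2) * f \<theta>"
          using f0 by (rule mult_right_mono)
        then show "(cmod (p m \<theta> - p n \<theta>))\<^sup>2 * f \<theta> \<le> 2 * ((cmod (p m \<theta> - indicator E \<theta>))\<^sup>2 * f \<theta>) +
            2 * ((cmod (p n \<theta> - indicator E \<theta>))\<^sup>2 * f \<theta>)"
          by (simp add: algebra_simps)
      qed (use i in auto)
      also have "\<dots> = 2 * (LINT \<theta>|Lc. (cmod (p m \<theta> - indicator E \<theta>))\<^sup>2 * f \<theta>) + 2 *
          (LINT \<theta>|Lc. (cmod (p n \<theta> - indicator E \<theta>))\<^sup>2 * f \<theta>)"
        using i by simp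
      also have "\<dots> < e\<^sup>2" using k[OF that(1)] k[OF that(2)] by linarith
      finally show ?thesis by (rule power2_less_imp_less) (use \<open>e > 0\<close> in simp)
    qed
    then show "\<exists>M. \<forall>m\<ge>M. \<forall>n\<ge>M. dist (v m) (v n) < e" by blast
  qed
  then obtain \<phi> where \<phi>: "v \<longlonglongrightarrow> \<phi>" using Cauchy_convergent convergent_def by blast
  have "(norm (\<psi> - \<phi>))\<^sup>2 = (LINT \<theta>|Lc. indicator {\<theta>. f \<theta> > M} \<theta> * f \<theta>)"
  proof -
    have one: "trig_op \<psi> (\<lambda>\<theta>. 1) \<psi>" using trig_op.monom[of \<psi> 1 0] by simp
    have "(\<lambda>n. (norm (\<psi> - v n))\<^sup>2) \<longlonglongrightarrow> (norm (\<psi> - \<phi>))\<^sup>2" by (intro tendsto_intros \<phi>)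
    moreover have "(\<lambda>n. (norm (\<psi> - v n))\<^sup>2) \<longlonglongrightarrow> (LINT \<theta>|Lc. (cmod (1 * (1 - indicator E \<theta>)))\<^sup>2 * f \<theta>)"
      using dct[of "\<lambda>_. 1" 1] trig_op_norm[OF f trig_op_diff[OF one v]] by simp
    ultimately have "(norm (\<psi> - \<phi>))\<^sup>2 = (LINT \<theta>|Lc. (cmod (1 * (1 - indicator E \<theta>)))\<^sup>2 * f \<theta>)"
      by (rule LIMSEQ_unique)
    also have "\<dots> = (LINT \<theta>|Lc. indicator {\<theta>. f \<theta> > M} \<theta> * f \<theta>)"
      by (rule Bochner_Integration.integral_cong) (auto simp: E_def indicator_def)
    finally show ?thesis .
  qed
  moreover have "kato_bound A (2 * pi * M) \<phi>"
    unfolding kato_bound_def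
  proof (intro allI impI)
    fix F :: "nat set" and c :: "nat \<Rightarrow> real" assume F: "finite F"
    define q where "q \<theta> = (\<Sum>r\<in>F. of_real (c r) * expi (int r) \<theta>)" for \<theta>
    have q: "continuous_on S q" for S unfolding q_def by (intro continuous_intros)
    have [measurable]: "q \<in> borel_measurable Lc" using q by (rule continuous_measurable_Lc)
    have "(\<lambda>n. (norm (\<Sum>r\<in>F. c r *\<^sub>R (A ^^ r) (v n)))\<^sup>2) \<longlonglongrightarrow> (norm (\<Sum>r\<in>F. c r *\<^sub>R (A ^^ r) \<phi>))\<^sup>2"
    proof (intro tendsto_intros)
      show "(\<lambda>n. (A ^^ r) (v n)) \<longlonglongrightarrow> (A ^^ r) \<phi>" for r
        by (rule bounded_linear.tendsto[OF bounded_linear_pow \<phi>])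
    qed
    moreover have "(norm (\<Sum>r\<in>F. c r *\<^sub>R (A ^^ r) (v n)))\<^sup>2 =
        (LINT \<theta>|Lc. (cmod (q \<theta> * p n \<theta>))\<^sup>2 * f \<theta>)" for n
      using trig_op_norm[OF f trig_op_sum[OF v F]] by (simp add: q_def)
    ultimately have "(norm (\<Sum>r\<in>F. c r *\<^sub>R (A ^^ r) \<phi>))\<^sup>2 =
        (LINT \<theta>|Lc. (cmod (q \<theta> * indicator E \<theta>))\<^sup>2 * f \<theta>)"
      using dct[OF q, of 0] by (simp add: LIMSEQ_unique)
    \<comment> \<open>Outside \<open>E\<close> the left integrand vanishes and on \<open>E\<close>
      the density is at most \<open>M\<close>. Parseval for \<open>q\<close> then produces the
      constant \<open>2 * pi * M\<close>.\<close>
    also have "\<dots> \<le> (LINT \<theta>|Lc. M * (cmod (q \<theta>))\<^sup>2)"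
    proof (rule integral_mono)
      obtain K where K: "\<And>\<theta>. \<theta> \<in> {0..2*pi} \<Longrightarrow> cmod (q \<theta>) \<le> K" using continuous_bounded_Lc[OF q]
          by blast
      show "integrable Lc (\<lambda>\<theta>. (cmod (q \<theta> * indicator E \<theta>))\<^sup>2 * f \<theta>)"
        by (rule int[where K = K]) (use K in \<open>auto simp: indicator_def intro:
            order_trans[OF norm_ge_zero]\<close>)
      show "integrable Lc (\<lambda>\<theta>. M * (cmod (q \<theta>))\<^sup>2)"
        unfolding integrable_Lc_iff by (intro absolutely_integrable_continuous_real
            continuous_intros q)
      show "(cmod (q \<theta> * indicator E \<theta>))\<^sup>2 * f \<theta> \<le> M * (cmod (q \<theta>))\<^sup>2" for \<theta>
        using M by (auto simp: indicator_def E_def mult.commute[of M] intro!: mult_left_mono)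
    qed
    also have "\<dots> = M * (2 * pi * (\<Sum>r\<in>F. (c r)\<^sup>2))"
      unfolding q_def using integral_trigpoly_square[OF F, of c] by simp
    finally show "(norm (\<Sum>r\<in>F. c r *\<^sub>R (A ^^ r) \<phi>))\<^sup>2 \<le> 2 * pi * M * (\<Sum>r\<in>F. (c r)\<^sup>2)"
        by (simp add: mult_ac)
  qed
  ultimately show thesis using that by blast
qed

text \<open>The squared error of the cut-off at height \<open>n\<close> is the mass of
  \<open>f\<close> on the set where it exceeds \<open>n\<close>, and this tends to zero by dominated
  convergence.\<close>

lemma ac_density_kato_approx:
  assumes f: "ac_density \<psi> f" and "\<epsilon> > 0"
  shows "\<exists>\<phi> M. kato_bound A M \<phi> \<and> norm (\<psi> - \<phi>) < \<epsilon>"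
proof -
  have f0: "f \<theta> \<ge> 0" and fint: "integrable Lc f" for \<theta> using f by (auto simp: ac_density_def)
  have [measurable]: "f \<in> borel_measurable Lc" using fint by (rule borel_measurable_integrable)
  have "(\<lambda>n. LINT \<theta>|Lc. indicator {\<theta>. f \<theta> > real n} \<theta> * f \<theta>) \<longlonglongrightarrow> (LINT \<theta>|Lc. 0)"
  proof (rule integral_dominated_convergence[where w = f])
    show "AE \<theta> in Lc. (\<lambda>n. indicator {\<theta>. f \<theta> > real n} \<theta> * f \<theta>) \<longlonglongrightarrow> 0"
    proof (rule AE_I2, rule tendsto_eventually)
      fix \<theta>
      obtain k where "f \<theta> \<le> real k" using real_arch_simple by blast
      then have "indicator {\<theta>. f \<theta> > real n} \<theta> * f \<theta> = 0" if "n \<ge> k" for n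
        using that by (auto simp: indicator_def)
      then show "\<forall>\<^sub>F n in sequentially. indicator {\<theta>. f \<theta> > real n} \<theta> * f \<theta> = 0"
        unfolding eventually_sequentially by blast
    qed
    show "AE \<theta> in Lc. norm (indicator {\<theta>. f \<theta> > real n} \<theta> * f \<theta>) \<le> f \<theta>" for n
      using f0 by (intro AE_I2) (auto simp: indicator_def)
    show "(\<lambda>\<theta>. indicator {\<theta>. f \<theta> > real n} \<theta> * f \<theta>) \<in> borel_measurable Lc" for n
    proof -
      have "(\<lambda>\<theta>. (if f \<theta> > real n then 1 else 0) * f \<theta>) \<in> borel_measurable Lc" by measurable
      then show ?thesis by (simp add: indicator_def)
    qed
  qed (use fint in auto)
  from order_tendstoD(2)[OF this, of "\<epsilon>\<^sup>2"] obtain n where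
    n: "(LINT \<theta>|Lc. indicator {\<theta>. f \<theta> > real n} \<theta> * f \<theta>) < \<epsilon>\<^sup>2"
    using \<open>\<epsilon> > 0\<close> unfolding eventually_sequentially by auto
  obtain \<phi> where \<phi>: "kato_bound A (2 * pi * real n) \<phi>"
    "(norm (\<psi> - \<phi>))\<^sup>2 = (LINT \<theta>|Lc. indicator {\<theta>. f \<theta> > real n} \<theta> * f \<theta>)"
    using ac_density_cutoff[OF f, of "real n"] by auto
  then have "norm (\<psi> - \<phi>) < \<epsilon>" using n \<open>\<epsilon> > 0\<close>
      by (intro power2_less_imp_less[of "norm (\<psi> - \<phi>)" \<epsilon>]) auto
  with \<phi>(1) show ?thesis by blast
qed

end

section \<open>Quantum walks as unitary operators\<close>

lemma cinner_adjm: "cinner (M *v v) w = cinner v (adjm M *v w)"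
proof -
  have "cinner (M *v v) w = (\<Sum>i\<in>UNIV. \<Sum>j\<in>UNIV. cnj (M$i$j) * cnj (v$j) * w$i)"
    by (simp add: cinner_def matrix_vector_mult_def sum_distrib_right)
  also have "\<dots> = (\<Sum>j\<in>UNIV. \<Sum>i\<in>UNIV. cnj (M$i$j) * cnj (v$j) * w$i)" by (rule sum.swap)
  also have "\<dots> = cinner v (adjm M *v w)"
    by (simp add: cinner_def matrix_vector_mult_def adjm_def sum_distrib_left mult_ac)
  finally show ?thesis .
qed

lemma norm_power2_cinner: "complex_of_real ((norm v)\<^sup>2) = cinner v v"
proof -
  have "Im (cinner v v) = 0" using arg_cong[OF cinner_simps(5)[of v v], of Im] by simp
  then show ?thesis by (simp add: complex_eq_iff Re_cinner power2_norm_eq_inner)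
qed

lemma unitary_mat_cinner:
  assumes "unitary_mat M"
  shows "cinner (M *v v) (M *v w) = cinner v w"
  using assms by (simp add: cinner_adjm unitary_mat_def matrix_vector_mul_assoc)

lemma unitary_mat_norm:
  assumes "unitary_mat M"
  shows "norm (M *v v) = norm v"
proof -
  have "complex_of_real ((norm (M *v v))\<^sup>2) = complex_of_real ((norm v)\<^sup>2)"
    unfolding norm_power2_cinner by (rule unitary_mat_cinner[OF assms])
  then have "(norm (M *v v))\<^sup>2 = (norm v)\<^sup>2" by (simp only: of_real_eq_iff)
  then show ?thesis by (simp add: power2_eq_iff_nonneg)
qed

lemma adjm_adjm [simp]: "adjm (adjm M) = M"
  by (simp add: adjm_def vec_eq_iff)

lemma unitary_mat_1: "unitary_mat (mat 1)"
proof -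
  have "adjm (mat 1) = (mat 1 :: complex^'n^'n)" by (simp add: adjm_def mat_def vec_eq_iff)
  then show ?thesis by (simp add: unitary_mat_def)
qed

lemma unitary_mat_adjm: "unitary_mat M \<Longrightarrow> unitary_mat (adjm M)"
  by (simp add: unitary_mat_def)

definition unshift :: "state \<Rightarrow> state" where
  "unshift \<Psi> x = (\<chi> i. if i = 1 then \<Psi> (x-1) $ 1 else \<Psi> (x+1) $ 2)"

text \<open>The \<open>inv (walk C)\<close> of the claim is an inverse on all functions. This is its
  explicit form, from which preservation of \<open>l2\<close> can be read off.\<close>

definition walk_inv :: "(int \<Rightarrow> complex^2^2) \<Rightarrow> state \<Rightarrow> state" where
  "walk_inv C \<Psi> x = adjm (C x) *v unshift \<Psi> x"

lemma shift_nth [simp]: "shift \<Psi> x $ 1 = \<Psi> (x+1) $ 1" "shift \<Psi> x $ 2 = \<Psi> (x-1) $ 2"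
  and unshift_nth [simp]: "unshift \<Psi> x $ 1 = \<Psi> (x-1) $ 1" "unshift \<Psi> x $ 2 = \<Psi> (x+1) $ 2"
  by (simp_all add: shift_def unshift_def)

lemma shift_unshift [simp]: "shift (unshift \<Psi>) = \<Psi>" "unshift (shift \<Psi>) = \<Psi>"
  by (simp_all add: fun_eq_iff vec_eq_iff forall_2)

lemma walk_walk_inv:
  assumes "\<And>x. unitary_mat (C x)"
  shows "walk C (walk_inv C \<Psi>) = \<Psi>" "walk_inv C (walk C \<Psi>) = \<Psi>"
proof -
  have 1: "coin C (walk_inv C \<Psi>) = unshift \<Psi>"
    using assms by (simp add: fun_eq_iff coin_def walk_inv_def unitary_mat_def
        matrix_vector_mul_assoc)
  show "walk C (walk_inv C \<Psi>) = \<Psi>" unfolding walk_def 1 by simp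
  show "walk_inv C (walk C \<Psi>) = \<Psi>"
    using assms by (simp add: fun_eq_iff coin_def walk_inv_def walk_def unitary_mat_def
        matrix_vector_mul_assoc)
qed

lemma bij_walk:
  assumes "\<And>x. unitary_mat (C x)"
  shows "bij (walk C)" "inv (walk C) = walk_inv C"
proof -
  show "bij (walk C)"
    by (rule o_bij[of "walk_inv C"]) (simp_all add: fun_eq_iff walk_walk_inv[OF assms])
  show "inv (walk C) = walk_inv C"
    by (rule inv_unique_comp) (simp_all add: fun_eq_iff walk_walk_inv[OF assms])
qed

lemma l2_component_translate:
  assumes "l2 \<Psi>"
  shows "(\<lambda>x. (cmod (\<Psi> (x + k) $ i))\<^sup>2) summable_on UNIV"
    "(\<Sum>\<^sub>\<infinity>x. (cmod (\<Psi> (x + k) $ i))\<^sup>2) = (\<Sum>\<^sub>\<infinity>x. (cmod (\<Psi> x $ i))\<^sup>2)"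
proof -
  have s: "(\<lambda>x. (cmod (\<Psi> x $ i))\<^sup>2) summable_on UNIV"
    by (rule summable_on_comparison_test[OF assms[unfolded l2_def]])
       (auto intro!: power_mono Finite_Cartesian_Product.norm_nth_le)
  have b: "bij_betw (\<lambda>x::int. x + k) UNIV UNIV"
    by (rule bij_betw_byWitness[where f' = "\<lambda>x. x - k"]) auto
  show "(\<lambda>x. (cmod (\<Psi> (x + k) $ i))\<^sup>2) summable_on UNIV"
    using summable_on_reindex_bij_betw[OF b, of "\<lambda>x. (cmod (\<Psi> x $ i))\<^sup>2"] s by simp
  show "(\<Sum>\<^sub>\<infinity>x. (cmod (\<Psi> (x + k) $ i))\<^sup>2) = (\<Sum>\<^sub>\<infinity>x. (cmod (\<Psi> x $ i))\<^sup>2)"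
    using infsum_reindex_bij_betw[OF b, of "\<lambda>x. (cmod (\<Psi> x $ i))\<^sup>2"] by simp
qed

lemma shift_norm_sum:
  assumes "l2 \<Psi>"
  shows "l2 (shift \<Psi>)" "(\<Sum>\<^sub>\<infinity>x. (norm (shift \<Psi> x))\<^sup>2) = (\<Sum>\<^sub>\<infinity>x. (norm (\<Psi> x))\<^sup>2)"
proof -
  note s = l2_component_translate(1)[OF assms] and t = l2_component_translate(2)[OF assms]
  have n: "(norm (shift \<Psi> x))\<^sup>2 = (cmod (\<Psi> (x + 1) $ 1))\<^sup>2 + (cmod (\<Psi> (x + (-1)) $ 2))\<^sup>2" for x
    by (simp add: cvec_power2_norm)
  show "l2 (shift \<Psi>)" unfolding l2_def n by (intro summable_on_add s)
  have s0: "(\<lambda>x. (cmod (\<Psi> x $ i))\<^sup>2) summable_on UNIV" for i using s[of 0 i] by simp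
  show "(\<Sum>\<^sub>\<infinity>x. (norm (shift \<Psi> x))\<^sup>2) = (\<Sum>\<^sub>\<infinity>x. (norm (\<Psi> x))\<^sup>2)"
    unfolding n cvec_power2_norm[of "\<Psi> _"] by (simp only: infsum_add[OF s s] infsum_add[OF s0 s0] t)
qed

lemma l2_unshift:
  assumes "l2 \<Psi>"
  shows "l2 (unshift \<Psi>)"
proof -
  have n: "(norm (unshift \<Psi> x))\<^sup>2 = (cmod (\<Psi> (x + (-1)) $ 1))\<^sup>2 + (cmod (\<Psi> (x + 1) $ 2))\<^sup>2" for x
    by (simp add: cvec_power2_norm)
  show ?thesis unfolding l2_def n by (intro summable_on_add l2_component_translate(1) assms)
qed

lemma l2_coin: "(\<And>x. unitary_mat (C x)) \<Longrightarrow> l2 (coin C \<Psi>) \<longleftrightarrow> l2 \<Psi>"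
  by (simp add: l2_def coin_def unitary_mat_norm)

lemma l2_walk: "(\<And>x. unitary_mat (C x)) \<Longrightarrow> l2 \<Psi> \<Longrightarrow> l2 (walk C \<Psi>)"
  unfolding walk_def by (simp add: shift_norm_sum l2_coin)

lemma l2_walk_inv: "(\<And>x. unitary_mat (C x)) \<Longrightarrow> l2 \<Psi> \<Longrightarrow> l2 (walk_inv C \<Psi>)"
  unfolding walk_inv_def using l2_unshift[of \<Psi>]
      by (simp add: l2_def unitary_mat_norm unitary_mat_adjm)

definition walkh :: "(int \<Rightarrow> complex^2^2) \<Rightarrow> hil \<Rightarrow> hil" where
  "walkh C h = hil (walk C (st h))"

lemma matrix_vector_smult: "M *v (c *s v) = c *s (M *v v)" for M :: "complex^'n^'m"
  by (simp add: matrix_vector_mult_def vec_eq_iff sum_distrib_left mult_ac)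

lemma matrix_vector_scaleR: "M *v (r *\<^sub>R v) = r *\<^sub>R (M *v v)" for M :: "complex^'n^'m"
  using matrix_vector_smult[of M "complex_of_real r" v] by (simp add: vec_smult_distribs)

lemma walk_add: "walk C (\<lambda>x. \<Phi> x + \<Psi> x) = (\<lambda>x. walk C \<Phi> x + walk C \<Psi> x)"
  and walk_smult: "walk C (\<lambda>x. c *s \<Psi> x) = (\<lambda>x. c *s walk C \<Psi> x)"
  and walk_scaleR: "walk C (\<lambda>x. r *\<^sub>R \<Psi> x) = (\<lambda>x. r *\<^sub>R walk C \<Psi> x)"
  by (simp_all add: fun_eq_iff vec_eq_iff forall_2 walk_def coin_def matrix_vector_right_distrib
      matrix_vector_smult matrix_vector_scaleR)

locale unitary_coin =
  fixes C :: "int \<Rightarrow> complex^2^2"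
  assumes C: "unitary_mat (C x)"
begin

lemma st_walkh [simp]: "st (walkh C h) = walk C (st h)"
  unfolding walkh_def by (simp add: l2_walk C)

lemma cunitary_walkh: "cunitary (walkh C)"
proof (intro cunitary.intro cunitary_axioms.intro unitary_op.intro)
  show "linear (walkh C)"
    by (rule linearI) (simp_all add: st_inject[symmetric] st_simps walk_add walk_scaleR)
  show "norm (walkh C h) = norm h" for h
  proof -
    have "l2 (coin C (st h))" by (simp add: l2_coin C)
    then have "(norm (walkh C h))\<^sup>2 = (norm h)\<^sup>2"
      unfolding norm_hil_sq st_walkh walk_def
          by (simp add: shift_norm_sum(2)) (simp add: coin_def unitary_mat_norm C)
    then show ?thesis by (simp add: power2_eq_iff_nonneg)
  qed
  show "surj (walkh C)"
  proof (rule surjI)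
    show "walkh C (hil (walk_inv C (st h))) = h" for h
      by (simp add: st_inject[symmetric] l2_walk_inv C walk_walk_inv)
  qed
  show "walkh C (cscale c h) = cscale c (walkh C h)" for c h
    by (simp add: st_inject[symmetric] walk_smult)
qed

sublocale cunitary "walkh C" by (rule cunitary_walkh)

lemma st_inv_walkh [simp]: "st (inv (walkh C) h) = inv (walk C) (st h)"
proof -
  have "walk C (st (inv (walkh C) h)) = st h"
    using surj by (simp add: surj_f_inv_f flip: st_walkh)
  then show ?thesis using bij_walk(1)[of C] C by (metis bij_inv_eq_iff)
qed

lemma st_walkh_pow: "st ((walkh C ^^ n) h) = (walk C ^^ n) (st h)"
  by (induction n) simp_all

lemma st_inv_walkh_pow: "st ((inv (walkh C) ^^ n) h) = (inv (walk C) ^^ n) (st h)"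
  by (induction n) simp_all

lemma st_zpow_walkh: "st (zpow (walkh C) n h) = upow (walk C) n (st h)"
  by (simp add: zpow_def upow_def st_walkh_pow st_inv_walkh_pow)

text \<open>For nonnegative \<open>f\<close> gauge and Lebesgue integrability on the circle agree,
  which brings \<open>Hac\<close> into measure-theoretic form.\<close>

lemma ac_density_iff_Hac: "st \<psi> \<in> Hac (walk C) \<longleftrightarrow> (\<exists>f. ac_density \<psi> f)"
proof -
  have "integral {0..2*pi} (\<lambda>\<theta>. exp (\<i> * of_int n * of_real \<theta>) * complex_of_real (f \<theta>))
      = (LINT \<theta>|Lc. expi n \<theta> * of_real (f \<theta>))" if "integrable Lc f" for f n
    using integral_Lc[OF integrable_continuous_mult[OF that continuous_on_expi]]
        by (simp add: expi_def)
  moreover have "integrable Lc f \<longleftrightarrow> f integrable_on {0..2*pi}" if "\<forall>\<theta>. f \<theta> \<ge> 0"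
      for f :: "real \<Rightarrow> real"
    using that integrable_Lc_nonneg integrable_on_lebesgue_on[of "{0..2*pi}" f] by auto
  ultimately show ?thesis
    unfolding Hac_def ac_density_def by (auto simp: cip_def st_zpow_walkh)
qed

end

section \<open>The perturbation is of trace class\<close>

definition site :: "int \<Rightarrow> complex^2 \<Rightarrow> hil" where
  "site x v = hil (\<lambda>y. if y = x then v else 0)"

lemma st_site: "st (site x v) = (\<lambda>y. if y = x then v else 0)"
  unfolding site_def
proof (rule st_hil)
  have "(\<lambda>y. (norm (if y = x then v else 0))\<^sup>2) summable_on {x}" by simp
  then show "l2 (\<lambda>y. if y = x then v else 0)"
    unfolding l2_def by (rule summable_on_cong_neutral[THEN iffD1, rotated -1]) auto
qed

lemma inner_site: "inner h (site x v) = inner (st h x) v"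
proof -
  have "(\<Sum>\<^sub>\<infinity>y. inner (st h y) (if y = x then v else 0)) = (\<Sum>\<^sub>\<infinity>y\<in>{x}. inner (st h y) v)"
    by (rule infsum_cong_neutral) auto
  then show ?thesis by (simp add: inner_hil_def st_site)
qed

lemma norm_site: "norm (site x v) = norm v"
  unfolding norm_eq_sqrt_inner inner_site by (simp add: st_site)

lemma powr_summable_int:
  assumes "s < -1"
  shows "(\<lambda>x::int. \<bar>real_of_int x\<bar> powr s) summable_on UNIV"
proof -
  have nat: "(\<lambda>n::nat. real n powr s) summable_on UNIV"
    by (rule norm_summable_imp_summable_on) (use assms in \<open>simp add: summable_real_powr_iff\<close>)
  have "(\<lambda>x::int. \<bar>real_of_int x\<bar> powr s) summable_on (int ` UNIV)"
    using nat by (subst summable_on_reindex) (auto simp: o_def)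
  moreover have "(\<lambda>x::int. \<bar>real_of_int x\<bar> powr s) summable_on ((\<lambda>n. - int n) ` UNIV)"
    using nat by (subst summable_on_reindex) (auto simp: o_def inj_on_def)
  ultimately have "(\<lambda>x::int. \<bar>real_of_int x\<bar> powr s) summable_on
      (int ` UNIV \<union> (\<lambda>n. - int n) ` UNIV)"
    by (rule summable_on_union)
  moreover have "int ` UNIV \<union> (\<lambda>n. - int n) ` UNIV = UNIV"
    by (auto simp: image_iff) (metis int_cases2)
  ultimately show ?thesis by simp
qed

lemma coin_difference_summable:
  assumes "c1 > 0" "\<epsilon> > 0"
    and "\<And>x. x \<noteq> 0 \<Longrightarrow> d x \<le> c1 * \<bar>real_of_int x\<bar> powr (-1 - \<epsilon>)" and "\<And>x. d x \<ge> 0"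
  shows "d summable_on UNIV"
proof -
  have "d summable_on UNIV - {0}"
    by (rule summable_on_comparison_test[OF summable_on_subset[OF
        summable_on_cmult_right[OF powr_summable_int[of "-1 - \<epsilon>"], of c1]]])
       (use assms in auto)
  then show ?thesis using summable_on_insert_iff[of d 0 "UNIV - {0}"] by (simp add: insert_UNIV)
qed

text \<open>The difference of the walks is the shift applied to a block-diagonal operator with
  blocks \<open>D x - C x\<close>. Each block is dominated by rank-one terms in a real basis,
  weighted with its operator norm, so summable block norms give the trace bound.\<close>

lemma trace_class_pair_walkh:
  assumes C: "\<And>x. unitary_mat (C x)" and D: "\<And>x. unitary_mat (D x)"
    and d: "(\<lambda>x. onorm (\<lambda>v. (D x - C x) *v v)) summable_on UNIV"
  obtains s e f where "trace_class_pair (walkh C) (walkh D) s e f"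
proof -
  interpret C: unitary_coin C by unfold_locales (rule C)
  interpret D: unitary_coin D by unfold_locales (rule D)
  interpret S: unitary_coin "\<lambda>_. mat 1" by unfold_locales (rule unitary_mat_1)
  define \<delta> where "\<delta> x = onorm (\<lambda>v. (D x - C x) *v v)" for x
  \<comment> \<open>The bare shift, written as a walk with trivial coin so that its unitarity is
    inherited.\<close>
  define Sh where "Sh = walkh (\<lambda>_. mat 1)"
  \<comment> \<open>One index per site and pair of real basis vectors; the weight of an index
    depends on the site only.\<close>
  define I where "I = (UNIV :: int set) \<times> ((Basis :: (complex^2) set) \<times> (Basis :: (complex^2) set))"
  have bl: "bounded_linear (\<lambda>v. M *v v)" for M :: "complex^2^2"
    by (rule matrix_vector_mul_bounded_linear)
  have \<delta>: "norm ((D x - C x) *v v) \<le> \<delta> x * norm v" for x v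
    unfolding \<delta>_def by (rule onorm[OF bl])
  have \<delta>0: "\<delta> x \<ge> 0" for x unfolding \<delta>_def by (rule onorm_pos_le[OF bl])
  have "countable I" "infinite I"
    unfolding I_def by (auto simp: countable_SIGMA countable_finite finite_cartesian_product_iff)
  then obtain \<phi> :: "nat \<Rightarrow> _" where \<phi>: "bij_betw \<phi> UNIV I"
    using bij_betw_from_nat_into by blast
  define s where "s n = \<delta> (fst (\<phi> n))" for n
  define e where "e n = Sh (site (fst (\<phi> n)) (fst (snd (\<phi> n))))" for n
  define f where "f n = site (fst (\<phi> n)) (snd (snd (\<phi> n)))" for n
  have \<phi>I: "fst (snd (\<phi> n)) \<in> Basis" "snd (snd (\<phi> n)) \<in> Basis" for n
    using bij_betwE[OF \<phi>, rule_format, of n] by (auto simp: I_def mem_Times_iff)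
  have sumI: "(\<lambda>z. \<delta> (fst z)) summable_on I"
    unfolding I_def
  proof (rule summable_on_SigmaI)
    let ?BB = "(Basis :: (complex^2) set) \<times> (Basis :: (complex^2) set)"
    show "((\<lambda>y. \<delta> (fst (x, y))) has_sum (of_nat (card ?BB) * \<delta> x)) ?BB" for x
      by (rule has_sum_finiteI) auto
    show "(\<lambda>x. of_nat (card ?BB) * \<delta> x) summable_on UNIV"
      by (rule summable_on_cmult_right) (use d in \<open>simp add: \<delta>_def\<close>)
  qed (use \<delta>0 in auto)
  have "s summable_on UNIV"
    using summable_on_reindex_bij_betw[OF \<phi>, of "\<lambda>z. \<delta> (fst z)"] sumI by (simp add: s_def[abs_def])
  then have s: "summable s" by (rule summable_on_imp_summable)
  have "trace_class_pair (walkh C) (walkh D) s e f"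
  proof (intro trace_class_pair.intro trace_class_pair_axioms.intro)
    show "unitary_op (walkh C)" "unitary_op (walkh D)" by unfold_locales
    show "s n \<ge> 0" for n by (simp add: s_def \<delta>0)
    show "summable s" by (rule s)
    show "norm (e n) \<le> 1" "norm (f n) \<le> 1" for n
      using \<phi>I by (simp_all add: e_def f_def Sh_def S.iso norm_site)
    fix h g
    define h' where "h' = inv Sh h"
    define k where "k x = (D x - C x) *v st g x" for x
    have l2k: "l2 k"
      unfolding k_def matrix_vector_mult_diff_rdistrib
      using l2_coin[of D "st g"] l2_coin[of C "st g"] C D
          by (intro l2_diff) (simp_all add: coin_def[abs_def])
    have "walkh D g - walkh C g = Sh (hil k)"
      by (simp add: st_inject[symmetric] st_simps Sh_def l2k)
         (simp add: fun_eq_iff vec_eq_iff forall_2 walk_def coin_def k_def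
             matrix_vector_mult_diff_rdistrib)
    moreover have "inner h (Sh (hil k)) = inner h' (hil k)"
      using S.inner_inv_pow[of 1 h "hil k"] by (simp add: h'_def Sh_def)
    ultimately have eq: "inner h (walkh D g - walkh C g) = (\<Sum>\<^sub>\<infinity>x. inner (st h' x) (k x))"
      by (simp add: inner_hil_def l2k)
    define G where "G x z = \<delta> x * (\<bar>inner (st h' x) (fst z)\<bar> * \<bar>inner (st g x) (snd z)\<bar>)" for x
        and z :: "(complex^2) \<times> (complex^2)"
    have G0: "G x z \<ge> 0" for x z by (simp add: G_def \<delta>0)
    have GI: "(\<lambda>(x, z). G x z) summable_on I"
    proof (rule summable_on_comparison_test)
      show "(\<lambda>z. norm h' * norm g * \<delta> (fst z)) summable_on I"
          by (rule summable_on_cmult_right[OF sumI])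
      fix p assume "p \<in> I"
      then obtain x b b' where p: "p = (x, b, b')" "b \<in> Basis" "b' \<in> Basis" by (auto simp: I_def)
      have "\<bar>inner (st h' x) b\<bar> \<le> norm h'" "\<bar>inner (st g x) b'\<bar> \<le> norm g"
        using Basis_le_norm[OF p(2), of "st h' x"] Basis_le_norm[OF p(3), of "st g x"]
            norm_st_le[of h' x] norm_st_le[of g x]
        by linarith+
      then have "\<bar>inner (st h' x) b\<bar> * \<bar>inner (st g x) b'\<bar> \<le> norm h' * norm g"
          by (intro mult_mono) auto
      then show "(\<lambda>(x, z). G x z) p \<le> norm h' * norm g * \<delta> (fst p)"
        using \<delta>0[of x] by (simp add: p(1) G_def mult.commute[of _ "\<delta> x"] mult_left_mono)
    qed (use G0 in auto)
    have GS: "(\<lambda>x. \<Sum>z\<in>Basis \<times> Basis. G x z) summable_on UNIV"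
      using summable_on_Sigma_banach[OF GI[unfolded I_def]] by simp
    have termwise: "\<bar>inner (st h' x) (k x)\<bar> \<le> (\<Sum>z\<in>Basis \<times> Basis. G x z)" for x
    proof -
      have "\<bar>inner (st h' x) (k x)\<bar> \<le> norm (st h' x) * (\<delta> x * norm (st g x))"
        using Cauchy_Schwarz_ineq2[of "st h' x" "k x"]
            mult_left_mono[OF \<delta>[of x "st g x"], of "norm (st h' x)"]
        by (simp add: k_def)
      \<comment> \<open>Euclidean norms are at most sums of absolute coordinates; multiplying out
        produces the rank-one terms.\<close>
      also have "\<dots> \<le> (\<Sum>b\<in>Basis. \<bar>inner (st h' x) b\<bar>) * (\<delta> x * (\<Sum>b\<in>Basis. \<bar>inner (st g x) b\<bar>))"
        by (intro mult_mono norm_le_l1 \<delta>0 mult_nonneg_nonneg sum_nonneg) auto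
      also have "\<dots> = (\<Sum>z\<in>Basis \<times> Basis. G x z)"
        unfolding sum.cartesian_product' G_def fst_conv snd_conv
        by (subst sum_distrib_right, simp only: sum_distrib_left mult_ac)
      finally show ?thesis .
    qed
    have "\<bar>\<Sum>\<^sub>\<infinity>x. inner (st h' x) (k x)\<bar> \<le> (\<Sum>\<^sub>\<infinity>x. \<bar>inner (st h' x) (k x)\<bar>)"
    proof -
      have "(\<lambda>x. norm (inner (st h' x) (k x))) summable_on UNIV"
        by (rule summable_on_comparison_test[OF GS]) (use termwise in auto)
      from norm_infsum_bound[OF this] show ?thesis by simp
    qed
    also have "\<dots> \<le> (\<Sum>\<^sub>\<infinity>x. \<Sum>z\<in>Basis \<times> Basis. G x z)"
      by (rule infsum_mono[OF summable_on_comparison_test[OF GS] GS]) (use termwise in auto)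
    also have "\<dots> = (\<Sum>\<^sub>\<infinity>x. \<Sum>\<^sub>\<infinity>z\<in>Basis \<times> Basis. G x z)" by simp
    also have "\<dots> = (\<Sum>\<^sub>\<infinity>(x, z)\<in>I. G x z)"
      unfolding I_def by (rule infsum_Sigma'_banach) (use GI in \<open>simp add: I_def\<close>)
    also have "\<dots> = (\<Sum>\<^sub>\<infinity>n. (\<lambda>(x, z). G x z) (\<phi> n))"
      by (rule infsum_reindex_bij_betw[OF \<phi>, symmetric])
    also have "\<dots> = (\<Sum>n. (\<lambda>(x, z). G x z) (\<phi> n))"
    proof -
      have "(\<lambda>n. (\<lambda>(x, z). G x z) (\<phi> n)) summable_on UNIV"
        using summable_on_reindex_bij_betw[OF \<phi>] GI by blast
      from has_sum_imp_sums[OF has_sum_infsum[OF this]] show ?thesis by (simp add: sums_iff)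
    qed
    also have "(\<lambda>n. (\<lambda>(x, z). G x z) (\<phi> n)) = (\<lambda>n. s n * (\<bar>inner h (e n)\<bar> * \<bar>inner g (f n)\<bar>))"
    proof
      fix n
      have "inner (st h' x) b = inner h (Sh (site x b))" for x b
        using S.inner_inv_pow[of 1 h "site x b"] by (simp add: h'_def Sh_def inner_site)
      then show "(\<lambda>(x, z). G x z) (\<phi> n) = s n * (\<bar>inner h (e n)\<bar> * \<bar>inner g (f n)\<bar>)"
        by (simp add: case_prod_beta G_def s_def e_def f_def inner_site)
    qed
    finally show "\<bar>inner h (walkh D g - walkh C g)\<bar> \<le>
        (\<Sum>n. s n * (\<bar>inner h (e n)\<bar> * \<bar>inner g (f n)\<bar>))"
      unfolding eq .
  qed
  then show thesis by (rule that)
qed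

section \<open>Square-integrable functions on the circle\<close>

lemma bilinear_cvec_smult: "bilinear ((*s) :: complex \<Rightarrow> complex^'n \<Rightarrow> complex^'n)"
  unfolding bilinear_def by (auto intro!: linearI simp: vec_eq_iff algebra_simps)

lemma bilinear_cmat_vec: "bilinear ((*v) :: complex^'n^'m \<Rightarrow> complex^'n \<Rightarrow> complex^'m)"
  unfolding bilinear_def
  by (auto intro!: linearI simp: matrix_vector_mult_def vec_eq_iff algebra_simps sum.distrib
      scaleR_sum_right)

lemma bilinear_cinner: "bilinear (cinner :: complex^'n \<Rightarrow> complex^'n \<Rightarrow> complex)"
  unfolding bilinear_def
  by (auto intro!: linearI simp: cinner_simps) (simp_all add: cinner_def scaleR_sum_right)

interpretation smult: bounded_bilinear "(*s) :: complex \<Rightarrow> complex^'n \<Rightarrow> complex^'n"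
  by (rule bilinear_conv_bounded_bilinear[THEN iffD1, OF bilinear_cvec_smult])
interpretation matvec: bounded_bilinear "(*v) :: complex^'n^'m \<Rightarrow> complex^'n \<Rightarrow> complex^'m"
  by (rule bilinear_conv_bounded_bilinear[THEN iffD1, OF bilinear_cmat_vec])
interpretation cinner: bounded_bilinear "cinner :: complex^'n \<Rightarrow> complex^'n \<Rightarrow> complex"
  by (rule bilinear_conv_bounded_bilinear[THEN iffD1, OF bilinear_cinner])

lemma smult_measurable [measurable (raw)]:
  fixes f :: "'a \<Rightarrow> complex" and g :: "'a \<Rightarrow> complex^'n"
  shows "f \<in> borel_measurable M \<Longrightarrow> g \<in> borel_measurable M \<Longrightarrow> (\<lambda>x. f x *s g x) \<in> borel_measurable M"
  by (rule borel_measurable_continuous_Pair) (auto intro!: smult.continuous_on continuous_intros)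

lemma matvec_measurable [measurable (raw)]:
  fixes f :: "'a \<Rightarrow> complex^'n^'m" and g :: "'a \<Rightarrow> complex^'n"
  shows "f \<in> borel_measurable M \<Longrightarrow> g \<in> borel_measurable M \<Longrightarrow> (\<lambda>x. f x *v g x) \<in> borel_measurable M"
  by (rule borel_measurable_continuous_Pair) (auto intro!: matvec.continuous_on continuous_intros)

lemma cinner_measurable [measurable (raw)]:
  fixes f g :: "'a \<Rightarrow> complex^'n"
  shows "f \<in> borel_measurable M \<Longrightarrow> g \<in> borel_measurable M \<Longrightarrow> (\<lambda>x. cinner (f x) (g x)) \<in>
      borel_measurable M"
  by (rule borel_measurable_continuous_Pair) (auto intro!: cinner.continuous_on continuous_intros)

definition sq_int :: "(real \<Rightarrow> complex^2) \<Rightarrow> bool" where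
  "sq_int f \<longleftrightarrow> f \<in> borel_measurable Lc \<and> integrable Lc (\<lambda>k. (norm (f k))\<^sup>2)"

definition dist2 :: "(real \<Rightarrow> complex^2) \<Rightarrow> (real \<Rightarrow> complex^2) \<Rightarrow> real" where
  "dist2 f g = (LINT k|Lc. (norm (f k - g k))\<^sup>2)"

lemma integrable_Lc_const: "integrable Lc (\<lambda>_. c :: real)"
  by (rule integrable_Lc_bounded[of _ "\<bar>c\<bar>"]) auto

lemma integral_Lc_const: "(LINT k|Lc. c) = 2 * pi * (c :: real)"
proof -
  have "integral {0..2*pi} (\<lambda>_. c) = 2 * pi * c" by simp
  then show ?thesis using integral_Lc[OF integrable_Lc_const[of c]] by (simp only:)
qed

lemma measure_Lc [simp]: "measure Lc {0..2*pi} = 2 * pi"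
  using integral_Lc_const[of 1] by simp

lemma sq_int_measurable: "sq_int f \<Longrightarrow> f \<in> borel_measurable Lc"
  by (simp add: sq_int_def)

lemma norm_square_add_le: "(norm (a + b))\<^sup>2 \<le> 2 * (norm a)\<^sup>2 + 2 * (norm b)\<^sup>2"
    for a b :: "'a::real_normed_vector"
  using order_trans[OF power_mono[OF norm_triangle_ineq[of a b], of 2]
      square_sum_le[of "norm a" "norm b"]] by simp

lemma sq_int_add:
  assumes "sq_int f" "sq_int g"
  shows "sq_int (\<lambda>k. f k + g k)"
  unfolding sq_int_def
proof
  have [measurable]: "f \<in> borel_measurable Lc" "g \<in> borel_measurable Lc"
    using assms by (auto simp: sq_int_def)
  show "(\<lambda>k. f k + g k) \<in> borel_measurable Lc" by measurable
  show "integrable Lc (\<lambda>k. (norm (f k + g k))\<^sup>2)"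
  proof (rule Bochner_Integration.integrable_bound[where f =
      "\<lambda>k. 2 * (norm (f k))\<^sup>2 + 2 * (norm (g k))\<^sup>2"])
    show "integrable Lc (\<lambda>k. 2 * (norm (f k))\<^sup>2 + 2 * (norm (g k))\<^sup>2)"
      using assms by (auto simp: sq_int_def)
    show "AE k in Lc. norm ((norm (f k + g k))\<^sup>2) \<le> norm (2 * (norm (f k))\<^sup>2 + 2 * (norm (g k))\<^sup>2)"
      using norm_square_add_le by (intro AE_I2) auto
  qed measurable
qed

lemma sq_int_uminus: "sq_int f \<Longrightarrow> sq_int (\<lambda>k. - f k)"
  by (auto simp: sq_int_def)

lemma sq_int_diff: "sq_int f \<Longrightarrow> sq_int g \<Longrightarrow> sq_int (\<lambda>k. f k - g k)"
  using sq_int_add[of f "\<lambda>k. - g k"] sq_int_uminus[of g] by simp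

lemma sq_int_norm_le:
  assumes "f \<in> borel_measurable Lc" "sq_int g" "\<And>k. k \<in> {0..2*pi} \<Longrightarrow> norm (f k) \<le> norm (g k)"
  shows "sq_int f"
  unfolding sq_int_def
proof
  show "integrable Lc (\<lambda>k. (norm (f k))\<^sup>2)"
    by (rule Bochner_Integration.integrable_bound[where f = "\<lambda>k. (norm (g k))\<^sup>2"])
       (use assms in \<open>auto simp: sq_int_def intro!: AE_I2 power_mono\<close>)
qed (rule assms)

lemma sq_int_bounded:
  assumes "f \<in> borel_measurable Lc" "\<And>k. k \<in> {0..2*pi} \<Longrightarrow> norm (f k) \<le> K"
  shows "sq_int f"
  unfolding sq_int_def
proof
  show "integrable Lc (\<lambda>k. (norm (f k))\<^sup>2)"
  proof (rule integrable_Lc_bounded[where K = "K\<^sup>2"])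
    show "(\<lambda>k. (norm (f k))\<^sup>2) \<in> borel_measurable Lc" using assms(1) by measurable
  qed (use assms in \<open>auto intro!: power_mono\<close>)
qed (rule assms)

lemma sq_int_integrable:
  assumes "sq_int f"
  shows "integrable Lc f"
proof (rule Bochner_Integration.integrable_bound[where f = "\<lambda>k. 1 + (norm (f k))\<^sup>2"])
  show "integrable Lc (\<lambda>k. 1 + (norm (f k))\<^sup>2)"
    using assms integrable_Lc_const by (auto simp: sq_int_def)
  show "AE k in Lc. norm (f k) \<le> norm (1 + (norm (f k))\<^sup>2)"
  proof (rule AE_I2)
    fix k
    show "norm (f k) \<le> norm (1 + (norm (f k))\<^sup>2)"
      using sum_squares_bound[of "norm (f k)" 1] norm_ge_zero[of "f k"] by (simp del: norm_ge_zero)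
  qed
qed (use assms in \<open>auto simp: sq_int_def\<close>)

lemma sq_int_cinner:
  assumes "sq_int f" "sq_int g"
  shows "integrable Lc (\<lambda>k. cinner (f k) (g k))" "integrable Lc (\<lambda>k. norm (f k) * norm (g k))"
proof -
  have [measurable]: "f \<in> borel_measurable Lc" "g \<in> borel_measurable Lc"
    using assms by (auto simp: sq_int_def)
  have i: "integrable Lc (\<lambda>k. (norm (f k))\<^sup>2 + (norm (g k))\<^sup>2)"
    using assms by (auto simp: sq_int_def)
  have b: "norm (f k) * norm (g k) \<le> (norm (f k))\<^sup>2 + (norm (g k))\<^sup>2" for k
    using sum_squares_bound[of "norm (f k)" "norm (g k)"]
        mult_nonneg_nonneg[of "norm (f k)" "norm (g k)"]
    by (simp del: mult_nonneg_nonneg)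
  show "integrable Lc (\<lambda>k. norm (f k) * norm (g k))"
    by (rule Bochner_Integration.integrable_bound[OF i]) (use b in \<open>auto intro!: AE_I2\<close>)
  show "integrable Lc (\<lambda>k. cinner (f k) (g k))"
  proof (rule Bochner_Integration.integrable_bound[OF i])
    show "AE k in Lc. cmod (cinner (f k) (g k)) \<le> norm ((norm (f k))\<^sup>2 + (norm (g k))\<^sup>2)"
      using order_trans[OF norm_cinner_le b] by (intro AE_I2) auto
  qed measurable
qed

lemma dist2_nonneg: "dist2 f g \<ge> 0"
  by (simp add: dist2_def)

lemma dist2_commute: "dist2 f g = dist2 g f"
  by (simp add: dist2_def norm_minus_commute)

text \<open>A fast subsequence has increments with summable L1 norms and hence converges almost
  everywhere; Fatou then controls the L2 distance to the limit. This provides the function that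
  \<open>fourier\<close> chooses.\<close>

lemma riesz_fischer:
  assumes f: "\<And>n. sq_int (f n)"
    and cauchy: "\<And>e. e > 0 \<Longrightarrow> \<exists>N. \<forall>m\<ge>N. \<forall>n\<ge>N. dist2 (f m) (f n) < e"
  obtains g where "sq_int g" "(\<lambda>n. dist2 (f n) g) \<longlonglongrightarrow> 0"
proof -
  have [measurable]: "f n \<in> borel_measurable Lc" for n using f by (simp add: sq_int_def)
  have "\<exists>N. \<forall>m\<ge>N. \<forall>n\<ge>N. dist2 (f m) (f n) < (1/4)^k" for k by (rule cauchy) simp
  then obtain r where r: "\<And>k m n. m \<ge> r k \<Longrightarrow> n \<ge> r k \<Longrightarrow> dist2 (f m) (f n) < (1/4)^k" by metis
  \<comment> \<open>Partial sums of \<open>r\<close> increase and dominate every earlier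
    \<open>r j\<close>, so \<open>R\<close> is a monotone choice of indices that are far enough
    out.\<close>
  define R where "R k = (\<Sum>j\<le>k. r j)" for k
  have Rr: "R K \<ge> r k" if "K \<ge> k" for k K :: nat
    unfolding R_def using that by (intro member_le_sum) auto
  define d where "d k \<theta> = f (R (Suc k)) \<theta> - f (R k) \<theta>" for k \<theta>
  have dsq: "sq_int (d k)" for k unfolding d_def by (intro sq_int_diff f)
  have [measurable]: "d k \<in> borel_measurable Lc" for k using dsq by (simp add: sq_int_def)
  have dint: "(LINT \<theta>|Lc. norm (d k \<theta>)) \<le> 4 * (1/2)^k" for k
  proof -
    \<comment> \<open>The inequality \<open>2 * a \<le> \<delta> + a^2 / \<delta>\<close> with
      \<open>\<delta> = (1/2)^k\<close> turns the L2 bound \<open>(1/4)^k\<close> into a geometric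
      L1 bound.\<close>
    have "(LINT \<theta>|Lc. norm (d k \<theta>)) \<le> (LINT \<theta>|Lc. (1/2) * (1/2)^k + (1/2) * 2^k * (norm (d k \<theta>))\<^sup>2)"
    proof (rule integral_mono)
      show "integrable Lc (\<lambda>\<theta>. norm (d k \<theta>))" using sq_int_integrable[OF dsq] by simp
      show "integrable Lc (\<lambda>\<theta>. (1/2) * (1/2)^k + (1/2) * 2^k * (norm (d k \<theta>))\<^sup>2)"
        using dsq[of k] integrable_Lc_const by (auto simp: sq_int_def)
      fix \<theta>
      have "0 \<le> (1 - 2^k * norm (d k \<theta>))\<^sup>2" by simp
      then have "2 * (2^k * norm (d k \<theta>)) \<le> 1 + (2^k * norm (d k \<theta>))\<^sup>2" by (simp add: power2_diff)
      then have "(1/2) * (1/2)^k * (2 * (2^k * norm (d k \<theta>))) \<le> (1/2) * (1/2)^k *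
          (1 + (2^k * norm (d k \<theta>))\<^sup>2)"
        by (intro mult_left_mono) auto
      then show "norm (d k \<theta>) \<le> (1/2) * (1/2)^k + (1/2) * 2^k * (norm (d k \<theta>))\<^sup>2"
        by (simp add: power_mult_distrib power_one_over field_simps power2_eq_square)
    qed
    also have "\<dots> = pi * (1/2)^k + (1/2) * 2^k * dist2 (f (R (Suc k))) (f (R k))"
      using dsq[of k] integrable_Lc_const by (simp add: sq_int_def integral_Lc_const dist2_def
          d_def)
    also have "\<dots> \<le> pi * (1/2)^k + (1/2) * 2^k * (1/4)^k"
      using r[OF Rr Rr, of k "Suc k" k] by (intro add_left_mono mult_left_mono) auto
    also have "(1/2) * 2^k * (1/4)^k = (1/2) * (1/2::real)^k"
      by (simp add: power_mult_distrib[symmetric])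
    also have "pi * (1/2)^k + (1/2) * (1/2)^k \<le> 4 * (1/2)^k"
      using mult_right_mono[of "pi + 1/2" 4 "(1/2) ^ k"] pi_approx by (simp add: distrib_right)
    finally show ?thesis .
  qed
  have "(\<integral>\<^sup>+\<theta>. (\<Sum>k. ennreal (norm (d k \<theta>))) \<partial>Lc) = (\<Sum>k. \<integral>\<^sup>+\<theta>. ennreal (norm (d k \<theta>)) \<partial>Lc)"
    by (rule nn_integral_suminf) measurable
  also have "\<dots> = (\<Sum>k. ennreal (LINT \<theta>|Lc. norm (d k \<theta>)))"
    using sq_int_integrable[OF dsq] by (simp add: nn_integral_eq_integral)
  also have "\<dots> \<le> (\<Sum>k. ennreal (4 * (1/2)^k))"
    by (intro suminf_le summableI ennreal_leI dint)
  also have "\<dots> = ennreal (\<Sum>k. 4 * (1/2)^k)"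
    by (rule suminf_ennreal2) (auto intro!: summable_mult summable_geometric)
  also have "\<dots> < \<infinity>" by simp
  finally have "(\<integral>\<^sup>+\<theta>. (\<Sum>k. ennreal (norm (d k \<theta>))) \<partial>Lc) \<noteq> \<infinity>" by simp
  from nn_integral_PInf_AE[OF _ this]
  have "AE \<theta> in Lc. (\<Sum>k. ennreal (norm (d k \<theta>))) \<noteq> \<infinity>" by measurable
  then have AEs: "AE \<theta> in Lc. summable (\<lambda>k. d k \<theta>)"
    by eventually_elim (auto intro!: summable_norm_cancel[OF summable_suminf_not_top] simp:
        infinity_ennreal_def)
  define g where "g \<theta> = f (R 0) \<theta> + (\<Sum>k. d k \<theta>)" for \<theta>
  have [measurable]: "g \<in> borel_measurable Lc" unfolding g_def by measurable
  have lim: "AE \<theta> in Lc. (\<lambda>K. f (R K) \<theta>) \<longlonglongrightarrow> g \<theta>"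
    using AEs
  proof eventually_elim
    case (elim \<theta>)
    have "f (R 0) \<theta> + (\<Sum>k<K. d k \<theta>) = f (R K) \<theta>" for K
      unfolding d_def by (subst sum_lessThan_telescope[of "\<lambda>k. f (R k) \<theta>"]) simp
    moreover have "(\<lambda>K. f (R 0) \<theta> + (\<Sum>k<K. d k \<theta>)) \<longlonglongrightarrow> g \<theta>"
      unfolding g_def using elim by (intro tendsto_intros summable_LIMSEQ)
    ultimately show ?case by simp
  qed
  have fatou: "(\<integral>\<^sup>+\<theta>. ennreal ((norm (f n \<theta> - g \<theta>))\<^sup>2) \<partial>Lc) \<le> ennreal ((1/4)^k)" if n: "n \<ge> R k"
      for n k
  proof -
    have "(\<integral>\<^sup>+\<theta>. ennreal ((norm (f n \<theta> - g \<theta>))\<^sup>2) \<partial>Lc)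
        = (\<integral>\<^sup>+\<theta>. liminf (\<lambda>K. ennreal ((norm (f n \<theta> - f (R K) \<theta>))\<^sup>2)) \<partial>Lc)"
    proof (rule nn_integral_cong_AE)
      show "AE \<theta> in Lc. ennreal ((norm (f n \<theta> - g \<theta>))\<^sup>2) = liminf
          (\<lambda>K. ennreal ((norm (f n \<theta> - f (R K) \<theta>))\<^sup>2))"
        using lim
      proof eventually_elim
        case (elim \<theta>)
        then have "(\<lambda>K. ennreal ((norm (f n \<theta> - f (R K) \<theta>))\<^sup>2)) \<longlonglongrightarrow> ennreal ((norm (f n \<theta> - g \<theta>))\<^sup>2)"
          by (intro tendsto_intros)
        from lim_imp_Liminf[OF sequentially_bot this] show ?case by (rule sym)
      qed
    qed
    also have "\<dots> \<le> liminf (\<lambda>K. \<integral>\<^sup>+\<theta>. ennreal ((norm (f n \<theta> - f (R K) \<theta>))\<^sup>2) \<partial>Lc)"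
      by (rule nn_integral_liminf) measurable
    also have "\<dots> \<le> ennreal ((1/4)^k)"
    proof (rule Liminf_le)
      show "\<forall>\<^sub>F K in sequentially. (\<integral>\<^sup>+\<theta>. ennreal ((norm (f n \<theta> - f (R K) \<theta>))\<^sup>2) \<partial>Lc) \<le> ennreal
          ((1/4)^k)"
        using eventually_ge_at_top[of k]
      proof eventually_elim
        case (elim K)
        have "(\<integral>\<^sup>+\<theta>. ennreal ((norm (f n \<theta> - f (R K) \<theta>))\<^sup>2) \<partial>Lc) = ennreal (dist2 (f n) (f (R K)))"
          unfolding dist2_def using sq_int_diff[OF f f, of n "R K"]
          by (intro nn_integral_eq_integral) (auto simp: sq_int_def)
        also have "\<dots> \<le> ennreal ((1/4)^k)"
          using r[of k n "R K"] Rr[of k K] Rr[of k k] n elim by (intro ennreal_leI) simp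
        finally show ?case .
      qed
    qed simp
    finally show ?thesis .
  qed
  have sqd: "sq_int (\<lambda>\<theta>. f n \<theta> - g \<theta>)" if "n \<ge> R 0" for n
    unfolding sq_int_def
  proof
    show "integrable Lc (\<lambda>\<theta>. (norm (f n \<theta> - g \<theta>))\<^sup>2)"
      by (rule integrableI_bounded) (use le_less_trans[OF fatou[OF that]] in auto)
  qed measurable
  have g: "sq_int g"
    using sq_int_diff[OF f[of "R 0"] sqd[of "R 0"]] by simp
  have "(\<lambda>n. dist2 (f n) g) \<longlonglongrightarrow> 0"
  proof (rule LIMSEQ_I)
    fix e :: real assume "e > 0"
    then obtain k where k: "(1/4)^k < e" using real_arch_pow_inv[of e "1/4"] by auto
    have "norm (dist2 (f n) g - 0) < e" if "n \<ge> R k" for n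
    proof -
      have "n \<ge> R 0" using that Rr[of 0 k] unfolding R_def by (simp add: sum_nonneg_leq_bound)
      then have "ennreal (dist2 (f n) g) = (\<integral>\<^sup>+\<theta>. ennreal ((norm (f n \<theta> - g \<theta>))\<^sup>2) \<partial>Lc)"
        unfolding dist2_def using sqd by (intro nn_integral_eq_integral[symmetric])
            (auto simp: sq_int_def)
      also have "\<dots> \<le> ennreal ((1/4)^k)" by (rule fatou[OF that])
      finally have "dist2 (f n) g \<le> (1/4)^k" by (subst (asm) ennreal_le_iff) auto
      then show ?thesis using k dist2_nonneg[of "f n" g] by simp
    qed
    then show "\<exists>no. \<forall>n\<ge>no. norm (dist2 (f n) g - 0) < e" by blast
  qed
  with g show thesis by (rule that)
qed

section \<open>The Fourier transform\<close>

lemma expi_conv: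
  "exp (\<i> * complex_of_real k * of_int x) = expi x k"
  "exp (- \<i> * complex_of_real k * of_int x) = expi (- x) k"
  by (simp_all add: expi_def mult_ac)

definition fsum :: "int set \<Rightarrow> state \<Rightarrow> real \<Rightarrow> complex^2" where
  "fsum F \<phi> k = (\<Sum>x\<in>F. expi (- x) k *s \<phi> x)"

lemma expi_measurable [measurable]: "expi n \<in> borel_measurable Lc"
  by (intro continuous_measurable_Lc continuous_intros)

lemma fsum_measurable [measurable]: "fsum F \<phi> \<in> borel_measurable Lc"
  unfolding fsum_def[abs_def] by measurable

lemma norm_fsum_le: "norm (fsum F \<phi> k) \<le> (\<Sum>x\<in>F. norm (\<phi> x))"
  unfolding fsum_def by (rule order_trans[OF norm_sum]) (simp add: cvec_norm_scale)

lemma sq_int_fsum: "sq_int (fsum F \<phi>)"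
  by (rule sq_int_bounded[OF fsum_measurable norm_fsum_le])

lemma integrable_expi_smult:
  assumes "integrable Lc h"
  shows "integrable Lc (\<lambda>k. expi x k *s h k)"
  by (rule Bochner_Integration.integrable_bound[OF assms])
     (use assms in \<open>auto simp: cvec_norm_scale intro: borel_measurable_integrable\<close>)

lemma fourier_inv_eq:
  assumes "integrable Lc h"
  shows "fourier_inv h x = complex_of_real (1 / (2*pi)) *s (LINT k|Lc. expi x k *s h k)"
  unfolding fourier_inv_def expi_conv using integral_Lc[OF integrable_expi_smult[OF assms]] by simp

lemma fourier_inv_diff:
  assumes "integrable Lc f" "integrable Lc g"
  shows "fourier_inv (\<lambda>k. f k - g k) x = fourier_inv f x - fourier_inv g x"
  using assms integrable_expi_smult[of f x] integrable_expi_smult[of g x]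
  by (simp add: fourier_inv_eq vec_smult_distribs)

text \<open>Fourier summation and \<open>fourier_inv\<close> are adjoint up to the factor 2 pi.
  Parseval, Bessel and the matrix elements of the free evolution all rest on this identity.\<close>

lemma cinner_fourier_inv:
  assumes h: "integrable Lc h" and F: "finite F"
  shows "integrable Lc (\<lambda>k. cinner (fsum F \<phi> k) (h k))"
    "(LINT k|Lc. cinner (fsum F \<phi> k) (h k)) = 2 * pi * (\<Sum>x\<in>F. cinner (\<phi> x) (fourier_inv h x))"
proof -
  have eq: "cinner (fsum F \<phi> k) (h k) = (\<Sum>x\<in>F. cinner (\<phi> x) (expi x k *s h k))" for k
    unfolding fsum_def cinner.sum_left by (simp add: cinner_simps cnj_expi)
  have i: "integrable Lc (\<lambda>k. cinner (\<phi> x) (expi x k *s h k))" for x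
    by (rule integrable_bounded_linear[OF cinner.bounded_linear_right integrable_expi_smult[OF h]])
  show "integrable Lc (\<lambda>k. cinner (fsum F \<phi> k) (h k))"
    unfolding eq by (intro Bochner_Integration.integrable_sum i)
  have "(LINT k|Lc. cinner (fsum F \<phi> k) (h k)) = (\<Sum>x\<in>F. LINT k|Lc. cinner (\<phi> x) (expi x k *s h k))"
    unfolding eq by (rule Bochner_Integration.integral_sum) (rule i)
  also have "\<dots> = (\<Sum>x\<in>F. cinner (\<phi> x) (LINT k|Lc. expi x k *s h k))"
    by (intro sum.cong refl integral_bounded_linear[OF cinner.bounded_linear_right
        integrable_expi_smult[OF h]])
  also have "\<dots> = (\<Sum>x\<in>F. 2 * pi * cinner (\<phi> x) (fourier_inv h x))"
    by (intro sum.cong refl) (simp add: fourier_inv_eq[OF h] cinner_simps)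
  finally show "(LINT k|Lc. cinner (fsum F \<phi> k) (h k)) = 2 * pi *
      (\<Sum>x\<in>F. cinner (\<phi> x) (fourier_inv h x))"
    by (simp add: sum_distrib_left)
qed

lemma integrable_expi: "integrable Lc (expi n)"
  unfolding integrable_Lc_iff by (intro absolutely_integrable_continuous_real continuous_intros)

lemma fourier_inv_fsum:
  assumes F: "finite F"
  shows "fourier_inv (fsum F \<phi>) x = (if x \<in> F then \<phi> x else 0)"
proof -
  have i: "integrable Lc (\<lambda>k. expi n k *s v)" for n and v :: "complex^2"
    by (rule integrable_bounded_linear[OF smult.bounded_linear_left integrable_expi])
  have "(LINT k|Lc. expi x k *s fsum F \<phi> k) = (LINT k|Lc. (\<Sum>y\<in>F. expi (x - y) k *s \<phi> y))"
    unfolding fsum_def smult.sum_right using expi_add[of x "- _"]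
    by (intro Bochner_Integration.integral_cong refl sum.cong) (simp add: vec_smult_distribs)
  also have "\<dots> = (\<Sum>y\<in>F. LINT k|Lc. expi (x - y) k *s \<phi> y)"
    by (rule Bochner_Integration.integral_sum) (rule i)
  also have "\<dots> = (\<Sum>y\<in>F. (LINT k|Lc. expi (x - y) k) *s \<phi> y)"
    by (intro sum.cong refl integral_bounded_linear[OF smult.bounded_linear_left integrable_expi])
  also have "\<dots> = (\<Sum>y\<in>F. if y = x then (2 * pi) *s \<phi> x else 0)"
    by (intro sum.cong refl) (auto simp: integral_expi)
  also have "\<dots> = (if x \<in> F then (2 * pi) *s \<phi> x else 0)" using F by simp
  finally show ?thesis
    by (simp add: fourier_inv_eq sq_int_integrable[OF sq_int_fsum] vec_smult_distribs(6))
qed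

lemma Re_LINT: "integrable M f \<Longrightarrow> Re (LINT k|M. f k) = (LINT k|M. Re (f k))"
  by (rule integral_bounded_linear[OF bounded_linear_Re, symmetric])

lemma parseval_fsum:
  assumes F: "finite F"
  shows "(LINT k|Lc. (norm (fsum F \<phi> k))\<^sup>2) = 2 * pi * (\<Sum>x\<in>F. (norm (\<phi> x))\<^sup>2)"
proof -
  note c = cinner_fourier_inv[OF sq_int_integrable[OF sq_int_fsum] F, of \<phi> F \<phi>]
  have "(LINT k|Lc. (norm (fsum F \<phi> k))\<^sup>2) = Re (LINT k|Lc. cinner (fsum F \<phi> k) (fsum F \<phi> k))"
    by (simp add: Re_LINT[OF c(1)] Re_cinner power2_norm_eq_inner)
  also have "\<dots> = 2 * pi * (\<Sum>x\<in>F. (norm (\<phi> x))\<^sup>2)"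
    unfolding c(2) by (simp add: fourier_inv_fsum[OF F] Re_cinner power2_norm_eq_inner)
  finally show ?thesis .
qed

text \<open>Expand the squared distance of \<open>h\<close> to its own partial Fourier sum
  \<open>S\<close>: the inner product of \<open>S\<close> with \<open>h\<close> and the square of
  \<open>S\<close> have the same integral.\<close>

lemma bessel:
  assumes h: "sq_int h" and F: "finite F"
  shows "(\<Sum>x\<in>F. (norm (fourier_inv h x))\<^sup>2) \<le> 1 / (2*pi) * (LINT k|Lc. (norm (h k))\<^sup>2)"
proof -
  define S where "S = fsum F (fourier_inv h)"
  define a where "a = (\<Sum>x\<in>F. (norm (fourier_inv h x))\<^sup>2)"
  note c = cinner_fourier_inv[OF sq_int_integrable[OF h] F, of "fourier_inv h"]
  have iS: "integrable Lc (\<lambda>k. (norm (S k))\<^sup>2)" "integrable Lc (\<lambda>k. (norm (h k))\<^sup>2)"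
    using sq_int_fsum h by (auto simp: sq_int_def S_def)
  have iC: "integrable Lc (\<lambda>k. inner (S k) (h k))"
    using integrable_bounded_linear[OF bounded_linear_Re c(1)] by (simp add: Re_cinner S_def)
  have "0 \<le> (LINT k|Lc. (norm (h k - S k))\<^sup>2)" by simp
  also have "\<dots> = (LINT k|Lc. (norm (h k))\<^sup>2 - 2 * inner (S k) (h k) + (norm (S k))\<^sup>2)"
    by (simp add: power2_norm_eq_inner inner_diff_left inner_diff_right inner_commute algebra_simps)
  also have "\<dots> = (LINT k|Lc. (norm (h k))\<^sup>2) - 2 * (LINT k|Lc. inner (S k) (h k)) +
      (LINT k|Lc. (norm (S k))\<^sup>2)"
    using iS iC by simp
  also have "(LINT k|Lc. inner (S k) (h k)) = 2 * pi * a"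
  proof -
    have "(LINT k|Lc. inner (S k) (h k)) = Re (LINT k|Lc. cinner (S k) (h k))"
      using Re_LINT[OF c(1)] by (simp add: Re_cinner S_def)
    then show ?thesis unfolding S_def c(2) by (simp add: Re_cinner power2_norm_eq_inner a_def)
  qed
  also have "(LINT k|Lc. (norm (S k))\<^sup>2) = 2 * pi * a" unfolding S_def a_def
      by (rule parseval_fsum[OF F])
  finally have "2 * pi * a \<le> (LINT k|Lc. (norm (h k))\<^sup>2)" by simp
  then show ?thesis by (simp add: a_def field_simps)
qed

lemma l2_fourier_inv:
  assumes "sq_int h"
  shows "l2 (fourier_inv h)"
  unfolding l2_def
  by (rule nonneg_bdd_above_summable_on) (use bessel[OF assms] in \<open>auto intro!: bdd_aboveI2\<close>)

definition hilF :: "(real \<Rightarrow> complex^2) \<Rightarrow> hil" where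
  "hilF h = hil (fourier_inv h)"

lemma st_hilF: "sq_int h \<Longrightarrow> st (hilF h) = fourier_inv h"
  by (simp add: hilF_def l2_fourier_inv)

lemma norm_hilF_le:
  assumes "sq_int h"
  shows "norm (hilF h) \<le> sqrt (1 / (2*pi) * (LINT k|Lc. (norm (h k))\<^sup>2))"
  by (rule norm_hil_le) (use bessel[OF assms] in \<open>auto simp: st_hilF[OF assms]\<close>)

lemma hilF_diff: "sq_int f \<Longrightarrow> sq_int g \<Longrightarrow> hilF (\<lambda>k. f k - g k) = hilF f - hilF g"
  by (simp add: st_inject[symmetric] st_hilF sq_int_diff st_simps fourier_inv_diff
      sq_int_integrable fun_eq_iff)

lemma norm_hilF_diff: "sq_int f \<Longrightarrow> sq_int g \<Longrightarrow> norm (hilF f - hilF g) \<le> sqrt (1 / (2*pi) * dist2 f g)"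
  using norm_hilF_le[OF sq_int_diff[of f g]] by (simp add: hilF_diff dist2_def)

text \<open>Endpoints have measure zero. This allows a multiplier to be altered there, where the
  derivatives of the bands are not two-sided.\<close>

lemma fourier_inv_spike:
  assumes "\<And>k. k \<in> {0<..<2*pi} \<Longrightarrow> f k = g k"
  shows "fourier_inv f = fourier_inv g"
proof
  fix x
  have "integral {0..2*pi} (\<lambda>k. exp (\<i> * of_real k * of_int x) *s f k)
      = integral {0..2*pi} (\<lambda>k. exp (\<i> * of_real k * of_int x) *s g k)"
    by (rule integral_spike[of "{0, 2*pi}"]) (use assms in auto)
  then show "fourier_inv f x = fourier_inv g x" by (simp add: fourier_inv_def)
qed

definition psum :: "state \<Rightarrow> nat \<Rightarrow> real \<Rightarrow> complex^2" where
  "psum \<Psi> N = fsum {- int N..int N} \<Psi>"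

lemma sq_int_psum: "sq_int (psum \<Psi> N)"
  unfolding psum_def by (rule sq_int_fsum)

lemma psum_dist2:
  assumes "N \<le> M"
  shows "dist2 (psum \<Psi> M) (psum \<Psi> N)
    = 2 * pi * ((\<Sum>x\<in>{- int M..int M}. (norm (\<Psi> x))\<^sup>2) - (\<Sum>x\<in>{- int N..int N}. (norm (\<Psi> x))\<^sup>2))"
proof -
  have sub: "{- int N..int N} \<subseteq> {- int M..int M}" using assms by auto
  have "psum \<Psi> M k - psum \<Psi> N k = fsum ({- int M..int M} - {- int N..int N}) \<Psi> k" for k
    unfolding psum_def fsum_def using sub by (simp add: sum_diff)
  then show ?thesis
    unfolding dist2_def using sub by (simp add: parseval_fsum sum_diff)
qed

lemma psum_Cauchy:
  assumes "l2 \<Psi>" "e > 0"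
  shows "\<exists>N0. \<forall>m\<ge>N0. \<forall>n\<ge>N0. dist2 (psum \<Psi> m) (psum \<Psi> n) < e"
proof -
  define a where "a N = (\<Sum>x\<in>{- int N..int N}. (norm (\<Psi> x))\<^sup>2)" for N
  have "incseq a" unfolding a_def by (intro monoI sum_mono2) auto
  moreover have "a N \<le> (norm (hil \<Psi>))\<^sup>2" for N
    unfolding a_def using finite_sum_le_norm_hil[of "{- int N..int N}" "hil \<Psi>"] assms(1) by simp
  ultimately have "Cauchy a"
    using incseq_convergent[of a] LIMSEQ_imp_Cauchy by metis
  then obtain N0 where N0: "\<And>m n. m \<ge> N0 \<Longrightarrow> n \<ge> N0 \<Longrightarrow> dist (a m) (a n) < e / (2*pi)"
    using metric_CauchyD[of a "e / (2*pi)"] assms(2) by auto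
  have d: "dist2 (psum \<Psi> m) (psum \<Psi> n) < e" if "n \<le> m" "m \<ge> N0" "n \<ge> N0" for m n
    using psum_dist2[OF that(1), of \<Psi>] N0[OF that(2,3)]
        by (simp add: a_def dist_real_def field_simps abs_less_iff)
  have "dist2 (psum \<Psi> m) (psum \<Psi> n) < e" if "m \<ge> N0" "n \<ge> N0" for m n
    using d[of m n] d[of n m] that by (cases "n \<le> m") (auto simp: dist2_commute)
  then show ?thesis by blast
qed

text \<open>Since \<open>fourier\<close> is a \<open>SOME\<close>, its defining property has to be
  shown satisfiable; Riesz-Fischer for the partial sums does this.\<close>

lemma fourier_properties:
  assumes "l2 \<Psi>"
  shows "sq_int (fourier \<Psi>)" "(\<lambda>N. dist2 (psum \<Psi> N) (fourier \<Psi>)) \<longlonglongrightarrow> 0"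
proof -
  have eq: "(\<Sum>x\<in>{-int N..int N}. exp (- \<i> * of_real k * of_int x) *s \<Psi> x) = psum \<Psi> N k" for N k
    unfolding psum_def fsum_def expi_conv ..
  have meas: "g measurable_on {0..2*pi} \<longleftrightarrow> g \<in> borel_measurable Lc" for g :: "real \<Rightarrow> complex^2"
    by (rule measurable_on_iff_borel_measurable) simp
  define P where "P g \<longleftrightarrow> g measurable_on {0..2*pi} \<and>
     (\<forall>N::nat. (\<lambda>k. (norm ((\<Sum>x\<in>{-int N..int N}. exp (- \<i> * of_real k * of_int x) *s \<Psi> x) - g k))\<^sup>2)
                  integrable_on {0..2*pi}) \<and>
     (\<lambda>N::nat. integral {0..2*pi}
        (\<lambda>k. (norm ((\<Sum>x\<in>{-int N..int N}. exp (- \<i> * of_real k * of_int x) *s \<Psi> x) - g k))\<^sup>2))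
       \<longlonglongrightarrow> 0" for g
  have int: "integrable Lc (\<lambda>k. (norm (psum \<Psi> N k - g k))\<^sup>2)
      \<longleftrightarrow> (\<lambda>k. (norm (psum \<Psi> N k - g k))\<^sup>2) integrable_on {0..2*pi}" for N g
    using integrable_Lc_nonneg integrable_on_lebesgue_on[of "{0..2*pi}"] by auto
  have P: "P g \<longleftrightarrow> sq_int g \<and> (\<lambda>N. dist2 (psum \<Psi> N) g) \<longlonglongrightarrow> 0" for g
  proof
    assume "P g"
    then have g: "g \<in> borel_measurable Lc" and i:
        "\<And>N. integrable Lc (\<lambda>k. (norm (psum \<Psi> N k - g k))\<^sup>2)"
      and l: "(\<lambda>N. integral {0..2*pi} (\<lambda>k. (norm (psum \<Psi> N k - g k))\<^sup>2)) \<longlonglongrightarrow> 0"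
      unfolding P_def eq meas int by auto
    \<comment> \<open>Square integrability of \<open>g\<close> is recovered from a single partial
      sum, here the one with \<open>N = 0\<close>.\<close>
    have "sq_int (\<lambda>k. psum \<Psi> 0 k - g k)"
      unfolding sq_int_def using i g sq_int_measurable[OF sq_int_psum] by auto
    from sq_int_diff[OF sq_int_psum[of \<Psi> 0] this] have "sq_int g" by simp
    with l show "sq_int g \<and> (\<lambda>N. dist2 (psum \<Psi> N) g) \<longlonglongrightarrow> 0"
      by (simp add: integral_Lc[OF i] dist2_def)
  next
    assume g: "sq_int g \<and> (\<lambda>N. dist2 (psum \<Psi> N) g) \<longlonglongrightarrow> 0"
    then have i: "integrable Lc (\<lambda>k. (norm (psum \<Psi> N k - g k))\<^sup>2)" for N
      using sq_int_diff[OF sq_int_psum[of \<Psi> N], of g] by (simp add: sq_int_def)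
    show "P g"
      unfolding P_def eq meas int[symmetric]
      using g i by (simp add: integral_Lc[OF i] dist2_def sq_int_measurable)
  qed
  have "\<exists>g. P g"
    unfolding P using riesz_fischer[OF sq_int_psum psum_Cauchy[OF assms]] by metis
  then have "P (SOME g. P g)" by (rule someI_ex)
  also have "(SOME g. P g) = fourier \<Psi>" unfolding P_def fourier_def ..
  finally show "sq_int (fourier \<Psi>)" "(\<lambda>N. dist2 (psum \<Psi> N) (fourier \<Psi>)) \<longlonglongrightarrow> 0"
    unfolding P by auto
qed

text \<open>The inverse transform of a partial sum is the truncation of \<open>h\<close>, so the
  error is a tail of a convergent sum. This reduces later limits to finitely supported
  states.\<close>

lemma hilF_psum_tendsto: "(\<lambda>N. hilF (psum (st h) N)) \<longlonglongrightarrow> h"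
proof -
  have st: "st (hilF (psum (st h) N)) = (\<lambda>x. if x \<in> {- int N..int N} then st h x else 0)" for N
    by (simp add: st_hilF sq_int_psum) (simp add: psum_def fourier_inv_fsum fun_eq_iff)
  have bound: "(norm (h - hilF (psum (st h) N)))\<^sup>2 \<le> (norm h)\<^sup>2 -
      (\<Sum>x\<in>{- int N..int N}. (norm (st h x))\<^sup>2)" for N
  proof -
    let ?I = "{- int N..int N}"
    have nn: "(norm h)\<^sup>2 - (\<Sum>x\<in>?I. (norm (st h x))\<^sup>2) \<ge> 0"
      using finite_sum_le_norm_hil[of ?I h] by simp
    have "norm (h - hilF (psum (st h) N)) \<le> sqrt ((norm h)\<^sup>2 - (\<Sum>x\<in>?I. (norm (st h x))\<^sup>2))"
    proof (rule norm_hil_le)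
      fix F :: "int set" assume F: "finite F"
      have "(\<Sum>x\<in>F. (norm (st (h - hilF (psum (st h) N)) x))\<^sup>2) =
          (\<Sum>x\<in>F. if x \<in> ?I then 0 else (norm (st h x))\<^sup>2)"
        unfolding st_simps st by (intro sum.cong) auto
      also have "\<dots> = (\<Sum>x\<in>F - ?I. (norm (st h x))\<^sup>2)"
        using F by (intro sum.mono_neutral_cong_right) auto
      also have "\<dots> = (\<Sum>x\<in>(F - ?I) \<union> ?I. (norm (st h x))\<^sup>2) - (\<Sum>x\<in>?I. (norm (st h x))\<^sup>2)"
        using F by (subst sum.union_disjoint) auto
      also have "\<dots> \<le> (norm h)\<^sup>2 - (\<Sum>x\<in>?I. (norm (st h x))\<^sup>2)"
        using F by (intro diff_right_mono finite_sum_le_norm_hil) auto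
      finally show "(\<Sum>x\<in>F. (norm (st (h - hilF (psum (st h) N)) x))\<^sup>2)
          \<le> (sqrt ((norm h)\<^sup>2 - (\<Sum>x\<in>?I. (norm (st h x))\<^sup>2)))\<^sup>2" using nn by simp
    qed (use nn in simp)
    then have "(norm (h - hilF (psum (st h) N)))\<^sup>2 \<le>
        (sqrt ((norm h)\<^sup>2 - (\<Sum>x\<in>?I. (norm (st h x))\<^sup>2)))\<^sup>2"
      by (intro power_mono) auto
    then show ?thesis using nn by simp
  qed
  show ?thesis
  proof (rule metric_LIMSEQ_I)
    fix e :: real assume e: "e > 0"
    have sm: "(\<lambda>x. (norm (st h x))\<^sup>2) summable_on UNIV" using l2_st[of h] by (simp add: l2_def)
    obtain F where F: "finite F" "dist (\<Sum>x\<in>F. (norm (st h x))\<^sup>2) (\<Sum>\<^sub>\<infinity>x. (norm (st h x))\<^sup>2) \<le> e\<^sup>2 /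
        2"
      using infsum_finite_approximation[OF sm, of "e\<^sup>2/2"] e by auto
    obtain N0 :: nat where N0: "\<And>x. x \<in> F \<Longrightarrow> \<bar>x\<bar> \<le> int N0"
    proof
      fix x assume "x \<in> F"
      then have "nat \<bar>x\<bar> \<le> (\<Sum>x\<in>F. nat \<bar>x\<bar>)" using F(1) by (intro member_le_sum) auto
      then show "\<bar>x\<bar> \<le> int (\<Sum>x\<in>F. nat \<bar>x\<bar>)" by linarith
    qed
    have "dist (hilF (psum (st h) N)) h < e" if "N \<ge> N0" for N
    proof -
      have "(\<Sum>x\<in>F. (norm (st h x))\<^sup>2) \<le> (\<Sum>x\<in>{- int N..int N}. (norm (st h x))\<^sup>2)"
        using N0 that by (intro sum_mono2) (force simp: abs_le_iff)+
      then have "(norm (h - hilF (psum (st h) N)))\<^sup>2 \<le> e\<^sup>2 / 2"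
        using bound[of N] F(2) unfolding norm_hil_sq[of h] dist_real_def by linarith
      also have "\<dots> < e\<^sup>2" using e by simp
      finally have "norm (h - hilF (psum (st h) N)) < e"
          by (rule power2_less_imp_less) (use e in simp)
      then show ?thesis by (simp add: dist_norm norm_minus_commute)
    qed
    then show "\<exists>no. \<forall>n\<ge>no. dist (hilF (psum (st h) n)) h < e" by blast
  qed
qed

section \<open>The free walk in momentum space\<close>

lemma U0hat_nth: "U0hat C0 k $ a $ b = (if a = 1 then expi 1 k else expi (-1) k) * C0 $ a $ b"
  using exhaust_2[of a] by (auto simp: U0hat_def matrix_matrix_mult_def sum_2 expi_def)

lemma U0hat_mult_nth [simp]:
  "(U0hat C0 k *v w) $ 1 = expi 1 k * (C0 *v w) $ 1"
  "(U0hat C0 k *v w) $ 2 = expi (-1) k * (C0 *v w) $ 2"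
  by (simp_all add: matrix_vector_mult_def sum_2 U0hat_nth distrib_left)

lemma continuous_on_U0hat: "continuous_on S (U0hat C0)"
proof -
  have "U0hat C0 = (\<lambda>k. \<chi> a b. (if a = 1 then expi 1 k else expi (-1) k) * C0 $ a $ b)"
    by (simp add: fun_eq_iff vec_eq_iff U0hat_nth)
  moreover have "continuous_on S (\<lambda>k. if a = 1 then expi 1 k else expi (-1) k)" for a :: 2
    by (cases "a = 1") (auto intro: continuous_intros)
  ultimately show ?thesis
    by (auto intro!: continuous_on_vec_lambda continuous_on_mult continuous_on_const)
qed

lemma U0hat_measurable [measurable]: "U0hat C0 \<in> borel_measurable Lc"
  by (rule continuous_measurable_Lc[OF continuous_on_U0hat])

lemma adjm_mult: "adjm (M ** N) = adjm N ** adjm M"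
  by (simp add: adjm_def matrix_matrix_mult_def vec_eq_iff mult.commute)

lemma unitary_mat_mult:
  assumes "unitary_mat M" "unitary_mat N"
  shows "unitary_mat (M ** N)"
proof -
  have "adjm N ** (adjm M ** M) ** N = mat 1" "M ** (N ** adjm N) ** adjm M = mat 1"
    using assms by (simp_all add: unitary_mat_def)
  then show ?thesis by (simp add: unitary_mat_def adjm_mult matrix_mul_assoc)
qed

lemma unitary_phase: "cmod z = 1 \<Longrightarrow> cmod w = 1 \<Longrightarrow>
  unitary_mat (\<chi> a b :: 2. if a = b then if a = 1 then z else w else 0)"
  using complex_norm_square[of z] complex_norm_square[of w]
  by (simp add: unitary_mat_def adjm_def matrix_matrix_mult_def vec_eq_iff forall_2 sum_2 mat_def
      mult.commute)

lemma unitary_U0hat: "unitary_mat C0 \<Longrightarrow> unitary_mat (U0hat C0 k)"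
  unfolding U0hat_def by (intro unitary_mat_mult unitary_phase) (auto simp: norm_exp_eq_Re)

lemma fourier_inv_nth:
  assumes "integrable Lc h"
  shows "fourier_inv h x $ i = complex_of_real (1 / (2*pi)) * (LINT k|Lc. expi x k * h k $ i)"
  using integral_bounded_linear[OF bounded_linear_vec_nth integrable_expi_smult[OF assms], of x i]
  by (simp add: fourier_inv_eq[OF assms])

lemma integrable_matvec:
  fixes h :: "real \<Rightarrow> complex^'n" and M :: "complex^'n^'m"
  shows "integrable Lc h \<Longrightarrow> integrable Lc (\<lambda>k. M *v h k)"
  by (rule integrable_bounded_linear[OF matvec.bounded_linear_right])

lemma coin_fourier_inv:
  assumes "integrable Lc h"
  shows "M *v fourier_inv h x = fourier_inv (\<lambda>k. M *v h k) x"
proof -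
  have "(LINT k|Lc. M *v (expi x k *s h k)) = M *v (LINT k|Lc. expi x k *s h k)"
    by (rule integral_bounded_linear[OF matvec.bounded_linear_right
        integrable_expi_smult[OF assms]])
  then show ?thesis
    using assms by (simp add: fourier_inv_eq integrable_matvec matrix_vector_smult)
qed

text \<open>Moving the position by one unit multiplies the integrand by \<open>expi 1\<close> or
  \<open>expi (-1)\<close>, which is the diagonal factor of \<open>U0hat\<close>.\<close>

lemma walk_fourier_inv:
  assumes h: "integrable Lc h" "integrable Lc (\<lambda>k. U0hat C0 k *v h k)"
  shows "walk (\<lambda>_. C0) (fourier_inv h) = fourier_inv (\<lambda>k. U0hat C0 k *v h k)"
proof -
  have ch: "integrable Lc (\<lambda>k. C0 *v h k)" by (rule integrable_matvec[OF h(1)])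
  have "coin (\<lambda>_. C0) (fourier_inv h) = fourier_inv (\<lambda>k. C0 *v h k)"
    by (simp add: fun_eq_iff coin_def coin_fourier_inv[OF h(1)])
  moreover have "shift (fourier_inv (\<lambda>k. C0 *v h k)) = fourier_inv (\<lambda>k. U0hat C0 k *v h k)"
    using expi_add[of _ 1] expi_add[of _ "-1"]
    by (simp add: fun_eq_iff vec_eq_iff forall_2 fourier_inv_nth[OF ch] fourier_inv_nth[OF h(2)]
        mult_ac)
  ultimately show ?thesis by (simp add: walk_def)
qed

section \<open>Ballistic asymptotics of the free walk\<close>

text \<open>Powers as an iterated action on a vector, parallel to the iteration of the walk
  itself.\<close>

definition U0hat_pow :: "complex^2^2 \<Rightarrow> nat \<Rightarrow> real \<Rightarrow> complex^2 \<Rightarrow> complex^2" where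
  "U0hat_pow C0 t k w = ((\<lambda>w. U0hat C0 k *v w) ^^ t) w"

definition U0hat_inv_pow :: "complex^2^2 \<Rightarrow> nat \<Rightarrow> real \<Rightarrow> complex^2 \<Rightarrow> complex^2" where
  "U0hat_inv_pow C0 t k w = ((\<lambda>w. adjm (U0hat C0 k) *v w) ^^ t) w"

lemma U0hat_pow_simps [simp]:
  "U0hat_pow C0 0 k w = w" "U0hat_pow C0 (Suc t) k w = U0hat C0 k *v U0hat_pow C0 t k w"
  by (simp_all add: U0hat_pow_def)

lemma U0hat_pow_diff: "U0hat_pow C0 t k (v - w) = U0hat_pow C0 t k v - U0hat_pow C0 t k w"
  by (induction t) (simp_all add: matvec.diff_right)

lemma norm_U0hat_pow: "unitary_mat C0 \<Longrightarrow> norm (U0hat_pow C0 t k w) = norm w"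
  by (induction t) (simp_all add: unitary_mat_norm unitary_U0hat)

lemma norm_U0hat_inv_pow: "unitary_mat C0 \<Longrightarrow> norm (U0hat_inv_pow C0 t k w) = norm w"
  by (induction t) (simp_all add: U0hat_inv_pow_def unitary_mat_norm unitary_U0hat unitary_mat_adjm)

lemma U0hat_inv_pow_diff: "U0hat_inv_pow C0 t k (v - w) = U0hat_inv_pow C0 t k v - U0hat_inv_pow
    C0 t k w"
  by (induction t) (simp_all add: U0hat_inv_pow_def matvec.diff_right)

lemma U0hat_inv_pow_U0hat_pow:
  assumes "unitary_mat C0"
  shows "U0hat_inv_pow C0 t k (U0hat_pow C0 t k w) = w"
proof (induction t)
  case (Suc t)
  have "adjm (U0hat C0 k) *v (U0hat C0 k *v v) = v" for v
    using unitary_U0hat[OF assms, of k] by (simp add: unitary_mat_def matrix_vector_mul_assoc)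
  with Suc show ?case by (simp add: U0hat_inv_pow_def funpow_swap1[symmetric] funpow_Suc_right
      del: funpow.simps(2))
qed (simp add: U0hat_inv_pow_def)

lemma U0hat_shift_measurable [measurable]: "(\<lambda>k. U0hat C0 (k - s)) \<in> borel_measurable Lc"
  by (intro continuous_measurable_Lc continuous_on_compose2[OF continuous_on_U0hat[of UNIV]]
      continuous_intros) auto

lemma adjm_U0hat_measurable [measurable]: "(\<lambda>k. adjm (U0hat C0 k)) \<in> borel_measurable Lc"
proof (rule continuous_measurable_Lc)
  have "continuous_on {0..2*pi} (\<lambda>k. U0hat C0 k $ j $ i)" for i j
    by (intro continuous_intros continuous_on_U0hat)
  then show "continuous_on {0..2*pi} (\<lambda>k. adjm (U0hat C0 k))"
    unfolding adjm_def by (auto intro!: continuous_on_vec_lambda continuous_on_cnj)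
qed

lemma U0hat_pow_measurable [measurable]:
  assumes [measurable]: "h \<in> borel_measurable Lc"
  shows "(\<lambda>k. U0hat_pow C0 t (k - s) (h k)) \<in> borel_measurable Lc"
  by (induction t) simp_all

lemma U0hat_pow_measurable' [measurable]:
  assumes "h \<in> borel_measurable Lc"
  shows "(\<lambda>k. U0hat_pow C0 t k (h k)) \<in> borel_measurable Lc"
  using U0hat_pow_measurable[OF assms, of C0 t 0] by simp

lemma U0hat_inv_pow_measurable [measurable]:
  assumes [measurable]: "h \<in> borel_measurable Lc"
  shows "(\<lambda>k. U0hat_inv_pow C0 t k (h k)) \<in> borel_measurable Lc"
  unfolding U0hat_inv_pow_def by (induction t) simp_all

lemma sq_int_U0hat_pow:
  assumes "unitary_mat C0" "sq_int h"
  shows "sq_int (\<lambda>k. U0hat_pow C0 t k (h k))"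
  by (rule sq_int_norm_le[OF U0hat_pow_measurable'[OF sq_int_measurable[OF assms(2)]] assms(2)])
     (simp add: norm_U0hat_pow[OF assms(1)])

lemma walk_pow_fourier_inv:
  assumes "unitary_mat C0" "sq_int h"
  shows "(walk (\<lambda>_. C0) ^^ t) (fourier_inv h) = fourier_inv (\<lambda>k. U0hat_pow C0 t k (h k))"
proof (induction t)
  case (Suc t)
  have "(walk (\<lambda>_. C0) ^^ Suc t) (fourier_inv h) = walk (\<lambda>_. C0)
      (fourier_inv (\<lambda>k. U0hat_pow C0 t k (h k)))"
    by (simp add: Suc)
  also have "\<dots> = fourier_inv (\<lambda>k. U0hat_pow C0 (Suc t) k (h k))"
    using sq_int_integrable[OF sq_int_U0hat_pow[OF assms, of t]]
        sq_int_integrable[OF sq_int_U0hat_pow[OF assms, of "Suc t"]]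
    by (simp add: walk_fourier_inv)
  finally show ?case .
qed simp

text \<open>The free walk conjugated by \<open>exp_x s\<close> is again a free walk, with constant
  coin \<open>U0hat C0 (- s)\<close>. The formula for its powers therefore applies, with the
  translated symbol.\<close>

lemma U0hat_U0hat: "U0hat (U0hat C0 (- s)) k = U0hat C0 (k - s)"
  by (simp add: vec_eq_iff forall_2 U0hat_nth expi_def algebra_simps flip: exp_add)

lemma exp_x_nth: "exp_x s \<Psi> x = exp (\<i> * of_real s * of_int x) *s \<Psi> x"
  by (simp add: exp_x_def mult_ac)

text \<open>Conjugation by \<open>exp (i s x)\<close> translates the quasi-momentum by \<open>s\<close>.\<close>

lemma exp_x_walk: "exp_x s (walk (\<lambda>_. C0) \<Psi>) = walk (\<lambda>_. U0hat C0 (- s)) (exp_x s \<Psi>)"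
proof
  fix x
  let ?e = "\<lambda>y. exp (\<i> * complex_of_real s * of_int y)"
  have "?e (x + 1) = exp (\<i> * s) * ?e x" "?e (x - 1) = exp (- (\<i> * s)) * ?e x"
    by (simp_all add: algebra_simps flip: exp_add)
  then show "exp_x s (walk (\<lambda>_. C0) \<Psi>) x = walk (\<lambda>_. U0hat C0 (- s)) (exp_x s \<Psi>) x"
    by (simp add: vec_eq_iff forall_2 walk_def coin_def exp_x_nth matrix_vector_smult expi_def
        mult.assoc[symmetric]
        exp_minus_inverse exp_minus del: of_int_add of_int_diff)
qed

lemma exp_x_walk_pow: "exp_x s ((walk (\<lambda>_. C0) ^^ t) \<Psi>) = (walk (\<lambda>_. U0hat C0 (- s)) ^^ t)
    (exp_x s \<Psi>)"
  by (induction t) (simp_all add: exp_x_walk)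

lemma fsum_exp_x: "fsum F (exp_x s \<phi>) k = fsum F \<phi> (k - s)"
  unfolding fsum_def
  by (intro sum.cong refl) (simp add: exp_x_nth expi_def vec_smult_distribs(6) algebra_simps flip:
      exp_add)

text \<open>Finite Fourier sums and \<open>U0hat\<close> are defined for all real \<open>k\<close>,
  so the translate by \<open>s\<close> makes sense even where \<open>k - s\<close> leaves the
  interval. General states follow by density.\<close>

lemma exp_x_walk_pow_fsum:
  assumes C0: "unitary_mat C0" and F: "finite F"
  shows "exp_x s ((walk (\<lambda>_. C0) ^^ t) (fourier_inv (fsum F \<phi>)))
     = fourier_inv (\<lambda>k. U0hat_pow C0 t (k - s) (fsum F \<phi> (k - s)))"
proof -
  have "exp_x s (fourier_inv (fsum F \<phi>)) = fourier_inv (fsum F (exp_x s \<phi>))"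
    by (simp add: fun_eq_iff fourier_inv_fsum[OF F] exp_x_def)
  then have "exp_x s ((walk (\<lambda>_. C0) ^^ t) (fourier_inv (fsum F \<phi>)))
      = fourier_inv (\<lambda>k. U0hat_pow (U0hat C0 (- s)) t k (fsum F (exp_x s \<phi>) k))"
    by (simp add: exp_x_walk_pow walk_pow_fourier_inv[OF unitary_U0hat[OF C0] sq_int_fsum])
  then show ?thesis by (simp add: U0hat_pow_def U0hat_U0hat fsum_exp_x)
qed

lemma norm_exp_x: "norm (exp_x s \<Psi> x) = norm (\<Psi> x)"
  by (simp add: exp_x_nth cvec_norm_scale norm_exp_eq_Re)

lemma l2_exp_x: "l2 \<Psi> \<Longrightarrow> l2 (exp_x s \<Psi>)"
  by (simp add: l2_def norm_exp_x)

definition exph :: "real \<Rightarrow> hil \<Rightarrow> hil" where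
  "exph s h = hil (exp_x s (st h))"

lemma st_exph [simp]: "st (exph s h) = exp_x s (st h)"
  by (simp add: exph_def l2_exp_x)

lemma norm_exph: "norm (exph s h) = norm h"
  by (simp add: norm_hil l2norm_def norm_exp_x)

lemma exph_diff: "exph s (g - h) = exph s g - exph s h"
  by (simp add: st_inject[symmetric] st_simps fun_eq_iff exp_x_nth vec_smult_distribs)

lemma has_vector_derivative_sequence:
  fixes f :: "real \<Rightarrow> 'a::real_normed_vector"
  assumes "(f has_vector_derivative D) (at 0)" "f 0 = 0"
  shows "(\<lambda>t. real t *\<^sub>R f (1 / real t)) \<longlonglongrightarrow> D"
proof -
  have "((\<lambda>y. norm (f y - y *\<^sub>R D) / norm y) \<longlongrightarrow> 0) (at 0)"
    using assms unfolding has_vector_derivative_def has_derivative_iff_norm by simp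
  moreover have "filterlim (\<lambda>t. 1 / real t) (at 0) sequentially"
    unfolding filterlim_at using lim_1_over_n eventually_gt_at_top[of 0]
    by (auto elim!: eventually_mono)
  ultimately have "(\<lambda>t. norm (f (1 / real t) - (1 / real t) *\<^sub>R D) / norm (1 / real t)) \<longlonglongrightarrow> 0"
    by (rule filterlim_compose)
  moreover have "\<forall>\<^sub>F t in sequentially. norm (f (1 / real t) - (1 / real t) *\<^sub>R D) / norm
      (1 / real t)
      = norm (real t *\<^sub>R f (1 / real t) - D)"
    using eventually_gt_at_top[of 0]
  proof eventually_elim
    case (elim t)
    have "real t *\<^sub>R f (1 / real t) - D = real t *\<^sub>R (f (1 / real t) - (1 / real t) *\<^sub>R D)"
      using elim by (simp add: scaleR_diff_right)
    then show ?case using elim by simp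
  qed
  ultimately have "(\<lambda>t. norm (real t *\<^sub>R f (1 / real t) - D)) \<longlonglongrightarrow> 0"
    by (rule Lim_transform_eventually)
  then show ?thesis using Lim_null tendsto_norm_zero_iff by blast
qed

locale free_walk =
  fixes C0 :: "complex^2^2" and lam :: "2 \<Rightarrow> real \<Rightarrow> complex" and u :: "2 \<Rightarrow> real \<Rightarrow> complex^2"
  assumes unitary_C0: "unitary_mat C0"
    and eig: "\<And>k. k \<in> {0..<2*pi} \<Longrightarrow> U0hat C0 k = (\<Sum>j\<in>UNIV. outer (lam j k) (u j k))"
    and orthonormal: "\<And>k j j'. k \<in> {0..<2*pi} \<Longrightarrow> cinner (u j k) (u j' k) = (if j = j' then 1 else 0)"
    and lam_diff: "\<And>j k. k \<in> {0..<2*pi} \<Longrightarrow> lam j differentiable (at k within {0..<2*pi})"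
    and u_diff: "\<And>j k. k \<in> {0..<2*pi} \<Longrightarrow> u j differentiable (at k within {0..<2*pi})"
begin

definition phase :: "real \<Rightarrow> 2 \<Rightarrow> real \<Rightarrow> complex" where
  "phase \<xi> j k = exp (\<i> * of_real \<xi> * (\<i> * deriv02 (lam j) k / lam j k))"

text \<open>The endpoints are excluded because \<^term>\<open>deriv02\<close> is the two-sided derivative only inside the interval.\<close>

definition symbol :: "real \<Rightarrow> real \<Rightarrow> complex^2^2" where
  "symbol \<xi> k = (if k \<in> {0<..<2*pi} then (\<Sum>j\<in>UNIV. outer (phase \<xi> j k) (u j k)) else 0)"

lemma outer_mult: "outer c v *v w = (c * cinner v w) *s v"
  by (simp add: outer_def matrix_vector_mult_def cinner_def vec_eq_iff sum_2 algebra_simps)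

lemma norm_u:
  assumes "k \<in> {0..<2*pi}"
  shows "norm (u j k) = 1"
proof -
  have "complex_of_real ((norm (u j k))\<^sup>2) = 1"
    using orthonormal[OF assms, of j j] norm_power2_cinner[of "u j k"] by simp
  then have "(norm (u j k))\<^sup>2 = 1\<^sup>2" by (simp only: of_real_eq_1_iff) simp
  then show ?thesis by (subst (asm) power2_eq_iff_nonneg) auto
qed

lemma U0hat_mult: "k \<in> {0..<2*pi} \<Longrightarrow> U0hat C0 k *v w =
    (\<Sum>j\<in>UNIV. (lam j k * cinner (u j k) w) *s u j k)"
  by (simp add: eig matvec.sum_left outer_mult)

lemma cinner_sum_u: "k \<in> {0..<2*pi} \<Longrightarrow> cinner (u i k) (\<Sum>j\<in>UNIV. c j *s u j k) = c i"
  by (simp add: cinner.sum_right cinner_simps orthonormal if_distrib cong: if_cong)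

lemma sum_delta_u: "(\<Sum>j\<in>UNIV. (if j = i then c j else 0) *s u j k) = c i *s u i k"
  by (simp add: if_distrib[where f = "\<lambda>c. c *s _"] cong: if_cong)

lemma eigen: "k \<in> {0..<2*pi} \<Longrightarrow> U0hat C0 k *v u i k = lam i k *s u i k"
  using sum_delta_u[where c = "\<lambda>j. lam j k" and i = i and k = k]
      by (simp add: U0hat_mult orthonormal if_distrib cong: if_cong)

lemma norm_lam: "k \<in> {0..<2*pi} \<Longrightarrow> cmod (lam j k) = 1"
  using unitary_mat_norm[OF unitary_U0hat[OF unitary_C0], of k "u j k"]
      by (simp add: eigen cvec_norm_scale norm_u)

text \<open>Stated for positive powers: one application of the symbol already expands any vector in
  the eigenvectors, while the zeroth power would call for the resolution of the identity.\<close>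

lemma U0hat_pow_Suc:
  assumes "k \<in> {0..<2*pi}"
  shows "U0hat_pow C0 (Suc t) k w = (\<Sum>j\<in>UNIV. (lam j k ^ Suc t * cinner (u j k) w) *s u j k)"
proof (induction t)
  case (Suc t)
  show ?case
    by (subst U0hat_pow_simps(2), subst Suc) (simp add: U0hat_mult[OF assms]
        cinner_sum_u[OF assms] mult_ac)
qed (simp add: U0hat_mult[OF assms])

lemma symbol_mult: "k \<in> {0<..<2*pi} \<Longrightarrow> symbol \<xi> k *v w =
    (\<Sum>j\<in>UNIV. (phase \<xi> j k * cinner (u j k) w) *s u j k)"
  by (simp add: symbol_def matvec.sum_left outer_mult)

lemma lam_deriv:
  assumes "k \<in> {0<..<2*pi}"
  shows "(lam j has_vector_derivative deriv02 (lam j) k) (at k)"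
proof -
  have "(lam j has_vector_derivative deriv02 (lam j) k) (at k within {0..<2*pi})"
    using lam_diff[of k j] assms unfolding deriv02_def by (simp add: vector_derivative_works)
  then have "(lam j has_vector_derivative deriv02 (lam j) k) (at k within {0<..<2*pi})"
    by (rule has_vector_derivative_within_subset) auto
  then show ?thesis using assms by (simp add: at_within_open[of k "{0<..<2*pi}"])
qed

lemma u_isCont:
  assumes "k \<in> {0<..<2*pi}"
  shows "isCont (u j) k"
proof -
  have "continuous (at k within {0..<2*pi}) (u j)"
    using u_diff[of k j] assms by (intro differentiable_imp_continuous_within) auto
  then have "continuous (at k within {0<..<2*pi}) (u j)"
    by (rule continuous_within_subset) auto
  then show ?thesis using assms by (simp add: at_within_open[of k "{0<..<2*pi}"])
qed

lemma shifted_tendsto: "(\<lambda>t. k - \<xi> / real t) \<longlonglongrightarrow> k"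
  using tendsto_diff[OF tendsto_const[of k] lim_const_over_n[of \<xi>]] by simp

lemma shifted_eventually:
  assumes "k \<in> {0<..<2*pi}"
  shows "\<forall>\<^sub>F t in sequentially. k - \<xi> / real t \<in> {0<..<2*pi}"
  by (rule topological_tendstoD[OF shifted_tendsto]) (use assms in auto)

text \<open>Write the power as \<open>exp (t * Ln (f (1/t)))\<close> with
  \<open>f s = lam j (k - \<xi> * s) / lam j k\<close>. Since \<open>f 0 = 1\<close>, the logarithm
  is differentiable there, and the exponent tends to the derivative of \<open>f\<close> at
  0.\<close>

lemma ratio_tendsto:
  assumes k: "k \<in> {0<..<2*pi}"
  shows "(\<lambda>t. (lam j (k - \<xi> / real t) / lam j k) ^ t) \<longlonglongrightarrow> phase \<xi> j k"
proof -
  have l0: "lam j k \<noteq> 0" using norm_lam[of k j] k by auto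
  define f where "f s = lam j (k - \<xi> * s) / lam j k" for s
  define D where "D = - (\<xi> *\<^sub>R deriv02 (lam j) k) / lam j k"
  have "((\<lambda>s. k - \<xi> * s) has_vector_derivative - \<xi>) (at 0)"
    by (auto intro!: derivative_eq_intros)
  from vector_diff_chain_at[OF this, of "lam j" "deriv02 (lam j) k"] lam_deriv[OF k]
  have "((\<lambda>s. lam j (k - \<xi> * s)) has_vector_derivative - (\<xi> *\<^sub>R deriv02 (lam j) k)) (at 0)"
    by (simp add: o_def)
  then have f: "(f has_vector_derivative D) (at 0)"
    unfolding f_def D_def by (rule has_vector_derivative_divide)
  have "(Ln has_field_derivative 1) (at (f 0))"
    using has_field_derivative_Ln[of 1] l0 by (simp add: f_def)
  from field_vector_diff_chain_at[OF f this]
  have "((\<lambda>s. Ln (f s)) has_vector_derivative D) (at 0)" by (simp add: o_def)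
  from has_vector_derivative_sequence[OF this]
  have "(\<lambda>t. real t *\<^sub>R Ln (f (1 / real t))) \<longlonglongrightarrow> D" using l0 by (simp add: f_def)
  then have "(\<lambda>t. exp (real t *\<^sub>R Ln (f (1 / real t)))) \<longlonglongrightarrow> exp D" by (rule tendsto_exp)
  moreover have "exp D = phase \<xi> j k"
  proof -
    have "\<i> * of_real \<xi> * (\<i> * deriv02 (lam j) k / lam j k) = (\<i> * \<i>) *
        (of_real \<xi> * deriv02 (lam j) k / lam j k)"
      by (simp only: mult_ac times_divide_eq_right)
    then show ?thesis unfolding D_def phase_def by (simp add: scaleR_conv_of_real)
  qed
  moreover have "\<forall>\<^sub>F t in sequentially. exp (real t *\<^sub>R Ln (f (1 / real t))) =
      (lam j (k - \<xi> / real t) / lam j k) ^ t"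
    using shifted_eventually[OF k, of \<xi>]
  proof eventually_elim
    case (elim t)
    then have "f (1 / real t) \<noteq> 0" using norm_lam[of "k - \<xi> / real t" j] l0 by (auto simp: f_def)
    then show ?case by (simp add: scaleR_conv_of_real exp_of_nat_mult) (simp add: f_def)
  qed
  ultimately show ?thesis using Lim_transform_eventually by fastforce
qed

text \<open>The factor \<open>lam j k ^ t\<close> oscillates but is unimodular. Once it is pulled
  out of both terms, only eigenvalue ratios and eigenvectors at nearby points remain, and these
  converge.\<close>

lemma shifted_U0hat_pow_tendsto:
  assumes k: "k \<in> {0<..<2*pi}" and v: "v \<longlonglongrightarrow> w"
  shows "(\<lambda>t. U0hat_pow C0 t (k - \<xi> / real t) (v t) - U0hat_pow C0 t k (symbol \<xi> k *v w)) \<longlonglongrightarrow> 0"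
proof -
  have k': "k \<in> {0..<2*pi}" using k by auto
  define a where "a j t = (lam j (k - \<xi> / real t) / lam j k) ^ t * cinner (u j (k - \<xi> / real t))
      (v t)" for j t
  define E where "E t = (\<Sum>j\<in>UNIV. norm (a j t *s u j (k - \<xi> / real t) -
      (phase \<xi> j k * cinner (u j k) w) *s u j k))" for t
  have uc: "(\<lambda>t. u j (k - \<xi> / real t)) \<longlonglongrightarrow> u j k" for j
    by (rule isCont_tendsto_compose[OF u_isCont[OF k] shifted_tendsto])
  have "E \<longlonglongrightarrow> (\<Sum>j\<in>UNIV. norm ((phase \<xi> j k * cinner (u j k) w) *s u j k -
      (phase \<xi> j k * cinner (u j k) w) *s u j k))"
    unfolding E_def a_def by (intro tendsto_intros smult.tendsto cinner.tendsto uc v ratio_tendsto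
        k)
  then have E: "E \<longlonglongrightarrow> 0" by simp
  show ?thesis
  proof (rule Lim_null_comparison[OF _ E])
    show "\<forall>\<^sub>F t in sequentially. norm (U0hat_pow C0 t (k - \<xi> / real t) (v t) - U0hat_pow C0 t k
        (symbol \<xi> k *v w)) \<le> E t"
      using shifted_eventually[OF k, of \<xi>] eventually_gt_at_top[of 0]
    proof eventually_elim
      case (elim t)
      then obtain r where t: "t = Suc r" using gr0_implies_Suc by blast
      define q where "q = k - \<xi> / real t"
      have q: "q \<in> {0..<2*pi}" using elim by (auto simp: q_def)
      have l0: "lam j k \<noteq> 0" for j using norm_lam[OF k', of j] by auto
      have "U0hat_pow C0 t q (v t) = (\<Sum>j\<in>UNIV. lam j k ^ t *s (a j t *s u j q))"
        unfolding t U0hat_pow_Suc[OF q] using l0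
        by (intro sum.cong refl) (simp add: a_def q_def t vec_smult_distribs(6) power_divide del:
            power_Suc)
      moreover have "U0hat_pow C0 t k (symbol \<xi> k *v w) =
          (\<Sum>j\<in>UNIV. lam j k ^ t *s ((phase \<xi> j k * cinner (u j k) w) *s u j k))"
        unfolding t U0hat_pow_Suc[OF k'] symbol_mult[OF k] cinner_sum_u[OF k']
            by (simp add: vec_smult_distribs(6))
      ultimately have "U0hat_pow C0 t q (v t) - U0hat_pow C0 t k (symbol \<xi> k *v w)
         = (\<Sum>j\<in>UNIV. lam j k ^ t *s (a j t *s u j q - (phase \<xi> j k * cinner (u j k) w) *s u j k))"
        by (simp add: vec_smult_distribs(2) sum_subtractf)
      then have "norm (U0hat_pow C0 t q (v t) - U0hat_pow C0 t k (symbol \<xi> k *v w))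
         \<le> (\<Sum>j\<in>UNIV. norm (lam j k ^ t *s (a j t *s u j q - (phase \<xi> j k * cinner (u j k) w) *s u
             j k)))"
        by (simp add: norm_sum)
      also have "\<dots> = E t"
        unfolding E_def q_def cvec_norm_scale norm_power norm_lam[OF k'] power_one mult_1_left ..
      finally show ?case by (simp add: q_def)
    qed
  qed
qed

text \<open>Unitarity is inherited from the limit: the shifted and the unshifted powers are
  isometries, and their difference tends to zero.\<close>

lemma norm_symbol_vec:
  assumes k: "k \<in> {0<..<2*pi}"
  shows "norm (symbol \<xi> k *v w) = norm w"
proof -
  have "(\<lambda>t. norm (U0hat_pow C0 t (k - \<xi> / real t) w - U0hat_pow C0 t k (symbol \<xi> k *v w))) \<longlonglongrightarrow> 0"
    by (rule tendsto_norm_zero[OF shifted_U0hat_pow_tendsto[OF k tendsto_const]])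
  then have "(\<lambda>t::nat. norm w - norm (symbol \<xi> k *v w)) \<longlonglongrightarrow> 0"
    by (rule Lim_null_comparison[rotated])
       (use norm_triangle_ineq3[of "U0hat_pow C0 _ _ w" "U0hat_pow C0 _ k (symbol \<xi> k *v w)"]
           in \<open>simp add: norm_U0hat_pow unitary_C0\<close>)
  then show ?thesis by (simp add: LIMSEQ_const_iff)
qed

lemma norm_symbol_vec_le: "norm (symbol \<xi> k *v w) \<le> norm w"
proof (cases "k \<in> {0<..<2*pi}")
  case False
  then show ?thesis by (auto simp: symbol_def)
qed (simp add: norm_symbol_vec)

lemma symbol_measurable [measurable]:
  assumes [measurable]: "g \<in> borel_measurable Lc"
  shows "(\<lambda>k. symbol \<xi> k *v g k) \<in> borel_measurable Lc"
proof (rule borel_measurable_LIMSEQ_metric)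
  let ?G = "\<lambda>t k. if k \<in> {0<..<2*pi} then U0hat_inv_pow C0 t k
      (U0hat_pow C0 t (k - \<xi> / real t) (g k)) else 0"
  have [measurable]: "{0<..<2*pi} \<in> sets Lc"
    by (auto simp: sets_restrict_space image_iff intro!: bexI[of _ "{0<..<2*pi}"])
  show "?G t \<in> borel_measurable Lc" for t by measurable
  show "(\<lambda>t. ?G t k) \<longlonglongrightarrow> symbol \<xi> k *v g k" for k
  proof (cases "k \<in> {0<..<2*pi}")
    case True
    have "(\<lambda>t. U0hat_inv_pow C0 t k (U0hat_pow C0 t (k - \<xi> / real t) (g k)) - symbol \<xi> k *v g k) \<longlonglongrightarrow>
        0"
    proof (rule Lim_null_comparison[OF always_eventually
        tendsto_norm_zero[OF shifted_U0hat_pow_tendsto[OF True tendsto_const]]], rule allI)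
      fix t
      have "U0hat_inv_pow C0 t k (U0hat_pow C0 t (k - \<xi> / real t) (g k)) - symbol \<xi> k *v g k
        = U0hat_inv_pow C0 t k (U0hat_pow C0 t (k - \<xi> / real t) (g k) - U0hat_pow C0 t k
            (symbol \<xi> k *v g k))"
        by (simp add: U0hat_inv_pow_diff U0hat_inv_pow_U0hat_pow unitary_C0)
      then show "norm (U0hat_inv_pow C0 t k (U0hat_pow C0 t (k - \<xi> / real t) (g k)) - symbol \<xi> k
          *v g k)
        \<le> norm (U0hat_pow C0 t (k - \<xi> / real t) (g k) - U0hat_pow C0 t k (symbol \<xi> k *v g k))"
        by (simp add: norm_U0hat_inv_pow unitary_C0)
    qed
    then show ?thesis using True Lim_null by (simp add: LIM_zero_iff)
  qed (auto simp: symbol_def)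
qed

lemma sq_int_symbol: "sq_int g \<Longrightarrow> sq_int (\<lambda>k. symbol \<xi> k *v g k)"
  by (rule sq_int_norm_le[OF symbol_measurable[OF sq_int_measurable]])
      (auto simp: norm_symbol_vec_le)

definition vel :: "real \<Rightarrow> hil \<Rightarrow> hil" where
  "vel \<xi> h = hilF (\<lambda>k. symbol \<xi> k *v fourier (st h) k)"

lemma exp_v0_eq: "exp_v0 \<xi> lam u (st h) = st (vel \<xi> h)"
proof -
  have "exp_v0 \<xi> lam u (st h) = fourier_inv (\<lambda>k. symbol \<xi> k *v fourier (st h) k)"
    unfolding exp_v0_def by (rule fourier_inv_spike) (simp add: symbol_def phase_def)
  then show ?thesis
    by (simp add: vel_def st_hilF sq_int_symbol fourier_properties)
qed

lemma norm_vel_psum: "norm (hilF (\<lambda>k. symbol \<xi> k *v psum (st h) N k) - vel \<xi> h)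
    \<le> sqrt (1 / (2*pi) * dist2 (psum (st h) N) (fourier (st h)))"
proof -
  have F: "sq_int (fourier (st h))" by (rule fourier_properties) simp
  have "norm (hilF (\<lambda>k. symbol \<xi> k *v psum (st h) N k) - vel \<xi> h)
      \<le> sqrt (1 / (2*pi) * dist2 (\<lambda>k. symbol \<xi> k *v psum (st h) N k)
          (\<lambda>k. symbol \<xi> k *v fourier (st h) k))"
    unfolding vel_def by (intro norm_hilF_diff sq_int_symbol sq_int_psum F)
  also have "\<dots> \<le> sqrt (1 / (2*pi) * dist2 (psum (st h) N) (fourier (st h)))"
    unfolding dist2_def
  proof (intro real_sqrt_le_mono mult_left_mono integral_mono)
    show "integrable Lc (\<lambda>k. (norm (psum (st h) N k - fourier (st h) k))\<^sup>2)"
      using sq_int_diff[OF sq_int_psum F] by (simp add: sq_int_def)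
    show "integrable Lc (\<lambda>k. (norm (symbol \<xi> k *v psum (st h) N k - symbol \<xi> k *v fourier (st h)
        k))\<^sup>2)"
      using sq_int_diff[OF sq_int_symbol[OF sq_int_psum] sq_int_symbol[OF F]]
          by (simp add: sq_int_def)
    show "(norm (symbol \<xi> k *v psum (st h) N k - symbol \<xi> k *v fourier (st h) k))\<^sup>2 \<le>
        (norm (psum (st h) N k - fourier (st h) k))\<^sup>2" for k
      using norm_symbol_vec_le by (simp add: power_mono flip: matvec.diff_right)
  qed simp
  finally show ?thesis .
qed

sublocale free: unitary_coin "\<lambda>_. C0" by unfold_locales (rule unitary_C0)

text \<open>For finite sums both sides are inverse transforms of functions bounded by the constant
  \<open>K\<close>, so pointwise convergence in \<open>k\<close> passes to L2.\<close>

lemma free_limit_fsum: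
  assumes F: "finite F"
  shows "(\<lambda>t. norm (exph (\<xi> / real t) ((walkh (\<lambda>_. C0) ^^ t) (hilF (fsum F \<phi>)))
    - (walkh (\<lambda>_. C0) ^^ t) (hilF (\<lambda>k. symbol \<xi> k *v fsum F \<phi> k)))) \<longlonglongrightarrow> 0"
proof -
  define a where "a t k = U0hat_pow C0 t (k - \<xi> / real t) (fsum F \<phi> (k - \<xi> / real t))" for t k
  define b where "b t k = U0hat_pow C0 t k (symbol \<xi> k *v fsum F \<phi> k)" for t k
  define K where "K = (\<Sum>x\<in>F. norm (\<phi> x))"
  have sb: "sq_int (b t)" for t
    unfolding b_def by (intro sq_int_U0hat_pow unitary_C0 sq_int_symbol sq_int_fsum)
  have [measurable]: "(\<lambda>k. fsum F \<phi> (k - s)) \<in> borel_measurable Lc" for s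
    using fsum_measurable[of F "exp_x s \<phi>"] by (simp add: fsum_exp_x[abs_def])
  have am[measurable]: "a t \<in> borel_measurable Lc" for t unfolding a_def by measurable
  have [measurable]: "b t \<in> borel_measurable Lc" for t by (rule sq_int_measurable[OF sb])
  have na: "norm (a t k) \<le> K" for t k unfolding a_def K_def
      by (simp add: norm_U0hat_pow unitary_C0 norm_fsum_le)
  have nb: "norm (b t k) \<le> K" for t k
    unfolding b_def K_def using order_trans[OF norm_symbol_vec_le norm_fsum_le]
        by (simp add: norm_U0hat_pow unitary_C0)
  have sa: "sq_int (a t)" for t by (rule sq_int_bounded[OF am na])
  have ea: "exph (\<xi> / real t) ((walkh (\<lambda>_. C0) ^^ t) (hilF (fsum F \<phi>))) = hilF (a t)" for t
    by (simp add: st_inject[symmetric] free.st_walkh_pow st_hilF sq_int_fsum sa)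
       (simp add: a_def[abs_def] exp_x_walk_pow_fsum[OF unitary_C0 F])
  have eb: "(walkh (\<lambda>_. C0) ^^ t) (hilF (\<lambda>k. symbol \<xi> k *v fsum F \<phi> k)) = hilF (b t)" for t
    by (simp add: st_inject[symmetric] free.st_walkh_pow st_hilF sq_int_symbol sq_int_fsum sb)
       (simp add: b_def[abs_def] walk_pow_fourier_inv[OF unitary_C0 sq_int_symbol[OF sq_int_fsum]])
  have "(\<lambda>t. dist2 (a t) (b t)) \<longlonglongrightarrow> (LINT k|Lc. 0)"
    unfolding dist2_def
  proof (rule integral_dominated_convergence[where w = "\<lambda>_. (2 * K)\<^sup>2"])
    show "AE k in Lc. norm ((norm (a t k - b t k))\<^sup>2) \<le> (2 * K)\<^sup>2" for t
    proof (rule AE_I2)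
      fix k
      have "norm (a t k - b t k) \<le> 2 * K"
        using norm_triangle_ineq4[of "a t k" "b t k"] na[of t k] nb[of t k] by linarith
      then show "norm ((norm (a t k - b t k))\<^sup>2) \<le> (2 * K)\<^sup>2"
        using power_mono[of "norm (a t k - b t k)" "2 * K" 2] by simp
    qed
    show "AE k in Lc. (\<lambda>t. (norm (a t k - b t k))\<^sup>2) \<longlonglongrightarrow> 0"
    proof (rule AE_LcI[of "{0, 2*pi}"])
      fix k assume "k \<in> {0..2*pi}" "k \<notin> {0, 2*pi}"
      then have k: "k \<in> {0<..<2*pi}" by auto
      have "continuous_on UNIV (fsum F \<phi>)"
        unfolding fsum_def[abs_def] by (intro continuous_intros smult.continuous_on)
      then have "(\<lambda>t. fsum F \<phi> (k - \<xi> / real t)) \<longlonglongrightarrow> fsum F \<phi> k"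
        by (intro continuous_on_tendsto_compose[OF _ shifted_tendsto]) auto
      from shifted_U0hat_pow_tendsto[OF k this, of \<xi>] have "(\<lambda>t. a t k - b t k) \<longlonglongrightarrow> 0"
          by (simp add: a_def b_def)
      then have "(\<lambda>t. (norm (a t k - b t k))\<^sup>2) \<longlonglongrightarrow> (norm (0 :: complex^2))\<^sup>2"
          by (intro tendsto_intros)
      then show "(\<lambda>t. (norm (a t k - b t k))\<^sup>2) \<longlonglongrightarrow> 0" by simp
    qed simp
  qed (use integrable_Lc_const in auto)
  then have "(\<lambda>t. sqrt (1 / (2*pi) * dist2 (a t) (b t))) \<longlonglongrightarrow> sqrt (1 / (2*pi) * 0)"
    by (intro tendsto_intros) simp
  then have lim: "(\<lambda>t. sqrt (1 / (2*pi) * dist2 (a t) (b t))) \<longlonglongrightarrow> 0" by simp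
  show ?thesis
    unfolding ea eb by (rule tendsto_norm_zero, rule Lim_null_comparison[OF _ lim])
      (use norm_hilF_diff[OF sa sb] in auto)
qed

text \<open>The powers and \<open>exph\<close> are isometries and \<open>norm_vel_psum\<close>
  controls the velocity term, so the truncation error is uniform in time.\<close>

theorem free_limit:
  "(\<lambda>t. norm (exph (\<xi> / real t) ((walkh (\<lambda>_. C0) ^^ t) h) - (walkh (\<lambda>_. C0) ^^ t) (vel \<xi> h))) \<longlonglongrightarrow> 0"
proof (rule LIMSEQ_I)
  fix e :: real assume e: "e > 0"
  let ?U = "walkh (\<lambda>_. C0)"
  have "(\<lambda>N. sqrt (1 / (2*pi) * dist2 (psum (st h) N) (fourier (st h)))) \<longlonglongrightarrow> sqrt (1 / (2*pi) * 0)"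
    by (intro tendsto_intros fourier_properties) simp
  then have "\<forall>\<^sub>F N in sequentially. sqrt (1 / (2*pi) * dist2 (psum (st h) N) (fourier (st h))) <
      e/3"
    by (rule order_tendstoD) (use e in simp)
  moreover have "\<forall>\<^sub>F N in sequentially. dist (hilF (psum (st h) N)) h < e/3"
    using hilF_psum_tendsto[of h] e by (intro tendstoD) auto
  ultimately obtain N where N: "sqrt (1 / (2*pi) * dist2 (psum (st h) N) (fourier (st h))) < e/3"
      "dist (hilF (psum (st h) N)) h < e/3"
    using eventually_happens'[OF sequentially_bot eventually_conj] by blast
  define p where "p = hilF (psum (st h) N)"
  define q where "q = hilF (\<lambda>k. symbol \<xi> k *v psum (st h) N k)"
  have "(\<lambda>t. norm (exph (\<xi> / real t) ((?U ^^ t) p) - (?U ^^ t) q)) \<longlonglongrightarrow> 0"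
    unfolding p_def q_def psum_def by (rule free_limit_fsum) simp
  then obtain T where T: "\<And>t. t \<ge> T \<Longrightarrow> norm (exph (\<xi> / real t) ((?U ^^ t) p) - (?U ^^ t) q) < e/3"
    using LIMSEQ_D[of _ 0 "e/3"] e by force
  have "norm (norm (exph (\<xi> / real t) ((?U ^^ t) h) - (?U ^^ t) (vel \<xi> h)) - 0) < e" if "t \<ge> T"
      for t
  proof -
    have "exph (\<xi> / real t) ((?U ^^ t) h) - (?U ^^ t) (vel \<xi> h)
       = exph (\<xi> / real t) ((?U ^^ t) (h - p)) + (exph (\<xi> / real t) ((?U ^^ t) p) - (?U ^^ t) q) +
           (?U ^^ t) (q - vel \<xi> h)"
      by (simp add: linear_diff[OF free.linear_pow] exph_diff)
    then have "norm (exph (\<xi> / real t) ((?U ^^ t) h) - (?U ^^ t) (vel \<xi> h))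
       \<le> norm (h - p) + norm (exph (\<xi> / real t) ((?U ^^ t) p) - (?U ^^ t) q) + norm (q - vel \<xi> h)"
      using norm_triangle_ineq[of "exph (\<xi> / real t) ((?U ^^ t) (h - p)) +
          (exph (\<xi> / real t) ((?U ^^ t) p) - (?U ^^ t) q)" "(?U ^^ t) (q - vel \<xi> h)"]
        norm_triangle_ineq[of "exph (\<xi> / real t) ((?U ^^ t) (h - p))"
            "exph (\<xi> / real t) ((?U ^^ t) p) - (?U ^^ t) q"]
      by (simp add: norm_exph free.iso_pow)
    also have "\<dots> < e/3 + e/3 + e/3"
      using T[OF that] N norm_vel_psum[of \<xi> h N] unfolding p_def q_def dist_norm
      by (intro add_strict_mono) (auto simp: norm_minus_commute)
    finally show ?thesis by simp
  qed
  then show "\<exists>no. \<forall>t\<ge>no. norm (norm (exph (\<xi> / real t) ((?U ^^ t) h) - (?U ^^ t) (vel \<xi> h)) - 0) <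
      e" by blast
qed

end

section \<open>The absolutely continuous subspace of the free walk\<close>

context cunitary
begin

text \<open>Since \<open>f\<close> is real, moments at negative powers are the conjugates of those
  at positive ones.\<close>

lemma ac_density_natI:
  assumes "\<And>\<theta>. f \<theta> \<ge> 0" "integrable Lc f"
    and pos: "\<And>n. cip \<psi> ((A ^^ n) \<psi>) = (LINT \<theta>|Lc. expi (int n) \<theta> * of_real (f \<theta>))"
  shows "ac_density \<psi> f"
proof -
  have "cip \<psi> (zpow A n \<psi>) = (LINT \<theta>|Lc. expi n \<theta> * of_real (f \<theta>))" for n
  proof (cases "n \<ge> 0")
    case True
    then show ?thesis using pos[of "nat n"] by (simp add: zpow_def)
  next
    case False
    define m where "m = nat (- n)"
    have n: "n = - int m" using False by (simp add: m_def)
    have "cip \<psi> (zpow A n \<psi>) = cip (zpow A (int m) \<psi>) (zpow A 0 \<psi>)"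
      unfolding cip_zpow by (simp add: n)
    also have "\<dots> = cnj (cip \<psi> ((A ^^ m) \<psi>))" by (simp add: cip_simps)
    also have "\<dots> = (LINT \<theta>|Lc. cnj (expi (int m) \<theta> * of_real (f \<theta>)))"
      unfolding pos by (rule Bochner_Integration.integral_cnj[symmetric])
    also have "\<dots> = (LINT \<theta>|Lc. expi n \<theta> * of_real (f \<theta>))" by (simp add: cnj_expi n)
    finally show ?thesis .
  qed
  with assms(1,2) show ?thesis by (simp add: ac_density_def)
qed

text \<open>A Riemann-Lebesgue lemma: vectors with bounded density have square-summable
  coefficients, and they approximate \<open>\<psi>\<close> uniformly along the orbit.\<close>

lemma ac_density_weak_limit:
  assumes f: "ac_density \<psi> f"
  shows "(\<lambda>p. inner g ((A ^^ p) \<psi>)) \<longlonglongrightarrow> 0"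
proof (rule LIMSEQ_I)
  fix e :: real assume e: "e > 0"
  define d where "d = e / (2 * (norm g + 1))"
  have d: "d > 0" "d * norm g < e / 2"
    using e by (auto simp: d_def field_simps add_pos_nonneg)
  obtain \<phi> M where k: "kato_bound A M \<phi>" and n: "norm (\<psi> - \<phi>) < d"
    using ac_density_kato_approx[OF f d(1)] by blast
  obtain N where N: "\<And>p. p \<ge> N \<Longrightarrow> \<bar>inner g ((A ^^ p) \<phi>)\<bar> < e / 2"
    using LIMSEQ_D[OF kato_bound_weak_limit[OF k], of "e/2" g] e by force
  have "norm (inner g ((A ^^ p) \<psi>) - 0) < e" if "p \<ge> N" for p
  proof -
    have "inner g ((A ^^ p) \<psi>) = inner g ((A ^^ p) \<phi>) + inner g ((A ^^ p) (\<psi> - \<phi>))"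
      by (simp add: linear_diff[OF linear_pow] inner_diff_right)
    moreover have "\<bar>inner g ((A ^^ p) (\<psi> - \<phi>))\<bar> \<le> norm g * d"
      using Cauchy_Schwarz_ineq2[of g "(A ^^ p) (\<psi> - \<phi>)"]
          mult_left_mono[of "norm (\<psi> - \<phi>)" d "norm g"] n
      by (simp add: iso_pow)
    ultimately show ?thesis using N[OF that] d(2) by (simp add: mult.commute)
  qed
  then show "\<exists>no. \<forall>n\<ge>no. norm (inner g ((A ^^ n) \<psi>) - 0) < e" by blast
qed

text \<open>Even powers act as unimodular scalars, so along them the overlap of
  \<open>\<psi>\<close> with its orbit has constant modulus, while Riemann-Lebesgue sends it to
  zero.\<close>

lemma ac_density_scalar_square:
  assumes f: "ac_density \<psi> f" and sq: "\<And>h. A (A h) = cscale c h"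
  shows "\<psi> = 0"
proof (rule ccontr)
  assume nz: "\<psi> \<noteq> 0"
  have "norm \<psi> = cmod c * norm \<psi>" using sq[of \<psi>] iso[of "A \<psi>"] by (simp add: iso norm_cscale)
  then have c: "cmod c = 1" using nz by simp
  have pow: "(A ^^ (2 * r)) \<psi> = cscale (c ^ r) \<psi>" for r
    by (induction r) (simp_all add: sq cscale_cscale)
  have "(\<lambda>p. cip \<psi> ((A ^^ p) \<psi>)) \<longlonglongrightarrow> Complex 0 0"
    unfolding cip_conv_inner by (intro tendsto_Complex ac_density_weak_limit[OF f])
  then have "(\<lambda>r. cip \<psi> ((A ^^ (2 * r)) \<psi>)) \<longlonglongrightarrow> Complex 0 0"
    using LIMSEQ_subseq_LIMSEQ[of _ _ "\<lambda>r. 2 * r"] by (force simp: strict_mono_def o_def)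
  then have "(\<lambda>r. cmod (c ^ r * complex_of_real ((norm \<psi>)\<^sup>2))) \<longlonglongrightarrow> cmod (Complex 0 0)"
    unfolding pow cip_simps cip_self by (rule tendsto_norm)
  moreover have "cmod (c ^ r * complex_of_real ((norm \<psi>)\<^sup>2)) = (norm \<psi>)\<^sup>2" for r
    by (simp add: norm_mult norm_power c)
  moreover have "Complex 0 0 = 0" by (simp add: complex_eq_iff)
  ultimately have "(\<lambda>r::nat. (norm \<psi>)\<^sup>2) \<longlonglongrightarrow> 0" by (simp only: norm_zero)
  then show False using nz by (simp add: LIMSEQ_const_iff)
qed

end

lemma cinner_quadratic_tendsto:
  assumes p: "\<And>N. sq_int (p N)" and g: "sq_int g" and lim: "(\<lambda>N. dist2 (p N) g) \<longlonglongrightarrow> 0"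
    and C0: "unitary_mat C0"
  shows "(\<lambda>N. LINT k|Lc. cinner (p N k) (U0hat_pow C0 n k (p N k))) \<longlonglongrightarrow>
      (LINT k|Lc. cinner (g k) (U0hat_pow C0 n k (g k)))"
proof (rule LIMSEQ_I)
  fix e :: real assume e: "e > 0"
  define G where "G = (LINT k|Lc. (norm (g k))\<^sup>2)"
  \<comment> \<open>The weight in Young's inequality \<open>2*a*b \<le> a^2/t + t*b^2\<close>, small
    enough that the term with \<open>g\<close> costs less than \<open>e/2\<close> for every
    \<open>N\<close>.\<close>
  define t where "t = e / (2 * (G + 1))"
  have G0: "G \<ge> 0" by (simp add: G_def)
  have t: "t > 0" "t * G < e / 2" using e G0 by (auto simp: t_def field_simps add_pos_nonneg)
  have "(\<lambda>N. (1 + 1/t) * dist2 (p N) g) \<longlonglongrightarrow> (1 + 1/t) * 0" by (intro tendsto_intros lim)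
  then have "\<forall>\<^sub>F N in sequentially. (1 + 1/t) * dist2 (p N) g < e / 2"
    by (rule order_tendstoD) (use e in simp)
  then obtain N0 where N0: "\<And>N. N \<ge> N0 \<Longrightarrow> (1 + 1/t) * dist2 (p N) g < e / 2"
    unfolding eventually_sequentially by blast
  have "norm ((LINT k|Lc. cinner (p N k) (U0hat_pow C0 n k (p N k))) -
      (LINT k|Lc. cinner (g k) (U0hat_pow C0 n k (g k)))) < e"
    if "N \<ge> N0" for N
  proof -
    let ?P = "\<lambda>k. cinner (p N k) (U0hat_pow C0 n k (p N k))"
        and ?Q = "\<lambda>k. cinner (g k) (U0hat_pow C0 n k (g k))"
    have iP: "integrable Lc ?P" "integrable Lc ?Q"
      using p g C0 by (auto intro!: sq_int_cinner sq_int_U0hat_pow)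
    have iB: "integrable Lc (\<lambda>k. (1 + 1/t) * (norm (p N k - g k))\<^sup>2 + t * (norm (g k))\<^sup>2)"
      using sq_int_diff[OF p g] g by (auto simp: sq_int_def)
    have bound: "cmod (?P k - ?Q k) \<le> (1 + 1/t) * (norm (p N k - g k))\<^sup>2 + t * (norm (g k))\<^sup>2" for k
    proof -
      define a where "a = norm (p N k - g k)"
      define b where "b = norm (g k)"
      have "?P k - ?Q k = cinner (p N k - g k) (U0hat_pow C0 n k (p N k)) + cinner (g k)
          (U0hat_pow C0 n k (p N k - g k))"
        by (simp add: cinner_simps U0hat_pow_diff)
      then have "cmod (?P k - ?Q k) \<le> a * norm (p N k) + b * a"
        using norm_triangle_mono[OF norm_cinner_le norm_cinner_le, of "p N k - g k"
            "U0hat_pow C0 n k (p N k)" "g k" "U0hat_pow C0 n k (p N k - g k)"]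
        by (simp add: norm_U0hat_pow[OF C0] a_def b_def)
      also have "\<dots> \<le> a * (a + b) + b * a"
        using norm_triangle_ineq[of "p N k - g k" "g k"]
            by (intro add_right_mono mult_left_mono) (auto simp: a_def b_def)
      also have "\<dots> \<le> (1 + 1/t) * a\<^sup>2 + t * b\<^sup>2"
      proof -
        have "0 \<le> (a - t * b)\<^sup>2 / t" using t by simp
        also have "\<dots> = a\<^sup>2 / t - 2 * a * b + t * b\<^sup>2" using t
            by (simp add: power2_eq_square field_simps)
        finally show ?thesis by (simp add: power2_eq_square field_simps)
      qed
      finally show ?thesis by (simp add: a_def b_def)
    qed
    have "norm (integral\<^sup>L Lc ?P - integral\<^sup>L Lc ?Q) = norm (LINT k|Lc. ?P k - ?Q k)"
      using iP by simp
    also have "\<dots> \<le> (LINT k|Lc. (1 + 1/t) * (norm (p N k - g k))\<^sup>2 + t * (norm (g k))\<^sup>2)"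
      by (rule order_trans[OF integral_norm_bound])
          (intro integral_mono integrable_norm Bochner_Integration.integrable_diff iP iB bound)
    also have "\<dots> = (1 + 1/t) * dist2 (p N) g + t * G"
      using sq_int_diff[OF p g] g by (simp add: sq_int_def dist2_def G_def)
    also have "\<dots> < e" using N0[OF that] t(2) by linarith
    finally show ?thesis .
  qed
  then show "\<exists>no. \<forall>N\<ge>no. norm ((LINT k|Lc. cinner (p N k) (U0hat_pow C0 n k (p N k))) -
      (LINT k|Lc. cinner (g k) (U0hat_pow C0 n k (g k)))) < e"
    by blast
qed

text \<open>Change of variables \<open>y = g k\<close>: the image measure has as density
  \<open>h\<close> divided by the Jacobian at the preimage, extended by zero. This turns a weight in
  quasi-momentum into a spectral density.\<close>

lemma pushforward_density:
  fixes g g' h :: "real \<Rightarrow> real"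
  assumes S: "S \<in> sets lebesgue" "S \<subseteq> {0..2*pi}"
    and der: "\<And>k. k \<in> S \<Longrightarrow> (g has_field_derivative g' k) (at k within S)"
    and inj: "inj_on g S" and nz: "\<And>k. k \<in> S \<Longrightarrow> g' k \<noteq> 0"
    and range: "g ` S \<subseteq> {0..2*pi}" and h: "integrable Lc h" "\<And>k. h k \<ge> 0"
  obtains G where "\<And>y. G y \<ge> 0" "integrable Lc G"
    "\<And>n. ((\<lambda>k. expi n (g k) * of_real (h k)) has_integral (LINT y|Lc. expi n y * of_real (G y))) S"
proof -
  define G where "G y = (if y \<in> g ` S then h (inv_into S g y) / \<bar>g' (inv_into S g y)\<bar> else 0)" for y
  have G0: "G y \<ge> 0" for y using h(2) by (simp add: G_def)
  have Gg: "\<bar>g' k\<bar> * G (g k) = h k" if "k \<in> S" for k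
    using that inj nz by (simp add: G_def inv_into_f_f)
  have "(\<lambda>k. \<bar>g' k\<bar> *\<^sub>R G (g k)) absolutely_integrable_on S"
  proof -
    have "h absolutely_integrable_on {0..2*pi}" using h(1) by (simp add: integrable_Lc_iff)
    then have "h absolutely_integrable_on S" by (rule set_integrable_subset) (use S in auto)
    then show ?thesis by (rule absolutely_integrable_spike[OF _ negligible_empty]) (use Gg in auto)
  qed
  then have "G absolutely_integrable_on g ` S"
    using absolutely_integrable_change_of_variables_real[OF S(1) der inj] by blast
  then have "G integrable_on g ` S" by (simp add: absolutely_integrable_on_def)
  then have "G integrable_on {0..2*pi}"
    using has_integral_on_superset[of G _ "g ` S" "{0..2*pi}"] range
        by (auto simp: integrable_on_def G_def)
  then have Gint: "integrable Lc G" by (intro integrable_Lc_nonneg G0)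
  have "((\<lambda>k. expi n (g k) * of_real (h k)) has_integral (LINT y|Lc. expi n y * of_real (G y))) S"
      for n
  proof -
    let ?f = "\<lambda>y. expi n y * complex_of_real (G y)"
    have fint: "integrable Lc ?f" by (rule integrable_continuous_mult[OF Gint continuous_on_expi])
    then have fa: "?f absolutely_integrable_on {0..2*pi}" by (simp add: integrable_Lc_iff)
    have "g ` S \<in> sets lebesgue"
      by (rule differentiable_image_in_sets_lebesgue[OF S(1)])
         (use der in \<open>force simp: differentiable_on_def differentiable_def
             has_field_derivative_def\<close>)+
    with fa have fa': "?f absolutely_integrable_on g ` S"
        by (rule set_integrable_subset[OF _ _ range])
    have "integral (g ` S) ?f = integral {0..2*pi} ?f"
    proof -
      have "(?f has_integral integral (g ` S) ?f) (g ` S)"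
        using fa' by (simp add: absolutely_integrable_on_def integrable_integral)
      then have "(?f has_integral integral (g ` S) ?f) {0..2*pi}"
        by (rule has_integral_on_superset) (use range in \<open>auto simp: G_def\<close>)
      then show ?thesis by (simp add: integral_unique)
    qed
    also have "\<dots> = (LINT y|Lc. ?f y)" by (rule integral_Lc[OF fint])
    finally have "(\<lambda>k. \<bar>g' k\<bar> *\<^sub>R ?f (g k)) absolutely_integrable_on S \<and>
        integral S (\<lambda>k. \<bar>g' k\<bar> *\<^sub>R ?f (g k)) = (LINT y|Lc. ?f y)"
      using has_absolute_integral_change_of_variables_real[OF S(1) der inj, of ?f] fa' by blast
    then have "((\<lambda>k. \<bar>g' k\<bar> *\<^sub>R ?f (g k)) has_integral (LINT y|Lc. ?f y)) S"
      by (metis absolutely_integrable_on_def integrable_integral)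
    then show ?thesis
    proof (rule has_integral_eq[rotated])
      fix k assume "k \<in> S"
      have "\<bar>g' k\<bar> *\<^sub>R ?f (g k) = expi n (g k) * of_real (\<bar>g' k\<bar> * G (g k))"
        by (simp add: scaleR_conv_of_real)
      then show "\<bar>g' k\<bar> *\<^sub>R ?f (g k) = expi n (g k) * of_real (h k)" using Gg[OF \<open>k \<in> S\<close>] by simp
    qed
  qed
  with G0 Gint show thesis by (rule that)
qed

section \<open>Dispersion relation and spectral densities of the free bands\<close>

lemma unitary_mat2_entries:
  assumes "unitary_mat (M :: complex^2^2)"
  shows "cmod (M $ 1 $ 1) = cmod (M $ 2 $ 2)" "(cmod (M $ 1 $ 1))\<^sup>2 + (cmod (M $ 1 $ 2))\<^sup>2 = 1"
proof -
  have "(adjm M ** M) $ 2 $ 2 = 1" "(M ** adjm M) $ 1 $ 1 = 1"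
    using assms by (simp_all add: unitary_mat_def mat_def)
  then have "complex_of_real ((cmod (M $ 1 $ 2))\<^sup>2 + (cmod (M $ 2 $ 2))\<^sup>2) = 1"
    "complex_of_real ((cmod (M $ 1 $ 1))\<^sup>2 + (cmod (M $ 1 $ 2))\<^sup>2) = 1"
    by (simp_all add: matrix_matrix_mult_def adjm_def sum_2 cmod_square of_real_add mult.commute
        del: of_real_power)
  then have e: "(cmod (M $ 1 $ 2))\<^sup>2 + (cmod (M $ 2 $ 2))\<^sup>2 = 1"
      "(cmod (M $ 1 $ 1))\<^sup>2 + (cmod (M $ 1 $ 2))\<^sup>2 = 1"
    by (simp_all only: of_real_eq_1_iff)
  then have "(cmod (M $ 1 $ 1))\<^sup>2 = (cmod (M $ 2 $ 2))\<^sup>2" by linarith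
  then show "cmod (M $ 1 $ 1) = cmod (M $ 2 $ 2)" by (simp add: power2_eq_iff_nonneg)
  show "(cmod (M $ 1 $ 1))\<^sup>2 + (cmod (M $ 1 $ 2))\<^sup>2 = 1" by (rule e(2))
qed

context free_walk
begin

abbreviation "U0 \<equiv> walkh (\<lambda>_. C0)"

text \<open>A vanishing diagonal entry makes \<open>U0\<^sup>2\<close> a scalar (flat bands).\<close>

lemma flat_bands_no_ac:
  assumes "C0 $ 1 $ 1 = 0" "free.ac_density \<psi> f"
  shows "\<psi> = 0"
proof (rule free.ac_density_scalar_square[OF assms(2)])
  have "C0 $ 2 $ 2 = 0" using unitary_mat2_entries(1)[OF unitary_C0] assms(1) by simp
  then show "U0 (U0 h) = cscale (C0 $ 1 $ 2 * C0 $ 2 $ 1) h" for h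
    using assms(1)
    by (simp add: st_inject[symmetric] fun_eq_iff vec_eq_iff forall_2 walk_def coin_def
        matrix_vector_mult_def sum_2 mult_ac)
qed

text \<open>The characteristic equation of \<open>U0hat\<close>: the two phases cancel in the
  determinant, which is that of \<open>C0\<close>, and survive in the trace.\<close>

lemma char_poly:
  assumes k: "k \<in> {0..<2*pi}"
  shows "lam j k * lam j k + (C0$1$1 * C0$2$2 - C0$1$2 * C0$2$1)
    = (C0$1$1 * expi 1 k + C0$2$2 * expi (-1) k) * lam j k"
proof -
  define e where "e = expi 1 k"
  define e' where "e' = expi (-1) k"
  have ee: "e * e' = 1" using expi_add[of 1 "-1" k] by (simp add: e_def e'_def)
  define x where "x = u j k $ 1"
  define y where "y = u j k $ 2"
  define l where "l = lam j k"
  have 1: "e * (C0$1$1 * x + C0$1$2 * y) = l * x" "e' * (C0$2$1 * x + C0$2$2 * y) = l * y"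
    using arg_cong[OF eigen[OF k, of j], of "\<lambda>v. v $ 1"]
        arg_cong[OF eigen[OF k, of j], of "\<lambda>v. v $ 2"]
    by (simp_all add: e_def e'_def x_def y_def l_def matrix_vector_mult_def sum_2 U0hat_nth
        algebra_simps)
  have nz: "x \<noteq> 0 \<or> y \<noteq> 0"
  proof (rule ccontr)
    assume "\<not> ?thesis"
    then have "u j k = 0" by (simp add: x_def y_def vec_eq_iff forall_2)
    then show False using norm_u[OF k, of j] by simp
  qed
  let ?d = "l * l + (C0$1$1 * C0$2$2 - C0$1$2 * C0$2$1) - (C0$1$1 * e + C0$2$2 * e') * l"
  have "?d * x = 0"
  proof -
    \<comment> \<open>Cramer's rule: the adjugate of \<open>U0hat C0 k - l\<close> is applied to the
      two eigenvalue equations, with a correction term for \<open>e * e' = 1\<close>.\<close>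
    have "?d * x = (e' * C0$2$2 - l) * (e * (C0$1$1 * x + C0$1$2 * y) - l * x)
       - (e * C0$1$2) * (e' * (C0$2$1 * x + C0$2$2 * y) - l * y)
       - (e * e' - 1) * (C0$1$1 * C0$2$2 - C0$1$2 * C0$2$1) * x"
      by (simp add: algebra_simps)
    then show ?thesis using 1 ee by simp
  qed
  moreover have "?d * y = 0"
  proof -
    have "?d * y = (e * C0$1$1 - l) * (e' * (C0$2$1 * x + C0$2$2 * y) - l * y)
       - (e' * C0$2$1) * (e * (C0$1$1 * x + C0$1$2 * y) - l * x)
       - (e * e' - 1) * (C0$1$1 * C0$2$2 - C0$1$2 * C0$2$1) * y"
      by (simp add: algebra_simps)
    then show ?thesis using 1 ee by simp
  qed
  ultimately have "?d = 0" using nz by auto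
  then show ?thesis by (simp add: l_def e_def e'_def)
qed

text \<open>The diagonal entries of a unitary 2 by 2 matrix have equal modulus, so their quotient is
  a phase; halving its argument symmetrises the trace into a cosine.\<close>

lemma trace_cos:
  assumes a: "C0 $ 1 $ 1 \<noteq> 0"
  obtains \<kappa> c where "c \<noteq> 0" "\<And>k. C0$1$1 * expi 1 k + C0$2$2 * expi (-1) k = c * complex_of_real
      (cos (k - \<kappa>))"
proof -
  define d where "d = C0$2$2 / C0$1$1"
  have "cmod d = 1"
    unfolding d_def norm_divide unitary_mat2_entries(1)[OF unitary_C0, symmetric] using a by simp
  then have d: "d = cis (Arg d)" using rcis_cmod_Arg[of d] by (simp add: rcis_def)
  define \<kappa> where "\<kappa> = Arg d / 2"
  have dk: "C0$2$2 = C0$1$1 * (cis \<kappa> * cis \<kappa>)"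
  proof -
    have "cis \<kappa> * cis \<kappa> = d" using d by (simp add: cis_mult \<kappa>_def)
    then show ?thesis using a by (simp add: d_def)
  qed
  have "C0$1$1 * expi 1 k + C0$2$2 * expi (-1) k = (2 * C0$1$1 * cis \<kappa>) * complex_of_real
      (cos (k - \<kappa>))" for k
  proof -
    have e: "expi 1 k = cis k" "expi (-1) k = cis (- k)"
        by (simp_all add: expi_def cis_conv_exp mult_ac)
    have "cis k = cis \<kappa> * cis (k - \<kappa>)" "cis \<kappa> * cis (- k) = cis (- (k - \<kappa>))"
        by (simp_all add: cis_mult)
    then have "C0$1$1 * cis k + C0$2$2 * cis (- k) = C0$1$1 * cis \<kappa> *
        (cis (k - \<kappa>) + cis (- (k - \<kappa>)))"
      unfolding dk by (simp add: algebra_simps)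
    also have "cis (k - \<kappa>) + cis (- (k - \<kappa>)) = 2 * complex_of_real (cos (k - \<kappa>))"
      by (simp only: complex_eq_iff) (simp del: minus_diff_eq)
    finally show ?thesis unfolding e by (simp add: mult_ac)
  qed
  moreover have "2 * C0$1$1 * cis \<kappa> \<noteq> 0" using a by simp
  ultimately show thesis using that by blast
qed

text \<open>By the characteristic equation the eigenvalue determines the cosine, and the sign
  \<open>\<sigma>\<close> then fixes the sine as well.\<close>

lemma band_injective:
  assumes tr: "c \<noteq> 0" "\<And>k. C0$1$1 * expi 1 k + C0$2$2 * expi (-1) k = c * complex_of_real
      (cos (k - \<kappa>))"
    and k: "k \<in> {0..<2*pi}" "k' \<in> {0..<2*pi}" and lam: "lam j k = lam j k'"
    and sgn: "\<sigma> * sin (k - \<kappa>) > 0" "\<sigma> * sin (k' - \<kappa>) > 0"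
  shows "k = k'"
proof -
  have l0: "lam j k' \<noteq> 0" using norm_lam[OF k(2), of j] by auto
  have "(c * complex_of_real (cos (k - \<kappa>))) * lam j k' = (c * complex_of_real (cos (k' - \<kappa>))) *
      lam j k'"
    using char_poly[OF k(1), of j] char_poly[OF k(2), of j] lam by (auto simp: tr(2))
  then have cos: "cos (k - \<kappa>) = cos (k' - \<kappa>)" using l0 tr(1) by simp
  then have "(sin (k - \<kappa>))\<^sup>2 = (sin (k' - \<kappa>))\<^sup>2" by (simp add: sin_squared_eq)
  then have "sin (k - \<kappa>) = sin (k' - \<kappa>) \<or> sin (k - \<kappa>) = - sin (k' - \<kappa>)" by (simp add: power2_eq_iff)
  then have "sin (k - \<kappa>) = sin (k' - \<kappa>)" using sgn by auto
  with cos obtain n :: int where n: "k - \<kappa> = k' - \<kappa> + 2 * pi * n" using sin_cos_eq_iff by blast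
  have "\<bar>k - k'\<bar> < 2 * pi" using k by auto
  then have "\<bar>2 * pi * real_of_int n\<bar> < 2 * pi" using n by (simp add: algebra_simps)
  then have "\<bar>real_of_int n\<bar> < 1" by (simp add: abs_mult)
  then have "n = 0" by linarith
  then show ?thesis using n by simp
qed

text \<open>Differentiate the characteristic equation at a supposed critical point: the quadratic
  side has derivative zero, the other side leaves
  \<open>- c * sin (k - \<kappa>) * lam j k\<close>.\<close>

lemma band_noncritical:
  assumes tr: "c \<noteq> 0" "\<And>k. C0$1$1 * expi 1 k + C0$2$2 * expi (-1) k = c * complex_of_real
      (cos (k - \<kappa>))"
    and k: "k \<in> {0<..<2*pi}" and s: "sin (k - \<kappa>) \<noteq> 0"
  shows "deriv02 (lam j) k \<noteq> 0"
proof
  assume d0: "deriv02 (lam j) k = 0"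
  have k': "k \<in> {0..<2*pi}" using k by auto
  have l0: "lam j k \<noteq> 0" using norm_lam[OF k', of j] by auto
  have l: "(lam j has_vector_derivative 0) (at k)" using lam_deriv[OF k, of j] d0 by simp
  have L: "((\<lambda>k. lam j k * lam j k + (C0$1$1 * C0$2$2 - C0$1$2 * C0$2$1)) has_vector_derivative 0)
      (at k)"
    by (rule has_vector_derivative_eq_rhs) (auto intro!: derivative_eq_intros l)
  have cosd: "((\<lambda>k. complex_of_real (cos (k - \<kappa>))) has_vector_derivative complex_of_real
      (- sin (k - \<kappa>))) (at k)"
    by (rule has_vector_derivative_of_real) (auto intro!: derivative_eq_intros simp flip:
        has_real_derivative_iff_has_vector_derivative)
  have R: "((\<lambda>k. c * complex_of_real (cos (k - \<kappa>)) * lam j k) has_vector_derivative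
      c * complex_of_real (cos (k - \<kappa>)) * 0 + c * complex_of_real (- sin (k - \<kappa>)) * lam j k) (at k)"
    by (intro has_vector_derivative_mult has_vector_derivative_mult_right cosd l)
  have "((\<lambda>k. c * complex_of_real (cos (k - \<kappa>)) * lam j k) has_vector_derivative 0) (at k)"
    by (rule has_vector_derivative_transform_within_open[OF L, of "{0<..<2*pi}"])
       (use k char_poly tr(2) in auto)
  from vector_derivative_unique_at[OF R this] show False using l0 tr(1) s by simp
qed

text \<open>A branch of the argument of \<open>lam j k\<close> with its cut at the value \<open>1\<close>.\<close>

definition angle :: "2 \<Rightarrow> real \<Rightarrow> real" where
  "angle j k = Im (Ln (- lam j k)) + pi"

lemma angle_properties:
  assumes k: "k \<in> {0..<2*pi}"
  shows "expi n (angle j k) = lam j k powi n" "lam j k \<noteq> 1 \<Longrightarrow> angle j k \<in> {0..2*pi}"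
    "lam j k \<noteq> 1 \<Longrightarrow> - lam j k \<notin> \<real>\<^sub>\<le>\<^sub>0" "Re (Ln (- lam j k)) = 0"
proof -
  have l: "cmod (lam j k) = 1" by (rule norm_lam[OF k])
  then have l0: "lam j k \<noteq> 0" by auto
  show re: "Re (Ln (- lam j k)) = 0" using l0 l by simp
  have "exp (Ln (- lam j k)) = - lam j k" using l0 by (intro exp_Ln) simp
  moreover have "Ln (- lam j k) = \<i> * Im (Ln (- lam j k))" using re by (simp add: complex_eq_iff)
  ultimately have "exp (\<i> * Im (Ln (- lam j k))) = - lam j k" by simp
  then have e: "exp (\<i> * angle j k) = lam j k"
    by (simp add: angle_def distrib_left exp_add)
  show "expi n (angle j k) = lam j k powi n"
    using exp_power_int[of "\<i> * angle j k" n] by (simp add: e expi_def mult_ac)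
  show "angle j k \<in> {0..2*pi}"
    using mpi_less_Im_Ln[of "- lam j k"] Im_Ln_le_pi[of "- lam j k"] l0 by (simp add: angle_def)
  show "- lam j k \<notin> \<real>\<^sub>\<le>\<^sub>0" if "lam j k \<noteq> 1"
  proof
    assume "- lam j k \<in> \<real>\<^sub>\<le>\<^sub>0"
    then have im: "Im (lam j k) = 0" "Re (lam j k) \<ge> 0" by (simp_all add: complex_nonpos_Reals_iff)
    then have "Re (lam j k) = 1" using l by (simp add: cmod_def)
    with im that show False by (simp add: complex_eq_iff)
  qed
qed

text \<open>As the eigenvalue stays on the unit circle, its logarithmic derivative is purely
  imaginary; the imaginary part can vanish only together with the derivative itself.\<close>

lemma angle_deriv:
  assumes k: "k \<in> {0<..<2*pi}" and l1: "lam j k \<noteq> 1"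
  shows "(angle j has_field_derivative Im (deriv02 (lam j) k / lam j k)) (at k)"
    "deriv02 (lam j) k \<noteq> 0 \<Longrightarrow> Im (deriv02 (lam j) k / lam j k) \<noteq> 0"
proof -
  have k': "k \<in> {0..<2*pi}" using k by auto
  have l0: "lam j k \<noteq> 0" using norm_lam[OF k', of j] by auto
  have "((\<lambda>k. - lam j k) has_vector_derivative - deriv02 (lam j) k) (at k)"
    by (rule has_vector_derivative_minus[OF lam_deriv[OF k]])
  from field_vector_diff_chain_at[OF this has_field_derivative_Ln[OF angle_properties(3)[OF k' l1]]]
  have L: "((\<lambda>k. Ln (- lam j k)) has_vector_derivative deriv02 (lam j) k / lam j k) (at k)"
    by (simp add: o_def divide_inverse)
  have "((\<lambda>k. Im (Ln (- lam j k)) + pi) has_vector_derivative Im (deriv02 (lam j) k / lam j k) +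
      0) (at k)"
    by (intro has_vector_derivative_add has_vector_derivative_const
        bounded_linear.has_vector_derivative[OF bounded_linear_Im L])
  then show "(angle j has_field_derivative Im (deriv02 (lam j) k / lam j k)) (at k)"
    unfolding angle_def[abs_def] by (simp add: has_real_derivative_iff_has_vector_derivative)
  have R: "((\<lambda>k. Re (Ln (- lam j k))) has_vector_derivative Re (deriv02 (lam j) k / lam j k))
      (at k)"
    by (rule bounded_linear.has_vector_derivative[OF bounded_linear_Re L])
  have "((\<lambda>k. Re (Ln (- lam j k))) has_vector_derivative 0) (at k)"
    by (rule has_vector_derivative_transform_within_open[OF has_vector_derivative_const, of
        "{0<..<2*pi}"])
       (use k angle_properties(4) in auto)
  from vector_derivative_unique_at[OF R this] have "Re (deriv02 (lam j) k / lam j k) = 0" .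
  then show "Im (deriv02 (lam j) k / lam j k) \<noteq> 0" if "deriv02 (lam j) k \<noteq> 0"
    using that l0 by (metis complex_eq_iff divide_eq_0_iff zero_complex.sel)
qed

text \<open>The share of the spectral weight of \<open>h\<close> that band \<open>j\<close> carries
  at quasi-momentum \<open>k\<close>; the 2 pi is that of Parseval.\<close>

definition weight :: "hil \<Rightarrow> 2 \<Rightarrow> real \<Rightarrow> real" where
  "weight h j k = (if k \<in> {0<..<2*pi} then (cmod (cinner (u j k) (fourier (st h) k)))\<^sup>2 / (2*pi)
      else 0)"

lemma weight_nonneg: "weight h j k \<ge> 0"
  by (simp add: weight_def)

lemma weight_integrable: "integrable Lc (weight h j)"
proof -
  have F: "sq_int (fourier (st h))" by (rule fourier_properties) simp
  have [measurable]: "fourier (st h) \<in> borel_measurable Lc" by (rule sq_int_measurable[OF F])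
  have "continuous_on {0<..<2*pi} (u j)"
    using u_isCont by (intro continuous_at_imp_continuous_on) auto
  then have "(\<lambda>k. indicator {0<..<2*pi} k *\<^sub>R u j k) \<in> borel_measurable borel"
    by (intro borel_measurable_continuous_on_indicator) auto
  then have [measurable]: "(\<lambda>k. indicator {0<..<2*pi} k *\<^sub>R u j k) \<in> borel_measurable Lc"
    by (intro measurable_restrict_space1 measurable_completion) simp
  have eq: "weight h j k = (cmod (cinner (indicator {0<..<2*pi} k *\<^sub>R u j k)
      (fourier (st h) k)))\<^sup>2 / (2*pi)" for k
    by (simp add: weight_def indicator_def cinner_simps)
  have "integrable Lc (\<lambda>k. 1 / (2*pi) * (norm (fourier (st h) k))\<^sup>2)" using F
      by (simp add: sq_int_def)
  then show ?thesis
  proof (rule Bochner_Integration.integrable_bound)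
    show "weight h j \<in> borel_measurable Lc" unfolding eq[abs_def] by measurable
    show "AE k in Lc. norm (weight h j k) \<le> norm (1 / (2*pi) * (norm (fourier (st h) k))\<^sup>2)"
    proof (rule AE_I2)
      fix k
      have "(cmod (cinner (u j k) (fourier (st h) k)))\<^sup>2 \<le> (norm (fourier (st h) k))\<^sup>2"
          if "k \<in> {0<..<2*pi}"
        using norm_cinner_le[of "u j k" "fourier (st h) k"] norm_u[of k j] that
            by (intro power_mono) auto
      then show "norm (weight h j k) \<le> norm (1 / (2*pi) * (norm (fourier (st h) k))\<^sup>2)"
        by (simp add: weight_def divide_right_mono)
    qed
  qed
qed

text \<open>The sign of the sine selects one of two regions on which the band is injective; points
  on the cut of \<open>angle\<close> are removed.\<close>

definition arc :: "real \<Rightarrow> real \<Rightarrow> 2 \<Rightarrow> real set" where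
  "arc \<kappa> \<sigma> j = {k \<in> {0<..<2*pi}. \<sigma> * sin (k - \<kappa>) > 0 \<and> lam j k \<noteq> 1}"

lemma arc_density:
  assumes tr: "c \<noteq> 0" "\<And>k. C0$1$1 * expi 1 k + C0$2$2 * expi (-1) k = c * complex_of_real
      (cos (k - \<kappa>))"
  shows "\<exists>G. (\<forall>y. G y \<ge> 0) \<and> integrable Lc G \<and>
      (\<forall>n. ((\<lambda>k. expi n (angle j k) * of_real (weight h j k))
    has_integral (LINT y|Lc. expi n y * of_real (G y))) (arc \<kappa> \<sigma> j))"
proof -
  have "continuous_on {0<..<2*pi} (lam j)"
    using lam_deriv has_vector_derivative_continuous
        by (intro continuous_at_imp_continuous_on) blast
  then have "open ({0<..<2*pi} \<inter> lam j -` (- {1}))"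
    by (rule continuous_open_preimage) auto
  moreover have "open {k. \<sigma> * sin (k - \<kappa>) > 0}" by (intro open_Collect_less continuous_intros)
  ultimately have "open (({0<..<2*pi} \<inter> lam j -` (- {1})) \<inter> {k. \<sigma> * sin (k - \<kappa>) > 0})"
      by (rule open_Int)
  also have "\<dots> = arc \<kappa> \<sigma> j" by (auto simp: arc_def)
  finally have S: "arc \<kappa> \<sigma> j \<in> sets lebesgue"
      by (intro sets_completionI_sets) (simp add: borel_open)
  show ?thesis
  proof (rule pushforward_density[OF S, of "angle j" "\<lambda>k. Im (deriv02 (lam j) k / lam j k)"
      "weight h j"])
    show "arc \<kappa> \<sigma> j \<subseteq> {0..2*pi}" by (auto simp: arc_def)
    show "(angle j has_field_derivative Im (deriv02 (lam j) k / lam j k)) (at k within arc \<kappa> \<sigma> j)"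
      if "k \<in> arc \<kappa> \<sigma> j" for k
      using angle_deriv(1)[of k j] that by (auto simp: arc_def intro:
          has_field_derivative_at_within)
    show "Im (deriv02 (lam j) k / lam j k) \<noteq> 0" if "k \<in> arc \<kappa> \<sigma> j" for k
    proof -
      have k: "k \<in> {0<..<2*pi}" "lam j k \<noteq> 1" "sin (k - \<kappa>) \<noteq> 0" using that by (auto simp: arc_def)
      then show ?thesis by (intro angle_deriv(2) band_noncritical[OF tr])
    qed
    show "angle j ` arc \<kappa> \<sigma> j \<subseteq> {0..2*pi}"
      using angle_properties(2) by (force simp: arc_def)
    show "inj_on (angle j) (arc \<kappa> \<sigma> j)"
    proof (rule inj_onI)
      fix k k' assume kk: "k \<in> arc \<kappa> \<sigma> j" "k' \<in> arc \<kappa> \<sigma> j" "angle j k = angle j k'"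
      then have "lam j k = lam j k'"
        using angle_properties(1)[of k 1 j] angle_properties(1)[of k' 1 j] by (auto simp: arc_def)
      then show "k = k'" using band_injective[OF tr, of k k' j \<sigma>] kk by (auto simp: arc_def)
    qed
  qed (use weight_nonneg weight_integrable in auto)
qed

text \<open>What is left out is countable: the endpoints, the zeros of the sine, and, by
  injectivity, at most one point on the cut for each sign.\<close>

lemma arcs_exhaust:
  assumes tr: "c \<noteq> 0" "\<And>k. C0$1$1 * expi 1 k + C0$2$2 * expi (-1) k = c * complex_of_real
      (cos (k - \<kappa>))"
  shows "negligible ({0..2*pi} - (arc \<kappa> 1 j \<union> arc \<kappa> (-1) j))"
proof -
  define X where "X \<sigma> = {k \<in> {0<..<2*pi}. \<sigma> * sin (k - \<kappa>) > 0 \<and> lam j k = 1}" for \<sigma>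
  have X: "countable (X \<sigma>)" for \<sigma>
  proof (cases "X \<sigma> = {}")
    case False
    then obtain k0 where "k0 \<in> X \<sigma>" by blast
    then have "X \<sigma> \<subseteq> {k0}" using band_injective[OF tr, of _ k0 j \<sigma>] by (auto simp: X_def)
    then show ?thesis by (rule countable_subset) simp
  qed simp
  have "{0..2*pi} - (arc \<kappa> 1 j \<union> arc \<kappa> (-1) j) \<subseteq> {0, 2*pi} \<union> range
      (\<lambda>n::int. \<kappa> + real_of_int n * pi) \<union> X 1 \<union> X (-1)"
  proof
    fix k assume k: "k \<in> {0..2*pi} - (arc \<kappa> 1 j \<union> arc \<kappa> (-1) j)"
    show "k \<in> {0, 2*pi} \<union> range (\<lambda>n::int. \<kappa> + real_of_int n * pi) \<union> X 1 \<union> X (-1)"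
    proof (cases "sin (k - \<kappa>) = 0")
      case True
      then obtain n :: int where "k - \<kappa> = real_of_int n * pi" using sin_zero_iff_int2 by blast
      then have "k = \<kappa> + real_of_int n * pi" by simp
      then show ?thesis by blast
    next
      case False
      then show ?thesis using k by (auto simp: arc_def X_def not_less less_le)
    qed
  qed
  moreover have "countable ({0, 2*pi} \<union> range (\<lambda>n::int. \<kappa> + real_of_int n * pi) \<union> X 1 \<union> X (-1))"
    using X by auto
  ultimately have "countable ({0..2*pi} - (arc \<kappa> 1 j \<union> arc \<kappa> (-1) j))" by (rule countable_subset)
  then show ?thesis
    unfolding negligible_iff_null_sets by (intro null_sets_completionI
        countable_imp_null_set_lborel)
qed

text \<open>For truncations this is the adjointness of summation and \<open>fourier_inv\<close>;
  both sides then converge along the truncations of \<open>h\<close>.\<close>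

lemma cip_U0_pow: "cip h ((U0 ^^ n) h) = 1 / (2*pi) *
    (LINT k|Lc. cinner (fourier (st h) k) (U0hat_pow C0 n k (fourier (st h) k)))"
proof -
  let ?p = "psum (st h)"
  have N: "cip (hilF (?p N)) ((U0 ^^ n) (hilF (?p N))) = 1 / (2*pi) *
      (LINT k|Lc. cinner (?p N k) (U0hat_pow C0 n k (?p N k)))" for N
  proof -
    let ?I = "{- int N..int N}"
    have st: "st (hilF (?p N)) x = (if x \<in> ?I then st h x else 0)" for x
      by (simp add: st_hilF sq_int_psum) (simp add: psum_def fourier_inv_fsum)
    have su: "sq_int (\<lambda>k. U0hat_pow C0 n k (?p N k))"
        by (rule sq_int_U0hat_pow[OF unitary_C0 sq_int_psum])
    have "st ((U0 ^^ n) (hilF (?p N))) = fourier_inv (\<lambda>k. U0hat_pow C0 n k (?p N k))"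
      by (simp add: free.st_walkh_pow st_hilF sq_int_psum walk_pow_fourier_inv unitary_C0)
    then have "cip (hilF (?p N)) ((U0 ^^ n) (hilF (?p N)))
       = (\<Sum>\<^sub>\<infinity>x. cinner (if x \<in> ?I then st h x else 0)
           (fourier_inv (\<lambda>k. U0hat_pow C0 n k (?p N k)) x))"
      by (simp add: cip_def linner_def st)
    also have "\<dots> = (\<Sum>\<^sub>\<infinity>x\<in>?I. cinner (st h x) (fourier_inv (\<lambda>k. U0hat_pow C0 n k (?p N k)) x))"
      by (rule infsum_cong_neutral) (auto simp: cinner_simps)
    also have "\<dots> = 1 / (2*pi) * (LINT k|Lc. cinner (fsum ?I (st h) k) (U0hat_pow C0 n k (?p N k)))"
      by (subst cinner_fourier_inv(2)[OF sq_int_integrable[OF su]]) auto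
    finally show ?thesis by (simp add: psum_def)
  qed
  have "(\<lambda>N. cip (hilF (?p N)) ((U0 ^^ n) (hilF (?p N)))) \<longlonglongrightarrow> cip h ((U0 ^^ n) h)"
    by (intro tendsto_cip hilF_psum_tendsto bounded_linear.tendsto[OF free.bounded_linear_pow])
  moreover have "(\<lambda>N. 1 / (2*pi) * (LINT k|Lc. cinner (?p N k) (U0hat_pow C0 n k (?p N k))))
      \<longlonglongrightarrow> 1 / (2*pi) * (LINT k|Lc. cinner (fourier (st h) k) (U0hat_pow C0 n k (fourier (st h) k)))"
    by (intro tendsto_mult_left cinner_quadratic_tendsto sq_int_psum fourier_properties
        unitary_C0) auto
  ultimately show ?thesis unfolding N by (rule LIMSEQ_unique)
qed

text \<open>One further application of the unitary symbol to both arguments makes each of them an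
  expansion in eigenvectors, also when \<open>n = 0\<close>.\<close>

lemma cinner_U0hat_pow:
  assumes k: "k \<in> {0..<2*pi}"
  shows "cinner w (U0hat_pow C0 n k w) = (\<Sum>j\<in>UNIV. lam j k ^ n * of_real
      ((cmod (cinner (u j k) w))\<^sup>2))"
proof -
  have "cinner w (U0hat_pow C0 n k w) = cinner (U0hat_pow C0 1 k w) (U0hat_pow C0 (Suc n) k w)"
    using unitary_mat_cinner[OF unitary_U0hat[OF unitary_C0], of k] by simp
  also have "U0hat_pow C0 1 k w = (\<Sum>j\<in>UNIV. (lam j k * cinner (u j k) w) *s u j k)"
    using U0hat_pow_Suc[OF k, of 0 w] by simp
  also have "cinner \<dots> (U0hat_pow C0 (Suc n) k w) =
      (\<Sum>j\<in>UNIV. cnj (lam j k * cinner (u j k) w) * (lam j k ^ Suc n * cinner (u j k) w))"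
    unfolding cinner.sum_left U0hat_pow_Suc[OF k]
        by (simp add: cinner_simps cinner_sum_u[OF k] del: power_Suc)
  also have "\<dots> = (\<Sum>j\<in>UNIV. lam j k ^ n * of_real ((cmod (cinner (u j k) w))\<^sup>2))"
  proof (intro sum.cong refl)
    fix j
    have "cnj (lam j k) * lam j k = 1" using cmod_square[of "lam j k"] norm_lam[OF k, of j] by simp
    then have "cnj (lam j k * cinner (u j k) w) * (lam j k ^ Suc n * cinner (u j k) w)
       = lam j k ^ n * (cnj (cinner (u j k) w) * cinner (u j k) w)" by (simp add: mult_ac)
    then show "cnj (lam j k * cinner (u j k) w) * (lam j k ^ Suc n * cinner (u j k) w)
       = lam j k ^ n * of_real ((cmod (cinner (u j k) w))\<^sup>2)" by (simp only: cmod_square)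
  qed
  finally show ?thesis .
qed

text \<open>The density is the sum of four image densities, one for each band and each sign of the
  sine. It is matched against the nonnegative moments.\<close>

theorem free_all_ac:
  assumes "C0 $ 1 $ 1 \<noteq> 0"
  obtains f where "free.ac_density h f"
proof -
  obtain \<kappa> c where tr: "c \<noteq> 0" "\<And>k. C0$1$1 * expi 1 k + C0$2$2 * expi (-1) k = c * complex_of_real
      (cos (k - \<kappa>))"
    using trace_cos[OF assms] by blast
  define P where "P j \<sigma> G \<longleftrightarrow> (\<forall>y. G y \<ge> 0) \<and> integrable Lc G \<and>
      (\<forall>n. ((\<lambda>k. expi n (angle j k) * of_real (weight h j k))
    has_integral (LINT y|Lc. expi n y * of_real (G y))) (arc \<kappa> \<sigma> j))" for j \<sigma> G
  define G where "G j \<sigma> = (SOME G. P j \<sigma> G)" for j \<sigma>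
  have "P j \<sigma> (G j \<sigma>)" for j \<sigma>
    unfolding G_def by (rule someI_ex[of "P j \<sigma>"]) (unfold P_def, rule arc_density[OF tr])
  then have G: "\<And>j \<sigma> y. G j \<sigma> y \<ge> 0" "\<And>j \<sigma>. integrable Lc (G j \<sigma>)"
    "\<And>j \<sigma> n. ((\<lambda>k. expi n (angle j k) * of_real (weight h j k))
      has_integral (LINT y|Lc. expi n y * of_real (G j \<sigma> y))) (arc \<kappa> \<sigma> j)"
    unfolding P_def by auto
  define f where "f y = (\<Sum>j\<in>UNIV. G j 1 y + G j (-1) y)" for y
  have f0: "f y \<ge> 0" for y unfolding f_def by (intro sum_nonneg add_nonneg_nonneg G)
  have fint: "integrable Lc f" unfolding f_def
      by (intro Bochner_Integration.integrable_sum Bochner_Integration.integrable_add G)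
  have pos: "cip h ((U0 ^^ n) h) = (LINT y|Lc. expi (int n) y * of_real (f y))" for n
  proof -
    let ?w = "\<lambda>j k. expi (int n) (angle j k) * complex_of_real (weight h j k)"
    let ?I = "\<lambda>j \<sigma>. LINT y|Lc. expi (int n) y * complex_of_real (G j \<sigma> y)"
    let ?g = "\<lambda>k. 1 / (2*pi) * cinner (fourier (st h) k) (U0hat_pow C0 n k (fourier (st h) k))"
    have F: "sq_int (fourier (st h))" by (rule fourier_properties) simp
    have gi: "integrable Lc ?g" by (intro integrable_mult_right sq_int_cinner F sq_int_U0hat_pow
        unitary_C0)
    have gI: "integrable Lc (\<lambda>y. expi m y * complex_of_real (G j \<sigma> y))" for m j \<sigma>
      by (rule integrable_continuous_mult[OF G(2) continuous_on_expi])
    have "(?w j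
      has_integral (?I j 1 + ?I j (-1))) {0..2*pi}" for j
    proof -
      have "(?w j
        has_integral (?I j 1 + ?I j (-1)))
        (arc \<kappa> 1 j \<union> arc \<kappa> (-1) j)"
      proof (rule has_integral_Un[OF G(3) G(3)])
        have "arc \<kappa> 1 j \<inter> arc \<kappa> (-1) j = {}" by (auto simp: arc_def)
        then show "negligible (arc \<kappa> 1 j \<inter> arc \<kappa> (-1) j)" by simp
      qed
      then show ?thesis
      proof (rule has_integral_spike_set_eq[THEN iffD1, rotated -1])
        show "negligible {x \<in> {0..2*pi} - (arc \<kappa> 1 j \<union> arc \<kappa> (-1) j). ?w j x \<noteq> 0}"
          by (rule negligible_subset[OF arcs_exhaust[OF tr, of j]]) auto
        show "negligible {x \<in> arc \<kappa> 1 j \<union> arc \<kappa> (-1) j - {0..2*pi}. ?w j x \<noteq> 0}"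
          by (rule negligible_subset[OF negligible_empty]) (auto simp: arc_def)
      qed
    qed
    then have "((\<lambda>k. \<Sum>j\<in>UNIV. ?w j k) has_integral
      (\<Sum>j\<in>UNIV. ?I j 1 + ?I j (-1))) {0..2*pi}"
      by (intro has_integral_sum) auto
    then have "(?g has_integral
      (\<Sum>j\<in>UNIV. ?I j 1 + ?I j (-1))) {0..2*pi}"
    proof (rule has_integral_spike[of "{0, 2*pi}", rotated -1])
      fix k assume "k \<in> {0..2*pi} - {0, 2*pi}"
      then have k: "k \<in> {0<..<2*pi}" by auto
      then have k': "k \<in> {0..<2*pi}" by auto
      show "?g k = (\<Sum>j\<in>UNIV. ?w j k)"
        unfolding cinner_U0hat_pow[OF k'] sum_distrib_left
        using k by (intro sum.cong refl) (simp add: angle_properties(1)[OF k'] weight_def)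
    qed simp
    then have "integral\<^sup>L Lc ?g = (\<Sum>j\<in>UNIV. ?I j 1 + ?I j (-1))"
      by (rule trans[OF integral_Lc[OF gi, symmetric] integral_unique])
    also have "\<dots> = (\<Sum>j\<in>UNIV. LINT y|Lc. expi (int n) y * of_real (G j 1 y) + expi (int n) y *
        of_real (G j (-1) y))"
      by (intro sum.cong refl Bochner_Integration.integral_add[symmetric] gI)
    also have "\<dots> = (LINT y|Lc. (\<Sum>j\<in>UNIV. expi (int n) y * of_real (G j 1 y) + expi (int n) y *
        of_real (G j (-1) y)))"
      by (intro Bochner_Integration.integral_sum[symmetric] Bochner_Integration.integrable_add gI)
    also have "\<dots> = (LINT y|Lc. expi (int n) y * of_real (f y))"
      by (simp add: f_def sum_distrib_left distrib_left)
    finally show ?thesis unfolding cip_U0_pow by simp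
  qed
  with f0 fint show thesis by (intro that[of f] free.ac_density_natI)
qed

end

section \<open>Wave operators\<close>

text \<open>By intertwining, \<open>B\<^sup>n \<phi>\<close> is the wave limit of \<open>A\<^sup>n \<psi>\<close>.\<close>

lemma wave_limit_ac_density:
  assumes "cunitary A" "cunitary B" and lim: "(\<lambda>t. (inv B ^^ t) ((A ^^ t) \<psi>)) \<longlonglongrightarrow> \<phi>"
    and f: "cunitary.ac_density A \<psi> f"
  shows "cunitary.ac_density B \<phi> f"
proof -
  interpret A: cunitary A by fact
  interpret B: cunitary B by fact
  interpret I: cunitary "inv B" by (rule B.cunitary_inv)
  have "cip \<phi> ((B ^^ n) \<phi>) = cip \<psi> ((A ^^ n) \<psi>)" for n
  proof -
    have "(\<lambda>t. (B ^^ n) ((inv B ^^ (t + n)) ((A ^^ (t + n)) \<psi>))) \<longlonglongrightarrow> (B ^^ n) \<phi>"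
      by (intro bounded_linear.tendsto[OF B.bounded_linear_pow]
          LIMSEQ_ignore_initial_segment[OF lim])
    moreover have "(B ^^ n) ((inv B ^^ (t + n)) x) = (inv B ^^ t) x" for t x
      by (simp add: add.commute[of t] funpow_add B.pow_cancel)
    ultimately have "(\<lambda>t. (inv B ^^ t) ((A ^^ t) ((A ^^ n) \<psi>))) \<longlonglongrightarrow> (B ^^ n) \<phi>"
      by (simp add: funpow_add)
    from tendsto_cip[OF lim this]
    have "(\<lambda>t. cip ((inv B ^^ t) ((A ^^ t) \<psi>)) ((inv B ^^ t) ((A ^^ t) ((A ^^ n) \<psi>)))) \<longlonglongrightarrow> cip \<phi>
        ((B ^^ n) \<phi>)" .
    moreover have "cip ((inv B ^^ t) x) ((inv B ^^ t) y) = cip x y" for t x y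
      using I.cip_zpow_zpow[of "int t"] by simp
    moreover have "cip ((A ^^ t) x) ((A ^^ t) y) = cip x y" for t x y
      using A.cip_zpow_zpow[of "int t"] by simp
    ultimately show ?thesis by (simp add: LIMSEQ_const_iff)
  qed
  moreover have "cip \<psi> ((A ^^ n) \<psi>) = (LINT \<theta>|Lc. expi (int n) \<theta> * of_real (f \<theta>))" for n
    using f unfolding A.ac_density_def by (metis zpow_of_nat)
  ultimately show ?thesis
    using f by (intro B.ac_density_natI) (auto simp: A.ac_density_def)
qed

text \<open>Uniqueness of the projection: the difference of two candidates lies in
  \<open>Hac\<close> and is orthogonal to itself. Closure under differences is a premise because the
  linear structure of \<open>Hac\<close> is established only by the wave operators.\<close>

lemma Pac_eqI:
  assumes "p \<in> Hac V" "\<And>\<phi>. \<phi> \<in> Hac V \<Longrightarrow> linner \<phi> (\<lambda>x. \<psi> x - p x) = 0" "l2 \<psi>"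
    and diff: "\<And>p'. p' \<in> Hac V \<Longrightarrow> (\<lambda>x. p' x - p x) \<in> Hac V"
  shows "Pac V \<psi> = p"
  unfolding Pac_def
proof (rule the_equality)
  fix p' assume p': "p' \<in> Hac V \<and> (\<forall>\<phi>\<in>Hac V. linner \<phi> (\<lambda>x. \<psi> x - p' x) = 0)"
  have l2: "l2 p" "l2 p'" using assms(1) p' by (auto simp: Hac_def)
  define q where "q = (\<lambda>x. p' x - p x)"
  have q: "q \<in> Hac V" "l2 q" using diff[of p'] p' by (auto simp: q_def Hac_def)
  have "cip (hil q) (hil (\<lambda>x. \<psi> x - p x)) = 0" "cip (hil q) (hil (\<lambda>x. \<psi> x - p' x)) = 0"
    using assms(2)[OF q(1)] p' q l2 \<open>l2 \<psi>\<close> by (simp_all add: cip_def l2_diff)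
  moreover have "hil (\<lambda>x. \<psi> x - p x) = hil (\<lambda>x. \<psi> x - p' x) + hil q"
    using q l2 \<open>l2 \<psi>\<close> by (simp add: st_inject[symmetric] st_simps l2_diff q_def)
  ultimately have "cip (hil q) (hil q) = 0" by (simp add: cip_simps)
  then have "hil q = 0" by (simp add: cip_self)
  then have "q = st 0" using q by (metis st_hil)
  then show "p' = p" by (simp add: st_simps q_def fun_eq_iff)
qed (use assms in auto)

locale scattering = free_walk C0 lam u + full: unitary_coin C
  for C0 :: "complex^2^2" and lam u and C :: "int \<Rightarrow> complex^2^2" +
  assumes summable: "(\<lambda>x. onorm (\<lambda>v. (C x - C0) *v v)) summable_on UNIV"
begin

abbreviation "U \<equiv> walkh C"

lemma wave_convergent:
  assumes "free.ac_density h f"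
  shows "convergent (\<lambda>t. (inv U ^^ t) ((U0 ^^ t) h))"
proof -
  obtain s e f' where "trace_class_pair U0 U s e f'"
    using trace_class_pair_walkh[of "\<lambda>_. C0" C] unitary_C0 full.C summable by blast
  then interpret trace_class_pair U0 U s e f' .
  show ?thesis
    by (intro Cauchy_convergent wave_Cauchy free.ac_density_kato_approx[OF assms])
qed

lemma inverse_wave_convergent:
  assumes "full.ac_density h f"
  shows "convergent (\<lambda>t. (inv U0 ^^ t) ((U ^^ t) h))"
proof -
  have "(\<lambda>x. onorm (\<lambda>v. (C0 - C x) *v v)) = (\<lambda>x. onorm (\<lambda>v. (C x - C0) *v v))"
  proof
    fix x
    have "(\<lambda>v. (C0 - C x) *v v) = (\<lambda>v. - ((C x - C0) *v v))"
      by (simp add: matrix_vector_mult_diff_rdistrib)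
    then show "onorm (\<lambda>v. (C0 - C x) *v v) = onorm (\<lambda>v. (C x - C0) *v v)" by (simp add: onorm_neg)
  qed
  then obtain s e f' where "trace_class_pair U U0 s e f'"
    using trace_class_pair_walkh[of C "\<lambda>_. C0"] unitary_C0 full.C summable by metis
  then interpret trace_class_pair U U0 s e f' .
  show ?thesis
    by (intro Cauchy_convergent wave_Cauchy full.ac_density_kato_approx[OF assms])
qed

text \<open>Asymptotic completeness. The trace class condition is symmetric in the two walks, so the
  inverse wave limit \<open>g\<close> exists; since all maps are isometries, the error on the way
  back equals the error on the way there.\<close>

lemma ac_limit:
  assumes "full.ac_density p f"
  obtains g where "free.ac_density g f" "(\<lambda>t. (inv U ^^ t) ((U0 ^^ t) g)) \<longlonglongrightarrow> p" "norm g = norm p"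
proof -
  obtain g where g: "(\<lambda>t. (inv U0 ^^ t) ((U ^^ t) p)) \<longlonglongrightarrow> g"
    using inverse_wave_convergent[OF assms] by (auto simp: convergent_def)
  interpret I: cunitary "inv U" by (rule full.cunitary_inv)
  interpret I0: cunitary "inv U0" by (rule free.cunitary_inv)
  have "norm ((inv U ^^ t) ((U0 ^^ t) g) - p) = norm ((inv U0 ^^ t) ((U ^^ t) p) - g)" for t
  proof -
    have "(inv U ^^ t) ((U0 ^^ t) g) - p = (inv U ^^ t)
        ((U0 ^^ t) (g - (inv U0 ^^ t) ((U ^^ t) p)))"
      by (simp add: linear_diff[OF free.linear_pow] linear_diff[OF I.linear_pow] free.pow_cancel
          full.pow_cancel)
    then show ?thesis by (simp add: I.iso_pow free.iso_pow norm_minus_commute)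
  qed
  moreover have "(\<lambda>t. norm ((inv U0 ^^ t) ((U ^^ t) p) - g)) \<longlonglongrightarrow> 0"
    using g by (simp add: tendsto_norm_zero_iff LIM_zero_iff)
  ultimately have "(\<lambda>t. norm ((inv U ^^ t) ((U0 ^^ t) g) - p)) \<longlonglongrightarrow> 0" by simp
  then have "(\<lambda>t. (inv U ^^ t) ((U0 ^^ t) g)) \<longlonglongrightarrow> p"
    by (simp add: tendsto_norm_zero_iff LIM_zero_iff)
  moreover have "free.ac_density g f"
    by (rule wave_limit_ac_density[OF full.cunitary_walkh free.cunitary_walkh g assms])
  moreover have "norm g = norm p"
  proof -
    have "(\<lambda>t. norm ((inv U0 ^^ t) ((U ^^ t) p))) \<longlonglongrightarrow> norm g" by (rule tendsto_norm[OF g])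
    then show ?thesis by (simp add: I0.iso_pow full.iso_pow LIMSEQ_const_iff)
  qed
  ultimately show thesis by (intro that)
qed

lemma Hac_iff:
  assumes "unitary_coin D"
  shows "\<Psi> \<in> Hac (walk D) \<longleftrightarrow> l2 \<Psi> \<and> (\<exists>f. cunitary.ac_density (walkh D) (hil \<Psi>) f)"
proof -
  interpret D: unitary_coin D by fact
  show ?thesis
  proof (cases "l2 \<Psi>")
    case True
    then show ?thesis using D.ac_density_iff_Hac[of "hil \<Psi>"] by simp
  qed (simp add: Hac_def)
qed

lemma zero_ac_density:
  assumes "cunitary A"
  shows "cunitary.ac_density A 0 (\<lambda>_. 0)"
proof -
  interpret cunitary A by fact
  have "cip 0 h = 0" for h by (simp add: cip_def linner_def st_simps cinner_simps)
  then show ?thesis by (simp add: ac_density_def)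
qed

end

section \<open>Flat bands: no absolutely continuous vectors\<close>

locale scattering_flat = scattering +
  assumes flat: "C0 $ 1 $ 1 = 0"
begin

text \<open>By completeness every absolutely continuous vector of the full walk has a free partner
  of the same norm, so triviality carries over from the free walk.\<close>

lemma Hac_trivial: "Hac (walk (\<lambda>_. C0)) = {\<lambda>x. 0}" "Hac (walk C) = {\<lambda>x. 0}"
proof -
  have z: "hil (\<lambda>x. 0) = 0" by (simp add: zero_hil_def)
  have z': "\<Psi> = (\<lambda>x. 0)" if "l2 \<Psi>" "hil \<Psi> = 0" for \<Psi> using that by (metis st_hil st_simps(1))
  have 0: "h = 0" if "free.ac_density h f" for h f using flat_bands_no_ac[OF flat that] .
  show "Hac (walk (\<lambda>_. C0)) = {\<lambda>x. 0}"
    using 0 z' zero_ac_density[OF free.cunitary_walkh]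
    by (auto simp: Hac_iff[OF free.unitary_coin_axioms] z l2_zero)
  have "h = 0" if "full.ac_density h f" for h f
    using ac_limit[OF that] 0 by (metis norm_eq_zero)
  then show "Hac (walk C) = {\<lambda>x. 0}"
    using z' zero_ac_density[OF full.cunitary_walkh]
    by (auto simp: Hac_iff[OF full.unitary_coin_axioms] z l2_zero)
qed

lemma linner_zero: "linner (\<lambda>x. 0) \<psi> = 0"
  by (simp add: linner_def cinner_simps)

lemma Pac_trivial: "Pac (walk (\<lambda>_. C0)) \<psi> = (\<lambda>x. 0)" "Pac (walk C) \<psi> = (\<lambda>x. 0)"
  unfolding Pac_def Hac_trivial by (auto simp: linner_zero)

lemma pow_zero: "(walk (\<lambda>_. C0) ^^ t) (\<lambda>x. 0) = (\<lambda>x. 0)" "(walk C ^^ t) (\<lambda>x. 0) = (\<lambda>x. 0)"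
    "(inv (walk C) ^^ t) (\<lambda>x. 0) = (\<lambda>x. 0)"
proof -
  interpret I: cunitary "inv U" by (rule full.cunitary_inv)
  show "(walk (\<lambda>_. C0) ^^ t) (\<lambda>x. 0) = (\<lambda>x. 0)" "(walk C ^^ t) (\<lambda>x. 0) = (\<lambda>x. 0)"
    "(inv (walk C) ^^ t) (\<lambda>x. 0) = (\<lambda>x. 0)"
    using free.st_walkh_pow[of t 0] full.st_walkh_pow[of t 0] full.st_inv_walkh_pow[of t 0]
    by (simp_all add: linear_0[OF free.linear_pow] linear_0[OF full.linear_pow]
        linear_0[OF I.linear_pow] st_simps)
qed

lemma Wplus_trivial: "Wplus (walk C) (walk (\<lambda>_. C0)) \<psi> = (\<lambda>x. 0)"
  unfolding Wplus_def Pac_trivial pow_zero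
proof (rule the_equality)
  show "l2 (\<lambda>x. 0) \<and> (\<lambda>t. l2norm (\<lambda>x. 0 - 0)) \<longlonglongrightarrow> 0" by (simp add: l2_zero l2norm_def)
  fix \<phi> assume "l2 \<phi> \<and> (\<lambda>t::nat. l2norm (\<lambda>x. 0 - \<phi> x)) \<longlonglongrightarrow> 0"
  then have "l2 \<phi>" "norm (hil (\<lambda>x. 0 - \<phi> x)) = 0"
    using l2_diff[OF l2_zero, of \<phi>] by (auto simp: LIMSEQ_const_iff norm_hil)
  then have "(\<lambda>x. 0 - \<phi> x) = (\<lambda>x. 0)"
    using l2_diff[OF l2_zero, of \<phi>] by (metis norm_eq_zero st_hil st_simps(1))
  then show "\<phi> = (\<lambda>x. 0)" by (simp add: fun_eq_iff)
qed

end

section \<open>Dispersive bands: the wave operator as an isometry on the whole space\<close>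

locale scattering_dispersive = scattering +
  assumes dispersive: "C0 $ 1 $ 1 \<noteq> 0"
begin

definition W :: "hil \<Rightarrow> hil" where
  "W h = lim (\<lambda>t. (inv U ^^ t) ((U0 ^^ t) h))"

lemma W: "(\<lambda>t. (inv U ^^ t) ((U0 ^^ t) h)) \<longlonglongrightarrow> W h"
proof -
  obtain f where "free.ac_density h f" using free_all_ac[OF dispersive] by blast
  then show ?thesis unfolding W_def using wave_convergent by (simp add: convergent_LIMSEQ_iff)
qed

sublocale fullinv: cunitary "inv U" by (rule full.cunitary_inv)

lemma norm_W: "norm (W h) = norm h"
  using tendsto_norm[OF W[of h]] by (simp add: fullinv.iso_pow free.iso_pow LIMSEQ_const_iff)

lemma W_cscale: "W (cscale c h) = cscale c (W h)"
proof (rule LIMSEQ_unique[OF W])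
  have "(\<lambda>t. cscale c ((inv U ^^ t) ((U0 ^^ t) h))) \<longlonglongrightarrow> cscale c (W h)"
    by (rule bounded_linear.tendsto[OF bounded_linear_cscale W])
  then show "(\<lambda>t. (inv U ^^ t) ((U0 ^^ t) (cscale c h))) \<longlonglongrightarrow> cscale c (W h)"
    by (simp add: free.clin_pow fullinv.clin_pow)
qed

lemma linear_W: "linear W"
proof (rule linearI)
  show "W (g + h) = W g + W h" for g h
  proof (rule LIMSEQ_unique[OF W])
    have "(\<lambda>t. (inv U ^^ t) ((U0 ^^ t) g) + (inv U ^^ t) ((U0 ^^ t) h)) \<longlonglongrightarrow> W g + W h"
      by (intro tendsto_add W)
    then show "(\<lambda>t. (inv U ^^ t) ((U0 ^^ t) (g + h))) \<longlonglongrightarrow> W g + W h"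
      by (simp add: linear_add[OF free.linear_pow] linear_add[OF fullinv.linear_pow])
  qed
  show "W (r *\<^sub>R h) = r *\<^sub>R W h" for r h
    using W_cscale[of "of_real r"] by (simp add: cscale_of_real)
qed

lemma cip_W: "cip (W g) (W h) = cip g h"
proof -
  have "inner (W g) (W h) = inner g h" for g h by (rule isometry_inner[OF linear_W norm_W])
  then show ?thesis by (simp add: cip_conv_inner W_cscale[symmetric])
qed

lemma Hac_free: "Hac (walk (\<lambda>_. C0)) = Collect l2"
proof -
  have "\<exists>f. free.ac_density h f" for h by (rule free_all_ac[OF dispersive]) blast
  then show ?thesis by (simp add: set_eq_iff Hac_iff[OF free.unitary_coin_axioms])
qed

text \<open>One inclusion is completeness (\<open>ac_limit\<close>), the other the transport of
  densities by the wave limit. As the range of a linear map the set is now seen to be a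
  subspace.\<close>

lemma Hac_full: "Hac (walk C) = st ` range W"
proof
  show "Hac (walk C) \<subseteq> st ` range W"
  proof
    fix \<Psi> assume "\<Psi> \<in> Hac (walk C)"
    then obtain f where l: "l2 \<Psi>" and f: "full.ac_density (hil \<Psi>) f"
      by (auto simp: Hac_iff[OF full.unitary_coin_axioms])
    obtain g where "(\<lambda>t. (inv U ^^ t) ((U0 ^^ t) g)) \<longlonglongrightarrow> hil \<Psi>" using ac_limit[OF f] by blast
    then have "hil \<Psi> = W g" using LIMSEQ_unique[OF W] by metis
    then have "\<Psi> = st (W g)" using l by (metis st_hil)
    then show "\<Psi> \<in> st ` range W" by blast
  qed
  show "st ` range W \<subseteq> Hac (walk C)"
  proof clarify
    fix g
    obtain f where f: "free.ac_density g f" using free_all_ac[OF dispersive] by blast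
    have "full.ac_density (W g) f"
      by (rule wave_limit_ac_density[OF free.cunitary_walkh full.cunitary_walkh W f])
    then show "st (W g) \<in> Hac (walk C)" by (auto simp: full.ac_density_iff_Hac)
  qed
qed

lemma Pac_free: "Pac (walk (\<lambda>_. C0)) (st h) = st h"
  by (rule Pac_eqI) (auto simp: Hac_free l2_diff linner_def cinner_simps)

text \<open>The isometric image of a complete space is complete, hence closed, so the orthogonal
  projection onto it exists.\<close>

lemma Pac_full: "\<exists>g. Pac (walk C) (st h) = st (W g)"
proof -
  have "bounded_linear W"
    by (rule bounded_linear_intro[where K = 1])
        (simp_all add: linear_add[OF linear_W] linear_scale[OF linear_W] norm_W)
  then have "complete (range W)"
    by (rule complete_isometric_image[OF zero_less_one subspace_UNIV])
        (auto simp: norm_W complete_UNIV)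
  then have cl: "closed (range W)" by (rule complete_imp_closed)
  have sub: "subspace (range W)" using linear_subspace_image[OF linear_W subspace_UNIV] .
  obtain p where p: "p \<in> range W" "\<And>y. y \<in> range W \<Longrightarrow> cip y (h - p) = 0"
  proof (rule cip_projection_exists[OF sub cl])
    show "cscale \<i> y \<in> range W" if "y \<in> range W" for y
    proof -
      obtain x where "y = W x" using \<open>y \<in> range W\<close> by blast
      then have "cscale \<i> y = W (cscale \<i> x)" by (simp add: W_cscale)
      then show ?thesis by simp
    qed
  qed (rule that)
  have "Pac (walk C) (st h) = st p"
  proof (rule Pac_eqI)
    show "st p \<in> Hac (walk C)" using p(1) by (simp add: Hac_full)
    show "linner \<phi> (\<lambda>x. st h x - st p x) = 0" if "\<phi> \<in> Hac (walk C)" for \<phi>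
    proof -
      obtain y where "y \<in> range W" "\<phi> = st y" using \<open>\<phi> \<in> Hac (walk C)\<close> unfolding Hac_full by blast
      then show ?thesis using p(2)[of y] by (simp add: cip_def st_simps)
    qed
    show "(\<lambda>x. p' x - st p x) \<in> Hac (walk C)" if "p' \<in> Hac (walk C)" for p'
    proof -
      obtain y where y: "y \<in> range W" "p' = st y" using \<open>p' \<in> Hac (walk C)\<close> unfolding Hac_full
          by blast
      then have "y - p \<in> range W" using p(1) sub by (simp add: subspace_diff)
      then have "st (y - p) \<in> Hac (walk C)" by (simp add: Hac_full)
      then show ?thesis by (simp add: y st_simps)
    qed
  qed simp
  with p(1) show ?thesis by blast
qed

lemma Wplus_eq: "Wplus (walk C) (walk (\<lambda>_. C0)) (st h) = st (W h)"
proof -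
  have eq: "l2norm (\<lambda>x. (inv (walk C) ^^ t) ((walk (\<lambda>_. C0) ^^ t) (st h)) x - \<phi> x)
      = norm ((inv U ^^ t) ((U0 ^^ t) h) - hil \<phi>)" if "l2 \<phi>" for t \<phi>
    using that by (simp add: norm_hil st_simps full.st_inv_walkh_pow free.st_walkh_pow)
  show ?thesis
    unfolding Wplus_def Pac_free
  proof (rule the_equality)
    have "(\<lambda>t. norm ((inv U ^^ t) ((U0 ^^ t) h) - W h)) \<longlonglongrightarrow> 0"
      using W[of h] by (simp add: tendsto_norm_zero_iff LIM_zero_iff)
    then show "l2 (st (W h)) \<and> (\<lambda>t. l2norm (\<lambda>x. (inv (walk C) ^^ t)
        ((walk (\<lambda>_. C0) ^^ t) (st h)) x - st (W h) x)) \<longlonglongrightarrow> 0"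
      by (simp add: eq st_inverse)
    fix \<phi> assume \<phi>: "l2 \<phi> \<and> (\<lambda>t. l2norm (\<lambda>x. (inv (walk C) ^^ t) ((walk (\<lambda>_. C0) ^^ t) (st h)) x -
        \<phi> x)) \<longlonglongrightarrow> 0"
    then have "(\<lambda>t. norm ((inv U ^^ t) ((U0 ^^ t) h) - hil \<phi>)) \<longlonglongrightarrow> 0"
      using eq[of \<phi>] by simp
    then have "(\<lambda>t. (inv U ^^ t) ((U0 ^^ t) h)) \<longlonglongrightarrow> hil \<phi>"
      by (simp only: tendsto_norm_zero_iff LIM_zero_iff)
    then have "hil \<phi> = W h" using LIMSEQ_unique[OF _ W] by blast
    then show "\<phi> = st (W h)" using \<phi> by (metis st_hil)
  qed
qed

text \<open>\<open>W\<close> preserves inner products, so its adjoint is a left inverse. The adjoint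
  is evaluated on the range of \<open>W\<close>, where \<open>Pac\<close> takes its values.\<close>

lemma adj_Wplus: "adj (Wplus (walk C) (walk (\<lambda>_. C0))) (st (W g)) = st g"
  unfolding adj_def
proof (rule the_equality)
  have "linner (st g) w = linner (st (W g)) (Wplus (walk C) (walk (\<lambda>_. C0)) w)" if "l2 w" for w
    using cip_W[of g "hil w"] Wplus_eq[of "hil w"] that by (simp add: cip_def)
  then show "l2 (st g) \<and> (\<forall>w. l2 w \<longrightarrow> linner (st g) w = linner (st (W g))
      (Wplus (walk C) (walk (\<lambda>_. C0)) w))"
    by simp
  fix \<psi> assume \<psi>: "l2 \<psi> \<and> (\<forall>w. l2 w \<longrightarrow> linner \<psi> w = linner (st (W g))
      (Wplus (walk C) (walk (\<lambda>_. C0)) w))"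
  have "hil \<psi> = g"
  proof (rule cip_eqI)
    fix w
    have "linner \<psi> (st w) = linner (st (W g)) (st (W w))" using \<psi> by (simp add: Wplus_eq)
    then show "cip (hil \<psi>) w = cip g w" using \<psi> cip_W[of g w] by (simp add: cip_def)
  qed
  then show "\<psi> = st g" using \<psi> by (metis st_hil)
qed

text \<open>Replace \<open>U^t W g\<close> by \<open>U0^t g\<close>, apply the free limit, and read
  the outcome as a wave approximant again. The remaining factors are isometries, so the three errors
  simply add.\<close>

lemma asymptotic_velocity:
  "(\<lambda>t. norm ((inv U ^^ t) (exph (\<xi> / real t) ((U ^^ t) (W g))) - W (vel \<xi> g))) \<longlonglongrightarrow> 0"
proof (rule tendsto_norm_zero, rule Lim_null_comparison)
  let ?a = "\<lambda>t. norm ((inv U ^^ t) ((U0 ^^ t) g) - W g)"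
  let ?b = "\<lambda>t. norm (exph (\<xi> / real t) ((U0 ^^ t) g) - (U0 ^^ t) (vel \<xi> g))"
  let ?c = "\<lambda>t. norm ((inv U ^^ t) ((U0 ^^ t) (vel \<xi> g)) - W (vel \<xi> g))"
  have "(\<lambda>t. ?a t + ?b t + ?c t) \<longlonglongrightarrow> 0 + 0 + 0"
    by (rule tendsto_add[OF tendsto_add[OF tendsto_norm_zero[OF LIM_zero[OF W]] free_limit]
          tendsto_norm_zero[OF LIM_zero[OF W]]])
  then show "(\<lambda>t. ?a t + ?b t + ?c t) \<longlonglongrightarrow> 0" by simp
  show "\<forall>\<^sub>F t in sequentially. norm ((inv U ^^ t) (exph (\<xi> / real t) ((U ^^ t) (W g))) - W
      (vel \<xi> g)) \<le> ?a t + ?b t + ?c t"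
  proof (intro always_eventually allI)
    fix t
    let ?s = "\<xi> / real t"
    let ?x = "(inv U ^^ t) (exph ?s ((U ^^ t) (W g - (inv U ^^ t) ((U0 ^^ t) g))))"
    let ?y = "(inv U ^^ t) (exph ?s ((U0 ^^ t) g) - (U0 ^^ t) (vel \<xi> g))"
    let ?z = "(inv U ^^ t) ((U0 ^^ t) (vel \<xi> g)) - W (vel \<xi> g)"
    have "(inv U ^^ t) (exph ?s ((U ^^ t) (W g))) - W (vel \<xi> g) = ?x + ?y + ?z"
      by (simp add: linear_diff[OF full.linear_pow] linear_diff[OF fullinv.linear_pow] exph_diff
          full.pow_cancel)
    moreover have "norm (?x + ?y + ?z) \<le> norm ?x + norm ?y + norm ?z"
      using norm_triangle_ineq[of "?x + ?y" ?z] norm_triangle_ineq[of ?x ?y] by linarith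
    moreover have "norm ?x = ?a t"
      by (simp only: fullinv.iso_pow norm_exph full.iso_pow norm_minus_commute[of "W g"])
    moreover have "norm ?y = ?b t" by (rule fullinv.iso_pow)
    ultimately show "norm ((inv U ^^ t) (exph ?s ((U ^^ t) (W g))) - W (vel \<xi> g)) \<le> ?a t + ?b t +
        ?c t"
      by (simp only:)
  qed
qed

end

theorem theorem4p3:
  fixes C :: "int \<Rightarrow> complex^2^2" and C0 :: "complex^2^2"
    and lam :: "2 \<Rightarrow> real \<Rightarrow> complex" and u :: "2 \<Rightarrow> real \<Rightarrow> complex^2"
    and \<xi> :: real and \<psi> :: state
  assumes unitary_C: "\<And>x. unitary_mat (C x)"
    and unitary_C0: "unitary_mat C0"
    and A1: "\<exists>c1>0. \<exists>\<epsilon>>0. \<forall>x. x \<noteq> 0 \<longrightarrow>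
               onorm (\<lambda>v. (C x - C0) *v v) \<le> c1 * \<bar>real_of_int x\<bar> powr (-1 - \<epsilon>)"
    and eig: "\<And>k. k \<in> {0..<2*pi} \<Longrightarrow> U0hat C0 k = (\<Sum>j\<in>UNIV. outer (lam j k) (u j k))"
    and orthonormal: "\<And>k j j'. k \<in> {0..<2*pi} \<Longrightarrow> cinner (u j k) (u j' k) = (if j = j' then 1 else 0)"
    and lam_diff: "\<And>j k. k \<in> {0..<2*pi} \<Longrightarrow> lam j differentiable (at k within {0..<2*pi})"
    and A2_diff: "\<And>j k. k \<in> {0..<2*pi} \<Longrightarrow> u j differentiable (at k within {0..<2*pi})"
    and A2_cont: "\<And>j. continuous_on {0..<2*pi} (deriv02 (u j))"
    and A2_bdd: "\<And>j. bounded (deriv02 (u j) ` {0..<2*pi})"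
    and psi: "l2 \<psi>"
  shows "(\<lambda>t::nat. l2norm (\<lambda>x.
            (inv (walk C) ^^ t) (exp_x (\<xi> / real t) ((walk C ^^ t) (Pac (walk C) \<psi>))) x
          - Wplus (walk C) (walk (\<lambda>_. C0))
              (exp_v0 \<xi> lam u (adj (Wplus (walk C) (walk (\<lambda>_. C0))) (Pac (walk C) \<psi>))) x))
         \<longlonglongrightarrow> 0"
proof -
  have summable: "(\<lambda>x. onorm (\<lambda>v. (C x - C0) *v v)) summable_on UNIV"
  proof -
    obtain c1 \<epsilon> where c: "c1 > 0" "\<epsilon> > 0"
      "\<forall>x. x \<noteq> 0 \<longrightarrow> onorm (\<lambda>v. (C x - C0) *v v) \<le> c1 * \<bar>real_of_int x\<bar> powr (-1 - \<epsilon>)"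
      using A1 by blast
    then show ?thesis
      by (intro coin_difference_summable[OF c(1,2)]
          onorm_pos_le[OF matrix_vector_mul_bounded_linear]) blast
  qed
  interpret scattering C0 lam u C
    using unitary_C0 eig orthonormal lam_diff A2_diff unitary_C summable
    by (intro scattering.intro free_walk.intro unitary_coin.intro scattering_axioms.intro)
  show ?thesis
  proof (cases "C0 $ 1 $ 1 = 0")
    case True
    \<comment> \<open>Projection and wave operator are both zero here, so both sides of the claim
      are the zero state.\<close>
    interpret scattering_flat C0 lam u C by unfold_locales (rule True)
    have "exp_x s (\<lambda>x. 0) = (\<lambda>x. 0)" for s by (simp add: exp_x_def fun_eq_iff)
    then show ?thesis by (simp add: Pac_trivial Wplus_trivial pow_zero l2norm_def)
  next
    case False
    interpret scattering_dispersive C0 lam u C by unfold_locales (rule False)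
    \<comment> \<open>The projected state lies in the range of \<open>W\<close>, where the adjoint
      of the wave operator returns \<open>g\<close>; the claim then reads as
      \<open>asymptotic_velocity\<close>.\<close>
    obtain g where g: "Pac (walk C) \<psi> = st (W g)" using Pac_full[of "hil \<psi>"] psi by auto
    have "l2norm (\<lambda>x. (inv (walk C) ^^ t) (exp_x (\<xi> / real t) ((walk C ^^ t) (st (W g)))) x - st
        (W (vel \<xi> g)) x)
      = norm ((inv U ^^ t) (exph (\<xi> / real t) ((U ^^ t) (W g))) - W (vel \<xi> g))" for t
      by (simp add: norm_hil st_simps full.st_inv_walkh_pow full.st_walkh_pow)
    then show ?thesis
      using asymptotic_velocity[of \<xi> g] by (simp add: g adj_Wplus exp_v0_eq Wplus_eq)
  qed
qed

end
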